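(* Let $\{\xi(m)\}_{m\in\mathbb Z}$ and $\{\eta(m)\}_{m\in\mathbb Z}$ be uncorrelated stationary stochastic sequences whose spectral densities $f(\lambda)$ and $g(\lambda)$ satisfy $$\int_{-\pi}^{\pi}\frac{1}{f(\lambda)+g(\lambda)}\,d\lambda<\infty .$$ Let $N\ge0$, let $a(0),\ldots,a(N)$ be coefficients, $\mathbf a_N=(a(0),\ldots,a(N),0,0,\ldots)'$ and $A_N(e^{i\lambda})=\sum_{k=0}^Na(k)e^{-i\lambda k}$. Then the mean-square optimal linear estimate $\widehat A_N\xi$ of $A_N\xi=\sum_{k=0}^Na(k)\xi(-k)$ based on observations of $\xi(m)+\eta(m)$ at $m=0,-1,-2,\ldots$ is $$\widehat A_N\xi=\int_{-\pi}^{\pi}h_N(\lambda)\,dZ_{\xi+\eta}(\lambda),$$ with spectral characteristic $$h_N(\lambda)=A_N(e^{i\lambda})\frac{f(\lambda)}{f(\lambda)+g(\lambda)}-\frac{\sum_{k=0}^\infty(\mathbf P^{-1}\mathbf R_N\mathbf a_N)_k\,e^{i\lambda(k+1)}}{f(\lambda)+g(\lambda)},$$ and its mean-square error $\Delta(f,g;\widehat A_N\xi)=\mathsf E|A_N\xi-\widehat A_N\xi|^2$ is $$\begin{aligned}\Delta(f,g;\widehat A_N\xi)&=\frac1{2\pi}\int_{-\pi}^{\pi}\frac{\left|A_N(e^{i\lambda})g(\lambda)+\sum_{k=0}^\infty(\mathbf P^{-1}\mathbf R_N\mathbf a_N)_ke^{i\lambda(k+1)}\right|^2}{(f(\lambda)+g(\lambda))^2}f(\lambda)\,d\lambda\\&\quad+\frac1{2\pi}\int_{-\pi}^{\pi}\frac{\left|A_N(e^{i\lambda})f(\lambda)-\sum_{k=0}^\infty(\mathbf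 P^{-1}\mathbf R_N\mathbf a_N)_ke^{i\lambda(k+1)}\right|^2}{(f(\lambda)+g(\lambda))^2}g(\lambda)\,d\lambda\\&=\langle\mathbf R_N\mathbf a_N,\mathbf P^{-1}\mathbf R_N\mathbf a_N\rangle+\langle\mathbf Q_N\mathbf a_N,\mathbf a_N\rangle .\end{aligned}$$ Moreover, if $f(\lambda)+g(\lambda)$ admits the canonical factorization $$\frac1{f(\lambda)+g(\lambda)}=\left|\sum_{k=0}^\infty\psi(k)e^{-i\lambda k}\right|^2=\left|\sum_{k=0}^\infty\theta(k)e^{-i\lambda k}\right|^{-2},$$ then in these formulas $\mathbf P^{-1}=\overline{\Theta}\,\Theta'$.
   Context: All sequences are zero-mean, wide-sense stationary, complex-valued, with finite second moments; $\xi$ and $\eta$ are mutually uncorrelated, with spectral densities $f,g\ge0$ (integrable on $[-\pi,\pi)$), normalized so that $\mathsf E\,\xi(m+k)\overline{\xi(m)}=\frac1{2\pi}\int_{-\pi}^{\pi}e^{ik\lambda}f(\lambda)d\lambda$, and similarly for $\eta,g$. Spectral representations: $\xi(m)=\int_{-\pi}^{\pi}e^{im\lambda}dZ_\xi(\lambda)$, $\eta(m)=\int_{-\pi}^{\pi}e^{im\lambda}dZ_\eta(\lambda)$, with $Z_\xi,Z_\eta$ having uncorrelated increments, and $Z_{\xi+\eta}=Z_\xi+Z_\eta$. Let $H$ be the Hilbert space of zero-mean, finite-variance random variables and $H^0(\xi+\eta)$ the closed linear span in $H$ of $\{\xi(m)+\eta(m):m=0,-1,-2,\ldots\}$. The mean-square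 optimal linear estimate of an element of $H$ is its orthogonal projection onto $H^0(\xi+\eta)$; the spectral characteristic of an estimate is the function $h\in L_2(f+g)$ representing it as $\int h\,dZ_{\xi+\eta}$. Inner product on $\ell_2$: $\langle x,y\rangle=\sum_{k\ge0}x_k\overline{y_k}$. $\mathbf P,\mathbf R_N,\mathbf Q_N$ are the linear operators on $\ell_2$ given by the matrices $$(\mathbf P)_{l,k}=\frac1{2\pi}\int_{-\pi}^{\pi}\frac{e^{i\lambda(k-l)}}{f(\lambda)+g(\lambda)}d\lambda\quad(l,k\ge0),$$ $$(\mathbf R_N)_{l,m}=\frac1{2\pi}\int_{-\pi}^{\pi}e^{-i\lambda(l+1+m)}\frac{f(\lambda)}{f(\lambda)+g(\lambda)}d\lambda\ \ (l\ge0,\ 0\le m\le N),\qquad(\mathbf R_N)_{l,m}=0\ \ (l\ge 0,\ m>N),$$ $$(\mathbf Q_N)_{l,k}=\frac1{2\pi}\int_{-\pi}^{\pi}e^{i\lambda(l-k)}\frac{f(\lambda)g(\lambda)}{f(\lambda)+g(\lambda)}d\lambda\ \ (0\le l,k\le N),\qquad(\mathbf Q_N)_{l,k}=0\ \text{ otherwise.}$$ It is understood that these matrices define linear operators on $\ell_2$ and that $\mathbf P$ is invertible. $(x)_k$ is the $k$th coordinate of $x$ ($k\ge0$). In the canonical factorization, $\psi,\theta$ are square-summable sequences whose power series are reciprocal: $\left(\sum_{k\ge0}\psi(k)e^{-i\lambda k}\right)\left(\sum_{k\ge0}\theta(k)e^{-i\lambda k}\right)=1$. $\Theta$ is the linear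 operator on $\ell_2$ with matrix $(\Theta)_{k,j}=\theta(k-j)$ for $0\le j\le k$ and $0$ for $0\le k<j$; $\Theta'$ is its transpose and $\overline\Theta$ its entrywise complex conjugate. *)

theory Defs
  imports "HOL-Probability.Probability"
begin

text \<open>Elements of \<open>L\<^sub>2\<close> spaces are represented by functions; equality of elements is equality
  almost everywhere.\<close>

definition sq_int :: "'b measure \<Rightarrow> ('b \<Rightarrow> complex) \<Rightarrow> bool" where
  "sq_int \<mu> X \<longleftrightarrow> X \<in> borel_measurable \<mu> \<and> integrable \<mu> (\<lambda>t. (cmod (X t))\<^sup>2)"

definition ms_tendsto :: "'b measure \<Rightarrow> (nat \<Rightarrow> 'b \<Rightarrow> complex) \<Rightarrow> ('b \<Rightarrow> complex) \<Rightarrow> bool" where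
  "ms_tendsto \<mu> X Y \<longleftrightarrow> (\<forall>n. sq_int \<mu> (X n)) \<and> sq_int \<mu> Y \<and>
     (\<lambda>n. LINT t|\<mu>. (cmod (X n t - Y t))\<^sup>2) \<longlonglongrightarrow> 0"

definition circ :: "real measure" where
  "circ = restrict_space lborel {-pi..<pi}"

definition circ_mean :: "(real \<Rightarrow> complex) \<Rightarrow> complex" where
  "circ_mean F = (LINT x|circ. F x) / (2 * of_real pi)"

definition spec_measure :: "(real \<Rightarrow> real) \<Rightarrow> real measure" where
  "spec_measure w = density circ (\<lambda>x. ennreal (w x / (2 * pi)))"

text \<open>For square-summable \<open>c\<close> and injective \<open>e\<close>, the series \<open>\<Sum>k. c k * exp (\<i> * e k * x)\<close> is
  understood as a limit in \<open>L\<^sub>2\<close> of the interval. The limit exists and is unique up to a null set;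
  the definition picks one representative.\<close>

definition trig_series :: "(nat \<Rightarrow> int) \<Rightarrow> (nat \<Rightarrow> complex) \<Rightarrow> real \<Rightarrow> complex" where
  "trig_series e c = (SOME F. ms_tendsto circ (\<lambda>n x. \<Sum>k<n. c k * cis (of_int (e k) * x)) F)"

definition l2 :: "(nat \<Rightarrow> complex) set" where
  "l2 = {x. summable (\<lambda>k. (cmod (x k))\<^sup>2)}"

definition l2_inner :: "(nat \<Rightarrow> complex) \<Rightarrow> (nat \<Rightarrow> complex) \<Rightarrow> complex" where
  "l2_inner x y = (\<Sum>k. x k * cnj (y k))"

definition mat_app :: "(nat \<Rightarrow> nat \<Rightarrow> complex) \<Rightarrow> (nat \<Rightarrow> complex) \<Rightarrow> nat \<Rightarrow> complex" where
  "mat_app A x = (\<lambda>l. \<Sum>k. A l k * x k)"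

text \<open>The matrix defines a linear operator on all of \<open>\<ell>\<^sub>2\<close>. Boundedness is not
  part of the definition (it is a consequence).\<close>

definition l2_matrix :: "(nat \<Rightarrow> nat \<Rightarrow> complex) \<Rightarrow> bool" where
  "l2_matrix A \<longleftrightarrow> (\<forall>x\<in>l2. (\<forall>l. summable (\<lambda>k. A l k * x k)) \<and> mat_app A x \<in> l2)"

definition l2_invertible :: "(nat \<Rightarrow> nat \<Rightarrow> complex) \<Rightarrow> bool" where
  "l2_invertible A \<longleftrightarrow> bij_betw (mat_app A) l2 l2"

definition l2_inverse :: "(nat \<Rightarrow> nat \<Rightarrow> complex) \<Rightarrow> (nat \<Rightarrow> complex) \<Rightarrow> nat \<Rightarrow> complex" where
  "l2_inverse A = inv_into l2 (mat_app A)"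

definition P_mat :: "(real \<Rightarrow> real) \<Rightarrow> (real \<Rightarrow> real) \<Rightarrow> nat \<Rightarrow> nat \<Rightarrow> complex" where
  "P_mat f g l k = circ_mean (\<lambda>x. cis (x * (real k - real l)) / of_real (f x + g x))"

definition R_mat :: "(real \<Rightarrow> real) \<Rightarrow> (real \<Rightarrow> real) \<Rightarrow> nat \<Rightarrow> nat \<Rightarrow> nat \<Rightarrow> complex" where
  "R_mat f g N l m =
     (if m \<le> N
      then circ_mean (\<lambda>x. cis (- x * real (l + 1 + m)) * of_real (f x / (f x + g x)))
      else 0)"

definition Q_mat :: "(real \<Rightarrow> real) \<Rightarrow> (real \<Rightarrow> real) \<Rightarrow> nat \<Rightarrow> nat \<Rightarrow> nat \<Rightarrow> complex" where
  "Q_mat f g N l k =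
     (if l \<le> N \<and> k \<le> N
      then circ_mean (\<lambda>x. cis (x * (real l - real k)) * of_real (f x * g x / (f x + g x)))
      else 0)"

definition Theta_mat :: "(nat \<Rightarrow> complex) \<Rightarrow> nat \<Rightarrow> nat \<Rightarrow> complex" where
  "Theta_mat \<theta> k j = (if j \<le> k then \<theta> (k - j) else 0)"

text \<open>That the two power series are reciprocal is expressed by their boundary values.\<close>

definition canonical_factorization ::
    "(real \<Rightarrow> real) \<Rightarrow> (nat \<Rightarrow> complex) \<Rightarrow> (nat \<Rightarrow> complex) \<Rightarrow> bool" where
  "canonical_factorization w \<psi> \<theta> \<longleftrightarrow> \<psi> \<in> l2 \<and> \<theta> \<in> l2 \<and>
     (AE x in circ.
        trig_series (\<lambda>k. - int k) \<psi> x * trig_series (\<lambda>k. - int k) \<theta> x = 1 \<and>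
        1 / w x = (cmod (trig_series (\<lambda>k. - int k) \<psi> x))\<^sup>2 \<and>
        1 / w x = 1 / (cmod (trig_series (\<lambda>k. - int k) \<theta> x))\<^sup>2)"

definition rv_space :: "'a measure \<Rightarrow> ('a \<Rightarrow> complex) set" where
  "rv_space M = {X. sq_int M X \<and> (LINT \<omega>|M. X \<omega>) = 0}"

definition cov :: "'a measure \<Rightarrow> ('a \<Rightarrow> complex) \<Rightarrow> ('a \<Rightarrow> complex) \<Rightarrow> complex" where
  "cov M X Y = (LINT \<omega>|M. X \<omega> * cnj (Y \<omega>))"

definition spectral_density :: "(real \<Rightarrow> real) \<Rightarrow> bool" where
  "spectral_density f \<longleftrightarrow> integrable circ f \<and> (\<forall>x\<in>{-pi..<pi}. 0 \<le> f x)"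

text \<open>Wide-sense stationarity is contained in the last condition: the covariance
  does not depend on \<open>m\<close>.\<close>

definition stationary_with ::
    "'a measure \<Rightarrow> (int \<Rightarrow> 'a \<Rightarrow> complex) \<Rightarrow> (real \<Rightarrow> real) \<Rightarrow> bool" where
  "stationary_with M \<xi> f \<longleftrightarrow> spectral_density f \<and> (\<forall>m. \<xi> m \<in> rv_space M) \<and>
     (\<forall>m k. cov M (\<xi> (m + k)) (\<xi> m) = circ_mean (\<lambda>x. cis (of_int k * x) * of_real (f x)))"

definition uncorrelated ::
    "'a measure \<Rightarrow> (int \<Rightarrow> 'a \<Rightarrow> complex) \<Rightarrow> (int \<Rightarrow> 'a \<Rightarrow> complex) \<Rightarrow> bool" where
  "uncorrelated M \<xi> \<eta> \<longleftrightarrow> (\<forall>m n. cov M (\<xi> m) (\<eta> n) = 0)"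

text \<open>A process on the interval with uncorrelated increments whose structure function has the
  density \<open>w / (2 * \<pi>)\<close>.\<close>

definition spectral_process ::
    "'a measure \<Rightarrow> (real \<Rightarrow> real) \<Rightarrow> (real \<Rightarrow> 'a \<Rightarrow> complex) \<Rightarrow> bool" where
  "spectral_process M w Z \<longleftrightarrow>
     (\<forall>t\<in>{-pi..pi}. Z t \<in> rv_space M) \<and>
     (\<forall>s t u v. -pi \<le> s \<and> s \<le> t \<and> t \<le> u \<and> u \<le> v \<and> v \<le> pi \<longrightarrow>
        cov M (\<lambda>\<omega>. Z t \<omega> - Z s \<omega>) (\<lambda>\<omega>. Z v \<omega> - Z u \<omega>) = 0) \<and>
     (\<forall>s t. -pi \<le> s \<and> s \<le> t \<and> t \<le> pi \<longrightarrow>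
        (LINT \<omega>|M. (cmod (Z t \<omega> - Z s \<omega>))\<^sup>2) = (LBINT x:{s..<t}. w x) / (2 * pi))"

text \<open>The integral with respect to \<open>Z\<close> of a step function, and its mean-square extension to
  \<open>L\<^sub>2(w)\<close>, where \<open>w\<close> is the spectral density of \<open>Z\<close>.\<close>

definition step_integral ::
    "(real \<Rightarrow> 'a \<Rightarrow> complex) \<Rightarrow> (real \<Rightarrow> complex) \<Rightarrow> ('a \<Rightarrow> complex) \<Rightarrow> bool" where
  "step_integral Z s X \<longleftrightarrow> (\<exists>(n::nat) c u v.
     (\<forall>j<n. -pi \<le> u j \<and> u j \<le> v j \<and> v j \<le> pi) \<and>
     s = (\<lambda>x. \<Sum>j<n. c j * indicator {u j..<v j} x) \<and>
     X = (\<lambda>\<omega>. \<Sum>j<n. c j * (Z (v j) \<omega> - Z (u j) \<omega>)))"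

definition has_stoch_integral ::
    "'a measure \<Rightarrow> (real \<Rightarrow> real) \<Rightarrow> (real \<Rightarrow> 'a \<Rightarrow> complex) \<Rightarrow> (real \<Rightarrow> complex) \<Rightarrow>
     ('a \<Rightarrow> complex) \<Rightarrow> bool" where
  "has_stoch_integral M w Z h X \<longleftrightarrow> (\<exists>s S. (\<forall>n. step_integral Z (s n) (S n)) \<and>
     ms_tendsto (spec_measure w) s h \<and> ms_tendsto M S X)"

definition spectral_representation ::
    "'a measure \<Rightarrow> (int \<Rightarrow> 'a \<Rightarrow> complex) \<Rightarrow> (real \<Rightarrow> real) \<Rightarrow> (real \<Rightarrow> 'a \<Rightarrow> complex) \<Rightarrow> bool" where
  "spectral_representation M \<xi> f Z \<longleftrightarrow> spectral_process M f Z \<and>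
     (\<forall>m. has_stoch_integral M f Z (\<lambda>x. cis (of_int m * x)) (\<xi> m))"

text \<open>The closed linear span of \<open>\<zeta> 0, \<zeta> (-1), \<dots>\<close>: every finite linear combination
  has the form \<open>\<Sum>j\<le>r. c j * \<zeta> (-j)\<close>.\<close>

definition past_space :: "'a measure \<Rightarrow> (int \<Rightarrow> 'a \<Rightarrow> complex) \<Rightarrow> ('a \<Rightarrow> complex) set" where
  "past_space M \<zeta> = {X \<in> rv_space M. \<exists>Y. ms_tendsto M Y X \<and>
     (\<forall>n. \<exists>r c. Y n = (\<lambda>\<omega>. \<Sum>j\<le>r. c j * \<zeta> (- int j) \<omega>))}"

definition orth_projection ::
    "'a measure \<Rightarrow> ('a \<Rightarrow> complex) set \<Rightarrow> ('a \<Rightarrow> complex) \<Rightarrow> ('a \<Rightarrow> complex) \<Rightarrow> bool" where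
  "orth_projection M S Y X \<longleftrightarrow> X \<in> S \<and> (\<forall>U\<in>S. cov M (\<lambda>\<omega>. Y \<omega> - X \<omega>) U = 0)"

definition optimal_estimate ::
    "'a measure \<Rightarrow> (int \<Rightarrow> 'a \<Rightarrow> complex) \<Rightarrow> ('a \<Rightarrow> complex) \<Rightarrow> ('a \<Rightarrow> complex) \<Rightarrow> bool" where
  "optimal_estimate M \<zeta> Y X \<longleftrightarrow> orth_projection M (past_space M \<zeta>) Y X"

definition mean_square_error :: "'a measure \<Rightarrow> ('a \<Rightarrow> complex) \<Rightarrow> ('a \<Rightarrow> complex) \<Rightarrow> real" where
  "mean_square_error M Y X = (LINT \<omega>|M. (cmod (Y \<omega> - X \<omega>))\<^sup>2)"

definition pad :: "nat \<Rightarrow> (nat \<Rightarrow> complex) \<Rightarrow> nat \<Rightarrow> complex" where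
  "pad N a k = (if k \<le> N then a k else 0)"

definition A_poly :: "nat \<Rightarrow> (nat \<Rightarrow> complex) \<Rightarrow> real \<Rightarrow> complex" where
  "A_poly N a x = (\<Sum>k\<le>N. a k * cis (- (real k * x)))"

definition A_functional ::
    "nat \<Rightarrow> (nat \<Rightarrow> complex) \<Rightarrow> (int \<Rightarrow> 'a \<Rightarrow> complex) \<Rightarrow> 'a \<Rightarrow> complex" where
  "A_functional N a \<xi> \<omega> = (\<Sum>k\<le>N. a k * \<xi> (- int k) \<omega>)"

definition C_series ::
    "(real \<Rightarrow> real) \<Rightarrow> (real \<Rightarrow> real) \<Rightarrow> nat \<Rightarrow> (nat \<Rightarrow> complex) \<Rightarrow> real \<Rightarrow> complex" where
  "C_series f g N a =
     trig_series (\<lambda>k. int k + 1) (l2_inverse (P_mat f g) (mat_app (R_mat f g N) (pad N a)))"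

definition spectral_char ::
    "(real \<Rightarrow> real) \<Rightarrow> (real \<Rightarrow> real) \<Rightarrow> nat \<Rightarrow> (nat \<Rightarrow> complex) \<Rightarrow> real \<Rightarrow> complex" where
  "spectral_char f g N a x =
     A_poly N a x * of_real (f x / (f x + g x)) - C_series f g N a x / of_real (f x + g x)"

end

theory Submission
  imports Defs
begin

text \<open>
  Write \<open>w = f + g\<close>. Since signal and noise are uncorrelated, an estimate with characteristic \<open>h\<close> has an error
  whose squared norm is the mean of \<open>\<bar>A - h\<bar>\<^sup>2 f + \<bar>h\<bar>\<^sup>2 g\<close> on the circle, and its error is orthogonal to the observations at
  the times \<open>0, -1, -2, \<dots>\<close> if and only if \<open>A f - h w\<close> has no coefficients at nonpositive frequencies. So \<open>A f - h w = C\<close>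
  for a series \<open>C\<close> in positive frequencies, that is, \<open>h = A f / w - C / w\<close>. The coefficients \<open>c\<close> of \<open>C\<close> are determined by
  the other requirement on \<open>h\<close>: it must lie in the closed span of the exponentials with nonpositive
  frequencies. Comparing coefficients at positive frequencies gives the system \<open>P c = R a\<close>, because \<open>P\<close> is the
  Toeplitz matrix of \<open>1 / w\<close> (lemmas \<open>y_coeff\<close>, \<open>fourier_UC\<close>). The error formulas follow by inserting \<open>h\<close>
  (\<open>error_density_identity\<close>, \<open>inner_y_c\<close>, \<open>inner_Q_a\<close>).

  Two points need work. The first is that a square-integrable \<open>h\<close> without positive frequencies belongs to the
  span in \<open>L\<^sub>2(w)\<close>, and that \<open>C / w\<close> is square-integrable at all. This holds because the hypotheses on \<open>P\<close> force
  \<open>w\<close> and \<open>1 / w\<close> to be bounded (\<open>spectral_density_bounds\<close>). By the uniform boundedness principle a matrix that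
  maps \<open>l2\<close> into \<open>l2\<close> is bounded, and so is its inverse by symmetry; bounds for the matrices become
  inequalities \<open>mean (\<bar>p\<bar>\<^sup>2 v) \<ge> 0\<close> for all polynomials \<open>p\<close>, and these imply \<open>v \<ge> 0\<close> almost everywhere by the
  Stone-Weierstrass theorem and outer regularity (\<open>AE_nonneg_circ_if_trig_squares\<close>). The same criterion
  yields the uniqueness of Fourier coefficients, hence the mean-square convergence of Fourier series.

  The second is the passage between stochastic integrals, which are limits of integrals of step functions,
  and the closed span of the observations. Exponentials are uniform limits of step functions, so
  \<open>\<xi> m + \<eta> m\<close> is the integral of the exponential with frequency \<open>m\<close> with respect to the sum of the two processes
  (\<open>has_stoch_integral_cis_add\<close>). The integral with respect to this sum is continuous in \<open>L\<^sub>2(w)\<close>, hence the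
  integral of \<open>h\<close> is the limit of the finite combinations of observations that belong to the partial sums of
  the Fourier series of \<open>h\<close>. All covariances are then limits of covariances of finite combinations, which
  stationarity computes (\<open>error_cov\<close>, \<open>error_norm\<close>).

  For the factorization, \<open>P x\<close> consists of the nonnegative frequencies of \<open>X / w\<close>. Multiplication by \<open>1 / w\<close>
  splits into an analytic and an antianalytic factor, and undoing them one at a time loses nothing
  (\<open>factorization_inverse\<close>).
\<close>

section \<open>Mean-square inner products and norms\<close>

text \<open>The function \<open>cov \<mu>\<close> is the inner product of \<open>L\<^sub>2(\<mu>)\<close> for every measure \<open>\<mu>\<close>. Four measures occur
  below: the probability measure, Lebesgue measure on the circle, the spectral measures, and the
  counting measure on \<open>nat\<close>, whose \<open>L\<^sub>2\<close> space is \<open>l2\<close>. All of them share the following lemmas.\<close>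

definition L2norm :: "'b measure \<Rightarrow> ('b \<Rightarrow> complex) \<Rightarrow> real" where
  "L2norm \<mu> X = sqrt (LINT t|\<mu>. (cmod (X t))\<^sup>2)"

lemma L2norm_nonneg [simp]: "0 \<le> L2norm \<mu> X"
  by (simp add: L2norm_def)

lemma L2norm_square: "(L2norm \<mu> X)\<^sup>2 = (LINT t|\<mu>. (cmod (X t))\<^sup>2)"
  by (simp add: L2norm_def)

lemma borel_measurable_cnj [measurable (raw)]:
  assumes "F \<in> borel_measurable \<mu>" shows "(\<lambda>t. cnj (F t)) \<in> borel_measurable \<mu>"
proof -
  have "cnj \<in> borel_measurable borel"
    by (intro borel_measurable_continuous_onI continuous_intros)
  from measurable_compose[OF assms this] show ?thesis .
qed

lemma sq_int_measurable [measurable_dest]: "sq_int \<mu> X \<Longrightarrow> X \<in> borel_measurable \<mu>"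
  by (simp add: sq_int_def)

lemma sq_int_bound:
  assumes "X \<in> borel_measurable \<mu>" "integrable \<mu> G" "AE t in \<mu>. (cmod (X t))\<^sup>2 \<le> G t"
  shows "sq_int \<mu> X"
  unfolding sq_int_def
proof
  show "integrable \<mu> (\<lambda>t. (cmod (X t))\<^sup>2)"
    by (rule Bochner_Integration.integrable_bound[OF assms(2)]) (use assms in auto)
qed (use assms in auto)

lemma sq_int_cong_AE:
  assumes "sq_int \<mu> X" "AE t in \<mu>. X t = Y t" "Y \<in> borel_measurable \<mu>"
  shows "sq_int \<mu> Y"
  using assms by (intro sq_int_bound[of Y \<mu> "\<lambda>t. (cmod (X t))\<^sup>2"]) (auto simp: sq_int_def)

lemma sq_int_zero [simp]: "sq_int \<mu> (\<lambda>t. 0)"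
  by (simp add: sq_int_def)

lemma cmod_sum_sq: "(cmod (x + y))\<^sup>2 \<le> 2 * (cmod x)\<^sup>2 + 2 * (cmod y)\<^sup>2"
proof -
  have "(cmod (x + y))\<^sup>2 \<le> (cmod x + cmod y)\<^sup>2"
    by (intro power_mono norm_triangle_ineq) auto
  also have "\<dots> \<le> 2 * (cmod x)\<^sup>2 + 2 * (cmod y)\<^sup>2"
    using sum_squares_bound[of "cmod x" "cmod y"] by (simp add: power2_sum)
  finally show ?thesis .
qed

lemma sq_int_add [intro]:
  assumes "sq_int \<mu> X" "sq_int \<mu> Y" shows "sq_int \<mu> (\<lambda>t. X t + Y t)"
  by (rule sq_int_bound[where G = "\<lambda>t. 2 * (cmod (X t))\<^sup>2 + 2 * (cmod (Y t))\<^sup>2"])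
    (use assms cmod_sum_sq in \<open>auto simp: sq_int_def\<close>)

lemma sq_int_scale [intro]:
  assumes "sq_int \<mu> X" shows "sq_int \<mu> (\<lambda>t. c * X t)"
  using assms by (auto simp: sq_int_def norm_mult power_mult_distrib)

lemma sq_int_diff [intro]:
  assumes "sq_int \<mu> X" "sq_int \<mu> Y" shows "sq_int \<mu> (\<lambda>t. X t - Y t)"
  using sq_int_add[OF assms(1) sq_int_scale[OF assms(2), of "-1"]] by simp

lemma sq_int_cnj:
  assumes "sq_int \<mu> X" shows "sq_int \<mu> (\<lambda>t. cnj (X t))"
  using assms by (auto simp: sq_int_def)

lemma sq_int_sum [intro]:
  assumes "\<And>i. i \<in> I \<Longrightarrow> sq_int \<mu> (X i)" shows "sq_int \<mu> (\<lambda>t. \<Sum>i\<in>I. X i t)"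
  using assms by (induction I rule: infinite_finite_induct) auto

lemma sq_int_mult_bounded:
  assumes "sq_int \<mu> X" "F \<in> borel_measurable \<mu>" "AE t in \<mu>. cmod (F t) \<le> K"
  shows "sq_int \<mu> (\<lambda>t. F t * X t)"
proof (rule sq_int_bound[where G = "\<lambda>t. K\<^sup>2 * (cmod (X t))\<^sup>2"])
  show "AE t in \<mu>. (cmod (F t * X t))\<^sup>2 \<le> K\<^sup>2 * (cmod (X t))\<^sup>2"
    using assms(3) by eventually_elim (auto simp: norm_mult power_mult_distrib intro!: mult_right_mono power_mono)
qed (use assms in \<open>auto simp: sq_int_def\<close>)

lemma integrable_mult_sq_int:
  assumes "sq_int \<mu> X" "sq_int \<mu> Y" shows "integrable \<mu> (\<lambda>t. X t * Y t)"
proof (rule Bochner_Integration.integrable_bound)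
  show "integrable \<mu> (\<lambda>t. (cmod (X t))\<^sup>2 + (cmod (Y t))\<^sup>2)"
    using assms by (auto simp: sq_int_def)
  have "cmod a * cmod b \<le> (cmod a)\<^sup>2 + (cmod b)\<^sup>2" for a b
    using sum_squares_bound[of "cmod a" "cmod b"] zero_le_power2[of "cmod a"] zero_le_power2[of "cmod b"]
    by linarith
  then show "AE t in \<mu>. norm (X t * Y t) \<le> norm ((cmod (X t))\<^sup>2 + (cmod (Y t))\<^sup>2)"
    by (auto simp: norm_mult)
qed (use assms in measurable)

lemma integrable_cov:
  assumes "sq_int \<mu> X" "sq_int \<mu> Y" shows "integrable \<mu> (\<lambda>t. X t * cnj (Y t))"
  using integrable_mult_sq_int[OF assms(1) sq_int_cnj[OF assms(2)]] .

lemma cov_commute: "cov \<mu> Y X = cnj (cov \<mu> X Y)"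
  unfolding cov_def by (simp add: mult.commute flip: Bochner_Integration.integral_cnj)

lemma cov_add_left:
  assumes "sq_int \<mu> X" "sq_int \<mu> X'" "sq_int \<mu> Y"
  shows "cov \<mu> (\<lambda>t. X t + X' t) Y = cov \<mu> X Y + cov \<mu> X' Y"
  unfolding cov_def using integrable_cov[OF assms(1,3)] integrable_cov[OF assms(2,3)]
  by (simp add: distrib_right)

lemma cov_scale_left: "cov \<mu> (\<lambda>t. c * X t) Y = c * cov \<mu> X Y"
  unfolding cov_def by (simp add: mult.assoc)

lemma cov_diff_left:
  assumes "sq_int \<mu> X" "sq_int \<mu> X'" "sq_int \<mu> Y"
  shows "cov \<mu> (\<lambda>t. X t - X' t) Y = cov \<mu> X Y - cov \<mu> X' Y"
  unfolding cov_def using integrable_cov[OF assms(1,3)] integrable_cov[OF assms(2,3)]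
  by (simp add: left_diff_distrib)

lemma cov_sum_left:
  assumes "\<And>i. i \<in> I \<Longrightarrow> sq_int \<mu> (X i)" "sq_int \<mu> Y"
  shows "cov \<mu> (\<lambda>t. \<Sum>i\<in>I. X i t) Y = (\<Sum>i\<in>I. cov \<mu> (X i) Y)"
  using assms
proof (induction I rule: infinite_finite_induct)
  case (insert x F)
  then show ?case using cov_add_left[of \<mu> "X x" "\<lambda>t. \<Sum>i\<in>F. X i t" Y] by (auto intro!: sq_int_sum)
qed (auto simp: cov_def)

lemma cov_add_right:
  assumes "sq_int \<mu> X" "sq_int \<mu> X'" "sq_int \<mu> Y"
  shows "cov \<mu> Y (\<lambda>t. X t + X' t) = cov \<mu> Y X + cov \<mu> Y X'"
  using cov_add_left[OF assms] cov_commute[of \<mu> Y] by simp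

lemma cov_scale_right: "cov \<mu> Y (\<lambda>t. c * X t) = cnj c * cov \<mu> Y X"
  using cov_scale_left[of \<mu> c X Y] cov_commute[of \<mu> Y] by simp

lemma cov_diff_right:
  assumes "sq_int \<mu> X" "sq_int \<mu> X'" "sq_int \<mu> Y"
  shows "cov \<mu> Y (\<lambda>t. X t - X' t) = cov \<mu> Y X - cov \<mu> Y X'"
  using cov_diff_left[OF assms] cov_commute[of \<mu> Y] by simp

lemma cov_sum_right:
  assumes "\<And>i. i \<in> I \<Longrightarrow> sq_int \<mu> (X i)" "sq_int \<mu> Y"
  shows "cov \<mu> Y (\<lambda>t. \<Sum>i\<in>I. X i t) = (\<Sum>i\<in>I. cov \<mu> Y (X i))"
proof -
  have "cov \<mu> Y (\<lambda>t. \<Sum>i\<in>I. X i t) = cnj (cov \<mu> (\<lambda>t. \<Sum>i\<in>I. X i t) Y)"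
    by (rule cov_commute)
  also have "\<dots> = (\<Sum>i\<in>I. cnj (cov \<mu> (X i) Y))"
    by (subst cov_sum_left) (use assms in auto)
  also have "\<dots> = (\<Sum>i\<in>I. cov \<mu> Y (X i))"
    by (intro sum.cong refl) (rule cov_commute[symmetric])
  finally show ?thesis .
qed

lemma cov_self: "cov \<mu> X X = of_real ((L2norm \<mu> X)\<^sup>2)"
  unfolding cov_def L2norm_square complex_norm_square[symmetric] by (simp flip: integral_complex_of_real)

lemma cov_cong_AE:
  assumes "AE t in \<mu>. X t = X' t" "AE t in \<mu>. Y t = Y' t"
    "X \<in> borel_measurable \<mu>" "X' \<in> borel_measurable \<mu>" "Y \<in> borel_measurable \<mu>" "Y' \<in> borel_measurable \<mu>"
  shows "cov \<mu> X Y = cov \<mu> X' Y'"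
  unfolding cov_def by (rule integral_cong_AE) (use assms in auto)

lemma L2norm_scale: "L2norm \<mu> (\<lambda>t. c * X t) = cmod c * L2norm \<mu> X"
  by (simp add: L2norm_def norm_mult power_mult_distrib real_sqrt_mult)

lemma L2norm_minus_commute: "L2norm \<mu> (\<lambda>t. X t - Y t) = L2norm \<mu> (\<lambda>t. Y t - X t)"
  by (simp add: L2norm_def norm_minus_commute)

lemma L2norm_cong_AE:
  assumes "AE t in \<mu>. X t = Y t" "X \<in> borel_measurable \<mu>" "Y \<in> borel_measurable \<mu>"
  shows "L2norm \<mu> X = L2norm \<mu> Y"
  unfolding L2norm_def by (intro arg_cong[of _ _ sqrt] integral_cong_AE) (use assms in auto)

lemma L2norm_diff_square:
  assumes "sq_int \<mu> X" "sq_int \<mu> Y"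
  shows "(L2norm \<mu> (\<lambda>t. X t - Y t))\<^sup>2 = (L2norm \<mu> X)\<^sup>2 - 2 * Re (cov \<mu> X Y) + (L2norm \<mu> Y)\<^sup>2"
proof -
  have "cov \<mu> (\<lambda>t. X t - Y t) (\<lambda>t. X t - Y t) = cov \<mu> X X - cov \<mu> X Y - (cov \<mu> Y X - cov \<mu> Y Y)"
    using assms by (simp add: cov_diff_left cov_diff_right sq_int_diff)
  then have "of_real ((L2norm \<mu> (\<lambda>t. X t - Y t))\<^sup>2)
      = of_real ((L2norm \<mu> X)\<^sup>2) - (cov \<mu> X Y + cnj (cov \<mu> X Y)) + of_real ((L2norm \<mu> Y)\<^sup>2)"
    unfolding cov_self unfolding cov_commute[of \<mu> Y X] by simp
  from arg_cong[OF this, of Re] show ?thesis by simp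
qed

text \<open>For \<open>c = cov \<mu> X Y\<close> the squared norm of \<open>X - r * c * Y\<close> is a nonnegative quadratic polynomial in the
  real number \<open>r\<close>. If \<open>Y\<close> has positive norm, its value at \<open>r = 1 / \<parallel>Y\<parallel>\<^sup>2\<close> is the assertion; otherwise
  the polynomial is affine and a large \<open>r\<close> forces \<open>c = 0\<close>.\<close>

lemma L2norm_Cauchy_Schwarz:
  assumes X: "sq_int \<mu> X" and Y: "sq_int \<mu> Y"
  shows "cmod (cov \<mu> X Y) \<le> L2norm \<mu> X * L2norm \<mu> Y"
proof -
  define c where "c = cov \<mu> X Y"
  have *: "0 \<le> (L2norm \<mu> X)\<^sup>2 - 2 * r * (cmod c)\<^sup>2 + r\<^sup>2 * (cmod c)\<^sup>2 * (L2norm \<mu> Y)\<^sup>2" for r :: real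
  proof -
    have "0 \<le> (L2norm \<mu> (\<lambda>t. X t - (of_real r * c) * Y t))\<^sup>2" by simp
    also have "\<dots> = (L2norm \<mu> X)\<^sup>2 - 2 * Re (cnj (of_real r * c) * c) + (L2norm \<mu> (\<lambda>t. (of_real r * c) * Y t))\<^sup>2"
      by (subst L2norm_diff_square) (use X Y in \<open>auto simp: cov_scale_right c_def\<close>)
    also have "Re (cnj (of_real r * c) * c) = r * (cmod c)\<^sup>2"
      by (simp add: cmod_power2) (simp add: power2_eq_square algebra_simps)
    finally show ?thesis by (simp add: L2norm_scale norm_mult power_mult_distrib algebra_simps)
  qed
  have "(cmod c)\<^sup>2 \<le> (L2norm \<mu> X)\<^sup>2 * (L2norm \<mu> Y)\<^sup>2"
  proof (cases "L2norm \<mu> Y = 0")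
    case True
    have "c = 0"
    proof (rule ccontr)
      assume c: "c \<noteq> 0"
      have "2 * (((L2norm \<mu> X)\<^sup>2 + 1) / (2 * (cmod c)\<^sup>2)) * (cmod c)\<^sup>2 = (L2norm \<mu> X)\<^sup>2 + 1"
        using c by (simp add: field_simps)
      with *[of "((L2norm \<mu> X)\<^sup>2 + 1) / (2 * (cmod c)\<^sup>2)"] show False using True c
        by (simp add: field_simps)
    qed
    then show ?thesis by simp
  next
    case False
    then have "0 \<le> (L2norm \<mu> X)\<^sup>2 - (cmod c)\<^sup>2 / (L2norm \<mu> Y)\<^sup>2"
      using *[of "1 / (L2norm \<mu> Y)\<^sup>2"] by (simp add: field_simps power2_eq_square)
    then show ?thesis using False by (simp add: field_simps)
  qed
  then have "(cmod c)\<^sup>2 \<le> (L2norm \<mu> X * L2norm \<mu> Y)\<^sup>2" by (simp add: power_mult_distrib)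
  then show ?thesis unfolding c_def by (rule power2_le_imp_le) simp
qed

lemma L2norm_triangle:
  assumes X: "sq_int \<mu> X" and Y: "sq_int \<mu> Y"
  shows "L2norm \<mu> (\<lambda>t. X t + Y t) \<le> L2norm \<mu> X + L2norm \<mu> Y"
proof (rule power2_le_imp_le)
  have "(L2norm \<mu> (\<lambda>t. X t - (-1) * Y t))\<^sup>2 = (L2norm \<mu> X)\<^sup>2 - 2 * Re (- cov \<mu> X Y) + (L2norm \<mu> Y)\<^sup>2"
    by (subst L2norm_diff_square) (use X sq_int_scale[OF Y, of "-1"] cov_scale_right[of \<mu> X "-1" Y] L2norm_scale[of \<mu> "-1" Y] in auto)
  also have "\<dots> \<le> (L2norm \<mu> X)\<^sup>2 + 2 * (L2norm \<mu> X * L2norm \<mu> Y) + (L2norm \<mu> Y)\<^sup>2"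
    using L2norm_Cauchy_Schwarz[OF X Y] complex_Re_le_cmod[of "cov \<mu> X Y"] by simp
  finally show "(L2norm \<mu> (\<lambda>t. X t + Y t))\<^sup>2 \<le> (L2norm \<mu> X + L2norm \<mu> Y)\<^sup>2"
    by (simp add: power2_sum algebra_simps)
qed simp

lemma L2norm_triangle_diff:
  assumes "sq_int \<mu> X" "sq_int \<mu> Y" "sq_int \<mu> Z"
  shows "L2norm \<mu> (\<lambda>t. X t - Z t) \<le> L2norm \<mu> (\<lambda>t. X t - Y t) + L2norm \<mu> (\<lambda>t. Y t - Z t)"
  using L2norm_triangle[of \<mu> "\<lambda>t. X t - Y t" "\<lambda>t. Y t - Z t"] assms by auto

lemma L2norm_eq_0_iff:
  assumes "sq_int \<mu> X" shows "L2norm \<mu> X = 0 \<longleftrightarrow> (AE t in \<mu>. X t = 0)"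
proof -
  have "L2norm \<mu> X = 0 \<longleftrightarrow> (LINT t|\<mu>. (cmod (X t))\<^sup>2) = 0" by (simp add: L2norm_def)
  also have "\<dots> \<longleftrightarrow> (AE t in \<mu>. (cmod (X t))\<^sup>2 = 0)"
    by (rule integral_nonneg_eq_0_iff_AE) (use assms in \<open>auto simp: sq_int_def\<close>)
  finally show ?thesis by simp
qed

lemma ms_tendsto_iff:
  "ms_tendsto \<mu> X Y \<longleftrightarrow> (\<forall>n. sq_int \<mu> (X n)) \<and> sq_int \<mu> Y \<and>
     (\<lambda>n. L2norm \<mu> (\<lambda>t. X n t - Y t)) \<longlonglongrightarrow> 0"
proof -
  have "(\<lambda>n. (L2norm \<mu> (\<lambda>t. X n t - Y t))\<^sup>2) \<longlonglongrightarrow> 0 \<longleftrightarrow> (\<lambda>n. L2norm \<mu> (\<lambda>t. X n t - Y t)) \<longlonglongrightarrow> 0" (is "?l \<longleftrightarrow> ?r")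
  proof
    assume ?l from tendsto_real_sqrt[OF this] show ?r by simp
  next
    assume ?r from tendsto_power[OF this, of 2] show ?l by simp
  qed
  then show ?thesis by (simp add: ms_tendsto_def L2norm_square)
qed

lemma ms_tendsto_cong_AE:
  assumes "ms_tendsto \<mu> X Y" "AE t in \<mu>. Y t = Y' t" "Y' \<in> borel_measurable \<mu>"
  shows "ms_tendsto \<mu> X Y'"
proof -
  have sq: "sq_int \<mu> Y'" "sq_int \<mu> Y" "\<And>n. sq_int \<mu> (X n)"
    using assms sq_int_cong_AE by (auto simp: ms_tendsto_def)
  have "L2norm \<mu> (\<lambda>t. X n t - Y t) = L2norm \<mu> (\<lambda>t. X n t - Y' t)" for n
    using sq assms(2) by (intro L2norm_cong_AE) (auto dest!: sq_int_measurable)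
  then show ?thesis using assms sq unfolding ms_tendsto_iff by simp
qed

lemma ms_tendsto_add:
  assumes "ms_tendsto \<mu> X Y" "ms_tendsto \<mu> X' Y'"
  shows "ms_tendsto \<mu> (\<lambda>n t. X n t + X' n t) (\<lambda>t. Y t + Y' t)"
proof -
  have sq: "sq_int \<mu> Y'" "sq_int \<mu> Y" "\<And>n. sq_int \<mu> (X n)" "\<And>n. sq_int \<mu> (X' n)"
    and l: "(\<lambda>n. L2norm \<mu> (\<lambda>t. X n t - Y t)) \<longlonglongrightarrow> 0" "(\<lambda>n. L2norm \<mu> (\<lambda>t. X' n t - Y' t)) \<longlonglongrightarrow> 0"
    using assms by (auto simp: ms_tendsto_iff)
  have "(\<lambda>n. L2norm \<mu> (\<lambda>t. X n t + X' n t - (Y t + Y' t))) \<longlonglongrightarrow> 0"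
  proof (rule tendsto_sandwich[OF _ _ tendsto_const])
    show "(\<lambda>n. L2norm \<mu> (\<lambda>t. X n t - Y t) + L2norm \<mu> (\<lambda>t. X' n t - Y' t)) \<longlonglongrightarrow> 0"
      using tendsto_add[OF l] by simp
    have "L2norm \<mu> (\<lambda>t. X n t + X' n t - (Y t + Y' t)) \<le> L2norm \<mu> (\<lambda>t. X n t - Y t) + L2norm \<mu> (\<lambda>t. X' n t - Y' t)" for n
      using L2norm_triangle[of \<mu> "\<lambda>t. X n t - Y t" "\<lambda>t. X' n t - Y' t"] sq by (auto simp: algebra_simps)
    then show "\<forall>\<^sub>F n in sequentially. L2norm \<mu> (\<lambda>t. X n t + X' n t - (Y t + Y' t)) \<le> L2norm \<mu> (\<lambda>t. X n t - Y t) + L2norm \<mu> (\<lambda>t. X' n t - Y' t)"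
      by simp
  qed auto
  then show ?thesis using sq by (auto simp: ms_tendsto_iff)
qed

lemma ms_tendsto_scale:
  assumes "ms_tendsto \<mu> X Y" shows "ms_tendsto \<mu> (\<lambda>n t. c * X n t) (\<lambda>t. c * Y t)"
proof -
  have "L2norm \<mu> (\<lambda>t. c * X n t - c * Y t) = cmod c * L2norm \<mu> (\<lambda>t. X n t - Y t)" for n
    using L2norm_scale[of \<mu> c "\<lambda>t. X n t - Y t"] by (simp add: right_diff_distrib)
  then show ?thesis using assms unfolding ms_tendsto_iff
    by (auto intro: tendsto_mult_right_zero)
qed

lemma ms_tendsto_diff:
  assumes "ms_tendsto \<mu> X Y" "ms_tendsto \<mu> X' Y'"
  shows "ms_tendsto \<mu> (\<lambda>n t. X n t - X' n t) (\<lambda>t. Y t - Y' t)"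
  using ms_tendsto_add[OF assms(1) ms_tendsto_scale[OF assms(2), of "-1"]] by simp

lemma ms_tendsto_const: "sq_int \<mu> X \<Longrightarrow> ms_tendsto \<mu> (\<lambda>n. X) X"
  by (auto simp: ms_tendsto_iff L2norm_def)

lemma ms_tendsto_unique:
  assumes "ms_tendsto \<mu> X Y" "ms_tendsto \<mu> X Y'" shows "AE t in \<mu>. Y t = Y' t"
proof -
  have sq: "sq_int \<mu> (\<lambda>t. Y t - Y' t)" using assms by (auto simp: ms_tendsto_iff)
  have "(\<lambda>n. L2norm \<mu> (\<lambda>t. 0 - (Y t - Y' t))) \<longlonglongrightarrow> 0"
    using ms_tendsto_diff[OF assms] by (simp add: ms_tendsto_iff)
  then have "L2norm \<mu> (\<lambda>t. 0 - (Y t - Y' t)) = 0" by (simp add: LIMSEQ_const_iff)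
  then have "L2norm \<mu> (\<lambda>t. Y t - Y' t) = 0" using L2norm_minus_commute[of \<mu> Y Y'] by simp
  then show ?thesis using L2norm_eq_0_iff[OF sq] by simp
qed

lemma ms_tendsto_cov:
  assumes "ms_tendsto \<mu> X Y" "ms_tendsto \<mu> X' Y'"
  shows "(\<lambda>n. cov \<mu> (X n) (X' n)) \<longlonglongrightarrow> cov \<mu> Y Y'"
proof -
  have sq: "sq_int \<mu> Y'" "sq_int \<mu> Y" "\<And>n. sq_int \<mu> (X n)" "\<And>n. sq_int \<mu> (X' n)"
    and l: "(\<lambda>n. L2norm \<mu> (\<lambda>t. X n t - Y t)) \<longlonglongrightarrow> 0" "(\<lambda>n. L2norm \<mu> (\<lambda>t. X' n t - Y' t)) \<longlonglongrightarrow> 0"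
    using assms by (auto simp: ms_tendsto_iff)
  have eq: "cov \<mu> (X n) (X' n) - cov \<mu> Y Y' = cov \<mu> (\<lambda>t. X n t - Y t) (\<lambda>t. X' n t - Y' t)
      + cov \<mu> (\<lambda>t. X n t - Y t) Y' + cov \<mu> Y (\<lambda>t. X' n t - Y' t)" for n
    using sq by (simp add: cov_diff_left cov_diff_right sq_int_diff algebra_simps)
  have "(\<lambda>n. L2norm \<mu> (\<lambda>t. X n t - Y t) * L2norm \<mu> (\<lambda>t. X' n t - Y' t) + L2norm \<mu> (\<lambda>t. X n t - Y t) * L2norm \<mu> Y'
       + L2norm \<mu> Y * L2norm \<mu> (\<lambda>t. X' n t - Y' t)) \<longlonglongrightarrow> 0"
    using tendsto_add[OF tendsto_add[OF tendsto_mult_zero[OF l] tendsto_mult_left_zero[OF l(1)]] tendsto_mult_right_zero[OF l(2)]]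
    by simp
  then have "(\<lambda>n. cov \<mu> (X n) (X' n) - cov \<mu> Y Y') \<longlonglongrightarrow> 0"
  proof (rule Lim_null_comparison[rotated])
    show "\<forall>\<^sub>F n in sequentially. norm (cov \<mu> (X n) (X' n) - cov \<mu> Y Y') \<le>
      L2norm \<mu> (\<lambda>t. X n t - Y t) * L2norm \<mu> (\<lambda>t. X' n t - Y' t) + L2norm \<mu> (\<lambda>t. X n t - Y t) * L2norm \<mu> Y'
       + L2norm \<mu> Y * L2norm \<mu> (\<lambda>t. X' n t - Y' t)"
    proof (rule always_eventually, rule allI)
      fix n
      show "norm (cov \<mu> (X n) (X' n) - cov \<mu> Y Y') \<le>
        L2norm \<mu> (\<lambda>t. X n t - Y t) * L2norm \<mu> (\<lambda>t. X' n t - Y' t) + L2norm \<mu> (\<lambda>t. X n t - Y t) * L2norm \<mu> Y'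
         + L2norm \<mu> Y * L2norm \<mu> (\<lambda>t. X' n t - Y' t)"
        unfolding eq using sq by (intro order_trans[OF norm_triangle_ineq] add_mono L2norm_Cauchy_Schwarz) auto
    qed
  qed
  then show ?thesis by (simp add: LIM_zero_iff)
qed

lemma ms_tendsto_L2norm:
  assumes "ms_tendsto \<mu> X Y" shows "(\<lambda>n. L2norm \<mu> (X n)) \<longlonglongrightarrow> L2norm \<mu> Y"
proof -
  have "(\<lambda>n. Re (cov \<mu> (X n) (X n))) \<longlonglongrightarrow> Re (cov \<mu> Y Y)"
    by (intro tendsto_Re ms_tendsto_cov assms)
  then have "(\<lambda>n. (L2norm \<mu> (X n))\<^sup>2) \<longlonglongrightarrow> (L2norm \<mu> Y)\<^sup>2" by (simp add: cov_self)
  from tendsto_real_sqrt[OF this] show ?thesis by simp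
qed

section \<open>Completeness and uniform boundedness\<close>

lemma summable_norm_of_weighted_squares:
  fixes d :: "nat \<Rightarrow> 'a::real_normed_vector"
  assumes "summable (\<lambda>k. 2 ^ k * (norm (d k))\<^sup>2)"
  shows "summable (\<lambda>k. norm (d k))"
proof -
  from summable_LIMSEQ_zero[OF assms] have "Bseq (\<lambda>k. 2 ^ k * (norm (d k))\<^sup>2)"
    by (intro convergent_imp_Bseq convergentI)
  then obtain C where C: "C > 0" "\<forall>k. norm (2 ^ k * (norm (d k))\<^sup>2) \<le> C"
    by (rule BseqE)
  define s where "s = sqrt (1/2)"
  have s: "0 \<le> s" "s < 1" "s\<^sup>2 = 1/2"
    unfolding s_def by (simp_all add: real_sqrt_lt_1_iff)
  have "norm (d k) \<le> sqrt C * s ^ k" for k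
  proof (rule power2_le_imp_le)
    have "(s ^ k)\<^sup>2 = (1/2) ^ k"
      unfolding s(3)[symmetric] power_mult[symmetric] by (simp only: mult.commute)
    moreover have "(norm (d k))\<^sup>2 \<le> C * (1/2) ^ k"
    proof -
      have "2 ^ k * (norm (d k))\<^sup>2 \<le> norm (2 ^ k * (norm (d k))\<^sup>2)"
        unfolding real_norm_def by (rule abs_ge_self)
      also have "\<dots> \<le> C" by (rule C(2)[rule_format])
      finally have "(norm (d k))\<^sup>2 \<le> C / 2 ^ k"
        by (subst pos_le_divide_eq) (simp_all add: mult.commute)
      then show ?thesis by (simp only: power_divide power_one) (simp only: times_divide_eq_right mult_1_right)
    qed
    ultimately show "(norm (d k))\<^sup>2 \<le> (sqrt C * s ^ k)\<^sup>2"
      using C(1) by (simp add: power_mult_distrib)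
  qed (use C s in simp)
  moreover have "summable (\<lambda>k. sqrt C * s ^ k)"
    by (rule summable_mult, rule summable_geometric) (use s in simp)
  ultimately show ?thesis
    by (intro summable_comparison_test'[of "\<lambda>k. sqrt C * s ^ k" 0 "\<lambda>k. norm (d k)"]) simp_all
qed

lemma nn_integral_cmod_square:
  assumes "sq_int \<mu> X"
  shows "(\<integral>\<^sup>+t. ennreal ((cmod (X t))\<^sup>2) \<partial>\<mu>) = ennreal ((L2norm \<mu> X)\<^sup>2)"
  using assms unfolding L2norm_square by (intro nn_integral_eq_integral) (auto simp: sq_int_def)

text \<open>The weighted sum of the squared increments has finite integral, so it is finite almost
  everywhere, and then the increments decay geometrically.\<close>

lemma L2_rapidly_Cauchy_AE_convergent:
  assumes sq: "\<And>n. sq_int \<mu> (X n)"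
    and r: "\<And>k. L2norm \<mu> (\<lambda>t. X (Suc k) t - X k t) \<le> (1/2) ^ k"
  shows "AE t in \<mu>. convergent (\<lambda>k. X k t)"
proof -
  define d where "d k t = X (Suc k) t - X k t" for k t
  have sqd: "sq_int \<mu> (d k)" for k unfolding d_def using sq by auto
  have "(\<integral>\<^sup>+t. (\<Sum>k. ennreal (2 ^ k * (cmod (d k t))\<^sup>2)) \<partial>\<mu>)
      = (\<Sum>k. \<integral>\<^sup>+t. ennreal (2 ^ k * (cmod (d k t))\<^sup>2) \<partial>\<mu>)"
    by (rule nn_integral_suminf) (use sqd in measurable)
  also have "\<dots> \<le> (\<Sum>k. ennreal ((1/2) ^ k))"
  proof (rule suminf_le)
    fix k
    have "(\<integral>\<^sup>+t. ennreal (2 ^ k * (cmod (d k t))\<^sup>2) \<partial>\<mu>) = ennreal (2 ^ k) * (\<integral>\<^sup>+t. ennreal ((cmod (d k t))\<^sup>2) \<partial>\<mu>)"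
      using sqd by (subst nn_integral_cmult[symmetric]) (auto simp: ennreal_mult dest: sq_int_measurable)
    also have "\<dots> = ennreal (2 ^ k * (L2norm \<mu> (d k))\<^sup>2)"
      using sqd by (simp add: nn_integral_cmod_square ennreal_mult)
    also have "\<dots> \<le> ennreal (2 ^ k * ((1/2) ^ k)\<^sup>2)"
      using r unfolding d_def by (intro ennreal_leI mult_left_mono power_mono) auto
    also have "2 ^ k * ((1/2) ^ k)\<^sup>2 = (1/2::real) ^ k"
    proof -
      have "2 ^ k * ((1/2) ^ k)\<^sup>2 = (2 * (1/2) * (1/2::real)) ^ k"
        unfolding power2_eq_square power_mult_distrib by (simp only: mult.assoc)
      then show ?thesis by simp
    qed
    finally show "(\<integral>\<^sup>+t. ennreal (2 ^ k * (cmod (d k t))\<^sup>2) \<partial>\<mu>) \<le> ennreal ((1/2) ^ k)" .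
  qed auto
  also have "\<dots> < \<infinity>"
    by (subst suminf_ennreal2) auto
  finally have "(\<integral>\<^sup>+t. (\<Sum>k. ennreal (2 ^ k * (cmod (d k t))\<^sup>2)) \<partial>\<mu>) \<noteq> \<infinity>" by simp
  then have "AE t in \<mu>. (\<Sum>k. ennreal (2 ^ k * (cmod (d k t))\<^sup>2)) \<noteq> \<infinity>"
    by (intro nn_integral_PInf_AE) (use sqd in measurable)
  then show ?thesis
  proof eventually_elim
    case (elim t)
    then have "summable (\<lambda>k. 2 ^ k * (cmod (d k t))\<^sup>2)"
      unfolding infinity_ennreal_def by (rule summable_suminf_not_top[rotated]) simp
    then have "summable (\<lambda>k. d k t)"
      by (rule summable_norm_cancel[OF summable_norm_of_weighted_squares])
    then have "convergent (\<lambda>n. \<Sum>k<n. d k t)"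
      unfolding summable_iff_convergent .
    then have "convergent (\<lambda>n. X 0 t + (\<Sum>k<n. d k t))"
      by (intro convergent_add convergent_const)
    moreover have "X 0 t + (\<Sum>k<n. d k t) = X n t" for n
      unfolding d_def sum_lessThan_telescope[of "\<lambda>k. X k t"] by simp
    ultimately show ?case by simp
  qed
qed

text \<open>Riesz and Fischer: a rapidly Cauchy subsequence converges almost everywhere, and Fatou's lemma
  turns the Cauchy property into mean-square convergence to its limit.\<close>

lemma L2_complete:
  assumes sq: "\<And>n. sq_int \<mu> (X n)"
    and C: "\<And>e. e > 0 \<Longrightarrow> \<exists>N. \<forall>m\<ge>N. \<forall>n\<ge>N. L2norm \<mu> (\<lambda>t. X m t - X n t) < e"
  shows "\<exists>Y. ms_tendsto \<mu> X Y"
proof -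
  have "\<forall>k. \<exists>N. \<forall>m\<ge>N. \<forall>n\<ge>N. L2norm \<mu> (\<lambda>t. X m t - X n t) < (1/2) ^ k"
    using C by simp
  then obtain N where "\<forall>k. \<forall>m\<ge>N k. \<forall>n\<ge>N k. L2norm \<mu> (\<lambda>t. X m t - X n t) < (1/2) ^ k"
    unfolding choice_iff by (rule exE)
  then have N: "L2norm \<mu> (\<lambda>t. X m t - X n t) < (1/2) ^ k" if "m \<ge> N k" "n \<ge> N k" for k m n
    using that by simp
  \<comment> \<open>monotone, unbounded, and at least \<open>N k\<close>\<close>
  define r where "r k = (\<Sum>i\<le>k. N i) + k" for k
  have rN: "N k \<le> r k" for k
    unfolding r_def using member_le_sum[of k "{..k}" N] by simp
  have rk: "r k \<le> r (Suc k)" "k \<le> r k" for k by (simp_all add: r_def)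
  have sqr: "\<And>k. sq_int \<mu> (X (r k))" using sq .
  have "L2norm \<mu> (\<lambda>t. X (r (Suc k)) t - X (r k) t) \<le> (1/2) ^ k" for k
    using N[of k "r (Suc k)" "r k"] rN[of k] rk(1)[of k] by simp
  from L2_rapidly_Cauchy_AE_convergent[OF sqr this]
  have conv: "AE t in \<mu>. convergent (\<lambda>k. X (r k) t)" .
  define Y where "Y t = lim (\<lambda>k. X (r k) t)" for t
  have Ym: "Y \<in> borel_measurable \<mu>"
    unfolding Y_def using sq by (intro borel_measurable_lim_metric) (auto dest: sq_int_measurable)
  have conv': "AE t in \<mu>. (\<lambda>k. X (r k) t) \<longlonglongrightarrow> Y t"
    using conv by eventually_elim (simp add: Y_def convergent_LIMSEQ_iff)
  have key: "sq_int \<mu> (\<lambda>t. X n t - Y t) \<and> L2norm \<mu> (\<lambda>t. X n t - Y t) \<le> e"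
    if n: "\<forall>m\<ge>K. L2norm \<mu> (\<lambda>t. X n t - X m t) < e" for n K e
  proof -
    have e: "e > 0" using n[rule_format, of K] L2norm_nonneg[of \<mu> "\<lambda>t. X n t - X K t"] by linarith
    have "(\<integral>\<^sup>+t. ennreal ((cmod (X n t - Y t))\<^sup>2) \<partial>\<mu>)
        = (\<integral>\<^sup>+t. liminf (\<lambda>k. ennreal ((cmod (X n t - X (r k) t))\<^sup>2)) \<partial>\<mu>)"
    proof (rule nn_integral_cong_AE)
      show "AE t in \<mu>. ennreal ((cmod (X n t - Y t))\<^sup>2) = liminf (\<lambda>k. ennreal ((cmod (X n t - X (r k) t))\<^sup>2))"
        using conv'
      proof eventually_elim
        case (elim t)
        then have "(\<lambda>k. ennreal ((cmod (X n t - X (r k) t))\<^sup>2)) \<longlonglongrightarrow> ennreal ((cmod (X n t - Y t))\<^sup>2)"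
          by (intro tendsto_ennrealI tendsto_intros)
        from lim_imp_Liminf[OF _ this] show ?case by simp
      qed
    qed
    also have "\<dots> \<le> liminf (\<lambda>k. \<integral>\<^sup>+t. ennreal ((cmod (X n t - X (r k) t))\<^sup>2) \<partial>\<mu>)"
      by (rule nn_integral_liminf) (use sq in measurable)
    also have "\<dots> \<le> ennreal (e\<^sup>2)"
    proof (rule Liminf_le)
      show "\<forall>\<^sub>F k in sequentially. (\<integral>\<^sup>+t. ennreal ((cmod (X n t - X (r k) t))\<^sup>2) \<partial>\<mu>) \<le> ennreal (e\<^sup>2)"
        using eventually_ge_at_top[of K]
      proof eventually_elim
        case (elim k)
        then have "L2norm \<mu> (\<lambda>t. X n t - X (r k) t) \<le> e"
          using n rk(2)[of k] by (simp add: less_imp_le)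
        then show ?case
          using sq by (subst nn_integral_cmod_square) (auto intro!: ennreal_leI power_mono)
      qed
    qed simp
    finally have le: "(\<integral>\<^sup>+t. ennreal ((cmod (X n t - Y t))\<^sup>2) \<partial>\<mu>) \<le> ennreal (e\<^sup>2)" .
    then have sqY: "sq_int \<mu> (\<lambda>t. X n t - Y t)"
      unfolding sq_int_def using sq Ym
      by (auto intro!: integrableI_bounded le_less_trans[OF le] dest: sq_int_measurable)
    have "(L2norm \<mu> (\<lambda>t. X n t - Y t))\<^sup>2 \<le> e\<^sup>2"
      using le nn_integral_cmod_square[OF sqY] by (simp add: ennreal_le_iff)
    with sqY e show ?thesis by (auto intro: power2_le_imp_le)
  qed
  obtain K where "\<forall>m\<ge>K. \<forall>n\<ge>K. L2norm \<mu> (\<lambda>t. X m t - X n t) < 1" using C[of 1] by auto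
  then have "sq_int \<mu> (\<lambda>t. X K t - Y t)" using key[of K K 1] by auto
  from sq_int_diff[OF sq[of K] this] have sqY: "sq_int \<mu> Y" by simp
  have "(\<lambda>n. L2norm \<mu> (\<lambda>t. X n t - Y t)) \<longlonglongrightarrow> 0"
  proof (rule LIMSEQ_I)
    fix e :: real assume "e > 0"
    then obtain K where "\<forall>m\<ge>K. \<forall>n\<ge>K. L2norm \<mu> (\<lambda>t. X m t - X n t) < e/2" using C[of "e/2"] by auto
    then have "L2norm \<mu> (\<lambda>t. X n t - Y t) \<le> e/2" if "n \<ge> K" for n using key[of K n "e/2"] that by auto
    then show "\<exists>no. \<forall>n\<ge>no. norm (L2norm \<mu> (\<lambda>t. X n t - Y t) - 0) < e"
      using \<open>e > 0\<close> by (intro exI[of _ K]) (auto simp: le_less_trans[of _ "e/2" e])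
  qed
  then show ?thesis using sq sqY by (auto simp: ms_tendsto_iff)
qed

text \<open>The uniform boundedness principle, by Sokal's elementary argument. If the optimal constants \<open>L n\<close>
  of the seminorms are unbounded, choose \<open>m k\<close> with \<open>L (m k) > 4 ^ k\<close> and walk from \<open>0\<close> with steps of
  length at most \<open>3 ^ -k\<close> along near-maximisers of \<open>q (m k)\<close>. One of the two signs of each step gives
  \<open>q (m k)\<close> at least three quarters of \<open>3 ^ -k * L (m k)\<close>; all later steps together move the point by
  at most \<open>3 ^ -k / 2\<close>. At the limit of the walk \<open>q (m k)\<close> is therefore at least \<open>(4/3) ^ k / 4\<close>.
  Seminorms replace operators because the principle is applied to truncations of a matrix.\<close>

lemma L2_uniform_boundedness:
  fixes q :: "nat \<Rightarrow> ('b \<Rightarrow> complex) \<Rightarrow> real"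
  assumes add: "\<And>n X Y. sq_int \<mu> X \<Longrightarrow> sq_int \<mu> Y \<Longrightarrow> q n (\<lambda>t. X t + Y t) \<le> q n X + q n Y"
    and scale: "\<And>n X c. sq_int \<mu> X \<Longrightarrow> q n (\<lambda>t. c * X t) = cmod c * q n X"
    and each: "\<And>n. \<exists>K. \<forall>X. sq_int \<mu> X \<longrightarrow> q n X \<le> K * L2norm \<mu> X"
    and pointwise: "\<And>X. sq_int \<mu> X \<Longrightarrow> \<exists>B. \<forall>n. q n X \<le> B"
  shows "\<exists>K. \<forall>n X. sq_int \<mu> X \<longrightarrow> q n X \<le> K * L2norm \<mu> X"
proof (rule ccontr)
  assume contra: "\<not> ?thesis"
  have q_nonneg: "0 \<le> q n X" if "sq_int \<mu> X" for n X
    using add[OF that sq_int_scale[OF that, of "-1"], of n] scale[OF that, of n "-1"] scale[OF that, of n 0] by simp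
  define L where "L n = Sup {q n X | X. sq_int \<mu> X \<and> L2norm \<mu> X \<le> 1}" for n
  have nonempty: "{q n X | X. sq_int \<mu> X \<and> L2norm \<mu> X \<le> 1} \<noteq> {}" for n
    by (auto intro!: exI[of _ "\<lambda>t. 0"] simp: L2norm_def)
  have bdd: "bdd_above {q n X | X. sq_int \<mu> X \<and> L2norm \<mu> X \<le> 1}" for n
  proof -
    obtain K where K: "\<forall>X. sq_int \<mu> X \<longrightarrow> q n X \<le> K * L2norm \<mu> X" using each by blast
    have "q n X \<le> \<bar>K\<bar>" if "sq_int \<mu> X" "L2norm \<mu> X \<le> 1" for X
    proof -
      have "q n X \<le> K * L2norm \<mu> X" using K that by blast
      also have "\<dots> \<le> \<bar>K\<bar> * 1" using that by (intro mult_mono) auto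
      finally show ?thesis by simp
    qed
    then show ?thesis by (intro bdd_aboveI[of _ "\<bar>K\<bar>"]) auto
  qed
  have q_unit: "q n X \<le> L n" if "sq_int \<mu> X" "L2norm \<mu> X \<le> 1" for n X
    unfolding L_def by (rule cSup_upper[OF _ bdd]) (use that in auto)
  have q_le: "q n X \<le> L n * L2norm \<mu> X" if X: "sq_int \<mu> X" for n X
  proof (cases "L2norm \<mu> X = 0")
    case True
    obtain K where "\<forall>X. sq_int \<mu> X \<longrightarrow> q n X \<le> K * L2norm \<mu> X" using each by blast
    then have "q n X \<le> K * L2norm \<mu> X" using X by blast
    then show ?thesis using True by simp
  next
    case False
    then have pos: "L2norm \<mu> X > 0" using L2norm_nonneg[of \<mu> X] by linarith
    have "q n (\<lambda>t. of_real (1 / L2norm \<mu> X) * X t) \<le> L n"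
      using pos X by (intro q_unit) (auto simp: L2norm_scale simp del: of_real_divide)
    then show ?thesis using pos X by (subst (asm) scale) (auto simp: field_simps norm_divide)
  qed
  have "\<exists>n. L n > K" for K
  proof (rule ccontr)
    assume "\<nexists>n. L n > K"
    then have "q n X \<le> K * L2norm \<mu> X" if "sq_int \<mu> X" for n X
      using q_le[OF that, of n] mult_right_mono[of "L n" K "L2norm \<mu> X"] by (auto simp: not_less intro: order_trans)
    with contra show False by blast
  qed
  then have "\<forall>k. \<exists>n. L n > 4 ^ k" by blast
  then obtain m where m: "\<And>k. L (m k) > 4 ^ k" using choice[of "\<lambda>k n. L n > 4 ^ k"] by blast
  have Lpos: "L (m k) > 0" for k using m[of k] by (rule less_trans[rotated]) simp
  have "\<forall>k. \<exists>z. sq_int \<mu> z \<and> L2norm \<mu> z \<le> 1 \<and> q (m k) z > 3/4 * L (m k)"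
  proof
    fix k
    have "3/4 * L (m k) < L (m k)" using Lpos[of k] by simp
    then have "\<exists>y\<in>{q (m k) X | X. sq_int \<mu> X \<and> L2norm \<mu> X \<le> 1}. 3/4 * L (m k) < y"
      unfolding L_def[of "m k"] by (rule less_cSupD[OF nonempty])
    then show "\<exists>z. sq_int \<mu> z \<and> L2norm \<mu> z \<le> 1 \<and> q (m k) z > 3/4 * L (m k)" by blast
  qed
  then obtain z where z: "\<And>k. sq_int \<mu> (z k)" "\<And>k. L2norm \<mu> (z k) \<le> 1" "\<And>k. q (m k) (z k) > 3/4 * L (m k)"
    unfolding choice_iff by blast
  have "\<exists>x. \<forall>k. sq_int \<mu> (x k) \<and> (L2norm \<mu> (\<lambda>t. x (Suc k) t - x k t) \<le> (1/3) ^ k \<and>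
      q (m k) (x (Suc k)) \<ge> (1/3) ^ k * (3/4 * L (m k)))"
  proof (rule dependent_nat_choice)
    show "\<exists>x. sq_int \<mu> x" using sq_int_zero by blast
    fix x k assume x: "sq_int \<mu> x"
    define p where "p s t = x t + (s * of_real ((1/3) ^ k)) * z k t" for s t
    have sqp: "sq_int \<mu> (p s)" for s unfolding p_def by (rule sq_int_add[OF x sq_int_scale[OF z(1)]])
    have "2 * (1/3) ^ k * q (m k) (z k) = q (m k) (\<lambda>t. of_real (2 * (1/3) ^ k) * z k t)"
      using z by (simp add: scale norm_mult norm_power norm_divide)
    also have "(\<lambda>t. of_real (2 * (1/3) ^ k) * z k t) = (\<lambda>t. p 1 t + -1 * p (-1) t)"
      by (auto simp: p_def algebra_simps)
    also have "q (m k) \<dots> \<le> q (m k) (p 1) + q (m k) (p (-1))"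
      using add[OF sqp[of 1] sq_int_scale[OF sqp[of "-1"], of "-1"], of "m k"] scale[OF sqp[of "-1"], of "m k" "-1"] by simp
    finally have "(1/3) ^ k * q (m k) (z k) \<le> q (m k) (p 1) \<or> (1/3) ^ k * q (m k) (z k) \<le> q (m k) (p (-1))"
      by (auto simp: mult.assoc)
    then obtain s where s: "s = 1 \<or> s = -1" "q (m k) (p s) \<ge> (1/3) ^ k * q (m k) (z k)"
      by blast
    have "L2norm \<mu> (\<lambda>t. p s t - x t) = (1/3) ^ k * L2norm \<mu> (z k)"
      unfolding p_def using s(1) L2norm_scale[of \<mu> "s * of_real ((1/3) ^ k)" "z k"]
      by (auto simp: norm_mult norm_power norm_divide)
    also have "\<dots> \<le> (1/3) ^ k" using z(2)[of k] by (simp add: mult_left_le)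
    finally have "L2norm \<mu> (\<lambda>t. p s t - x t) \<le> (1/3) ^ k" .
    moreover have "(1/3) ^ k * (3/4 * L (m k)) \<le> q (m k) (p s)"
      by (rule order_trans[OF mult_left_mono s(2)]) (use z(3)[of k] in simp_all)
    ultimately show "\<exists>y. sq_int \<mu> y \<and> L2norm \<mu> (\<lambda>t. y t - x t) \<le> (1/3) ^ k \<and> q (m k) y \<ge> (1/3) ^ k * (3/4 * L (m k))"
      using sqp[of s] by blast
  qed
  then obtain x where x: "\<And>k. sq_int \<mu> (x k)" "\<And>k. L2norm \<mu> (\<lambda>t. x (Suc k) t - x k t) \<le> (1/3) ^ k"
      "\<And>k. q (m k) (x (Suc k)) \<ge> (1/3) ^ k * (3/4 * L (m k))" by blast
  have tail: "L2norm \<mu> (\<lambda>t. x (j + i) t - x j t) \<le> 3/2 * (1/3) ^ j - 3/2 * (1/3) ^ (j + i)" for i j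
  proof (induction i)
    case 0
    then show ?case by (simp add: L2norm_def)
  next
    case (Suc i)
    have "L2norm \<mu> (\<lambda>t. x (j + Suc i) t - x j t) \<le> L2norm \<mu> (\<lambda>t. x (Suc (j + i)) t - x (j + i) t) + L2norm \<mu> (\<lambda>t. x (j + i) t - x j t)"
      using L2norm_triangle_diff[OF x(1) x(1) x(1)] by simp
    also have "\<dots> \<le> (1/3) ^ (j + i) + (3/2 * (1/3) ^ j - 3/2 * (1/3) ^ (j + i))"
      using Suc x(2)[of "j + i"] by linarith
    finally show ?case by simp
  qed
  have tail': "L2norm \<mu> (\<lambda>t. x n t - x j t) \<le> 3/2 * (1/3) ^ j" if "n \<ge> j" for n j
    
  proof -
    have "0 \<le> 3/2 * (1/3::real) ^ n" by simp
    moreover have "L2norm \<mu> (\<lambda>t. x n t - x j t) \<le> 3/2 * (1/3) ^ j - 3/2 * (1/3) ^ n"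
      using tail[of j "n - j"] that by simp
    ultimately show ?thesis by linarith
  qed
  have "\<exists>X. ms_tendsto \<mu> x X"
  proof (rule L2_complete[OF x(1)])
    fix e :: real assume "e > 0"
    then obtain j where j: "(1/3) ^ j < e / 3" using real_arch_pow_inv[of "e/3" "1/3"] by auto
    have "L2norm \<mu> (\<lambda>t. x a t - x b t) < e" if "a \<ge> j" "b \<ge> j" for a b
      using L2norm_triangle_diff[OF x(1)[of a] x(1)[of j] x(1)[of b]] tail'[OF that(1)] tail'[OF that(2)] j
        L2norm_minus_commute[of \<mu> "x j" "x b"] by linarith
    then show "\<exists>N. \<forall>m\<ge>N. \<forall>n\<ge>N. L2norm \<mu> (\<lambda>t. x m t - x n t) < e" by blast
  qed
  then obtain X where X: "ms_tendsto \<mu> x X" by blast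
  then have sqX: "sq_int \<mu> X" by (simp add: ms_tendsto_iff)
  have dist: "L2norm \<mu> (\<lambda>t. X t - x j t) \<le> 3/2 * (1/3) ^ j" for j
  proof (rule LIMSEQ_le_const2[OF ms_tendsto_L2norm[OF ms_tendsto_diff[OF X ms_tendsto_const[OF x(1)]]]])
    show "\<exists>N. \<forall>n\<ge>N. L2norm \<mu> (\<lambda>t. x n t - x j t) \<le> 3/2 * (1/3) ^ j" using tail' by blast
  qed
  have low: "q (m k) X \<ge> 1/4 * (4/3) ^ k" for k
  proof -
    have "q (m k) (x (Suc k)) \<le> q (m k) X + q (m k) (\<lambda>t. X t - x (Suc k) t)"
      using add[OF sqX sq_int_scale[OF sq_int_diff[OF sqX x(1)], of "-1"], of "m k" "Suc k"]
        scale[OF sq_int_diff[OF sqX x(1)], of "m k" "-1" "Suc k"] by simp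
    moreover have "q (m k) (\<lambda>t. X t - x (Suc k) t) \<le> L (m k) * (3/2 * (1/3) ^ Suc k)"
      using q_le[OF sq_int_diff[OF sqX x(1)], of "m k" "Suc k"] mult_left_mono[OF dist[of "Suc k"], of "L (m k)"] Lpos[of k]
      by linarith
    ultimately have "q (m k) X \<ge> 1/4 * ((1/3) ^ k * L (m k))" using x(3)[of k] by (simp add: algebra_simps)
    moreover have "(1/3) ^ k * L (m k) \<ge> (1/3) ^ k * 4 ^ k"
      using m[of k] by (intro mult_left_mono) auto
    moreover have "(1/3) ^ k * 4 ^ k = (4/3::real) ^ k" by (simp flip: power_mult_distrib)
    ultimately show ?thesis by linarith
  qed
  obtain B where B: "\<And>n. q n X \<le> B" using pointwise[OF sqX] by blast
  obtain k where "(4/3) ^ k > 4 * B" using real_arch_pow[of "4/3" "4 * B"] by auto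
  with low[of k] B[of "m k"] show False by linarith
qed

lemma sq_int_count_space: "sq_int (count_space UNIV) x \<longleftrightarrow> x \<in> l2" for x :: "nat \<Rightarrow> complex"
  by (simp add: sq_int_def l2_def integrable_count_space_nat_iff)

lemma L2norm_count_space:
  fixes x :: "nat \<Rightarrow> complex"
  assumes "x \<in> l2" shows "(L2norm (count_space UNIV) x)\<^sup>2 = (\<Sum>k. (cmod (x k))\<^sup>2)"
  using assms unfolding L2norm_square by (intro integral_count_space_nat) (simp add: l2_def integrable_count_space_nat_iff)

lemma cov_count_space_sums:
  fixes x y :: "nat \<Rightarrow> complex"
  assumes "x \<in> l2" "y \<in> l2"
  shows "(\<lambda>k. x k * cnj (y k)) sums cov (count_space UNIV) x y"
  unfolding cov_def
  by (rule sums_integral_count_space_nat) (use assms integrable_cov in \<open>auto simp: sq_int_count_space[symmetric]\<close>)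

section \<open>Uniqueness of Fourier coefficients on the circle\<close>

lemma space_circ [simp]: "space circ = {-pi..<pi}"
  by (simp add: circ_def space_restrict_space)

lemma sets_circ: "sets circ = sets (restrict_space borel {-pi..<pi})"
  unfolding circ_def by (intro sets_restrict_space_cong) simp

lemma measurable_circ_borel [measurable (raw)]: "F \<in> measurable borel M \<Longrightarrow> F \<in> measurable circ M"
  unfolding measurable_cong_sets[OF sets_circ refl] by (rule measurable_restrict_space1)

lemma emeasure_circ: "emeasure circ (space circ) = ennreal (2 * pi)"
  unfolding circ_def by (subst emeasure_restrict_space) (auto simp: space_restrict_space)

lemma finite_measure_circ [simp]: "finite_measure circ"
  by (rule finite_measureI) (simp only: emeasure_circ, simp)

lemma continuous_measurable_circ [measurable (raw)]:
  fixes F :: "real \<Rightarrow> 'a::topological_space"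
  assumes "continuous_on UNIV F" shows "F \<in> borel_measurable circ"
  using borel_measurable_continuous_onI[OF assms] by (rule measurable_circ_borel)

lemma cis_measurable_circ [measurable, simp]:
  "(\<lambda>x. cis (c * x)) \<in> borel_measurable circ" "(\<lambda>x. cis (- (c * x))) \<in> borel_measurable circ"
  "(\<lambda>x. cis (x * c)) \<in> borel_measurable circ" "cis \<in> borel_measurable circ"
  by (auto intro!: continuous_measurable_circ continuous_intros)

lemma integrable_circ_bounded:
  fixes F :: "real \<Rightarrow> 'a::{banach, second_countable_topology}"
  assumes "F \<in> borel_measurable circ" "\<And>x. norm (F x) \<le> K"
  shows "integrable circ F"
  by (rule finite_measure.integrable_const_bound[OF finite_measure_circ _ assms(1)]) (use assms in auto)

lemma integrable_bounded_mult:
  fixes F G :: "'b \<Rightarrow> 'a::{real_normed_field, banach, second_countable_topology}"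
  assumes "integrable \<mu> G" "F \<in> borel_measurable \<mu>" "AE x in \<mu>. norm (F x) \<le> K"
  shows "integrable \<mu> (\<lambda>x. F x * G x)"
proof (rule Bochner_Integration.integrable_bound)
  show "integrable \<mu> (\<lambda>x. K * norm (G x))" using assms(1) by auto
  show "AE x in \<mu>. norm (F x * G x) \<le> norm (K * norm (G x))"
    using assms(3)
  proof eventually_elim
    case (elim x)
    then have "0 \<le> K" using norm_ge_zero order_trans by blast
    with elim show ?case by (simp add: norm_mult abs_mult mult_right_mono)
  qed
qed (use assms in measurable)

lemma AE_circ_interior: "AE x in circ. x \<noteq> -pi"
proof -
  have "AE x in lborel. x \<noteq> -pi" by (rule AE_lborel_singleton)
  then show ?thesis unfolding circ_def by (subst AE_restrict_space_iff) auto
qed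

lemma cis_inj: "cis x = cis y \<Longrightarrow> x \<in> {-pi<..<pi} \<Longrightarrow> y \<in> {-pi..pi} \<Longrightarrow> x = y"
proof -
  assume eq: "cis x = cis y" and x: "x \<in> {-pi<..<pi}" and y: "y \<in> {-pi..pi}"
  have sc: "sin x = sin y \<and> cos x = cos y" using eq by (simp add: complex_eq_iff)
  then obtain n :: int where n: "x = y + 2 * pi * n" unfolding sin_cos_eq_iff by blast
  have "\<bar>x - y\<bar> < 2 * pi" using x y by auto
  then have "\<bar>2 * pi * real_of_int n\<bar> < 2 * pi" using n by simp
  then have "\<bar>real_of_int n\<bar> < 1" by (simp add: abs_mult)
  then have "n = 0" by linarith
  then show "x = y" using n by simp
qed

text \<open>On the circle a real polynomial in the two coordinates is a trigonometric polynomial. After the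
  factor \<open>cis (- n * x)\<close>, which has modulus one, only nonnegative frequencies remain; this is how
  matrices indexed by \<open>nat\<close> see all trigonometric polynomials.\<close>

lemma real_polynomial_on_circle:
  fixes q :: "complex \<Rightarrow> real"
  assumes "real_polynomial_function q"
  shows "\<exists>n p. \<forall>x. of_real (q (cis x)) = cis (- (real n * x)) * poly p (cis x)"
  using assms
proof induction
  case (linear q)
  \<comment> \<open>coefficients of \<open>cis (- x)\<close> and \<open>cis x\<close> in \<open>cos x * q 1 + sin x * q \<i>\<close>\<close>
  define A B where "A = (of_real (q 1) + \<i> * of_real (q \<i>)) / 2" and "B = (of_real (q 1) - \<i> * of_real (q \<i>)) / 2"
  have "of_real (q (cis x)) = cis (- (real 1 * x)) * poly [:A, 0, B:] (cis x)" for x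
  proof -
    have "cis x = cos x *\<^sub>R 1 + sin x *\<^sub>R \<i>" by (simp add: complex_eq_iff)
    then have "q (cis x) = cos x * q 1 + sin x * q \<i>"
      using linear by (simp add: linear_simps)
    then have "of_real (q (cis x)) = cis (- x) * A + cis x * B"
      by (simp add: A_def B_def complex_eq_iff field_simps)
    also have "\<dots> = cis (- (real 1 * x)) * poly [:A, 0, B:] (cis x)"
      by (simp add: distrib_left cis_mult mult.assoc[symmetric])
    finally show ?thesis .
  qed
  then show ?case by blast
next
  case (const c)
  have "of_real c = cis (- (real 0 * x)) * poly [:of_real c:] (cis x)" for x by simp
  then show ?case by blast
next
  case (add f g)
  then obtain n p m r where f: "\<And>x. of_real (f (cis x)) = cis (- (real n * x)) * poly p (cis x)"
    and g: "\<And>x. of_real (g (cis x)) = cis (- (real m * x)) * poly r (cis x)" by blast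
  have "of_real (f (cis x) + g (cis x)) = cis (- (real (n + m) * x)) * poly (monom 1 m * p + monom 1 n * r) (cis x)" for x
  proof -
    have "cis (- (real (n + m) * x)) * cis (real m * x) = cis (- (real n * x))"
      "cis (- (real (n + m) * x)) * cis (real n * x) = cis (- (real m * x))"
      by (simp_all add: cis_mult algebra_simps)
    then show ?thesis
      by (simp add: f g poly_monom Complex.DeMoivre distrib_left mult.assoc[symmetric] del: of_nat_add)
  qed
  then show ?case by blast
next
  case (mult f g)
  then obtain n p m r where f: "\<And>x. of_real (f (cis x)) = cis (- (real n * x)) * poly p (cis x)"
    and g: "\<And>x. of_real (g (cis x)) = cis (- (real m * x)) * poly r (cis x)" by blast
  have "of_real (f (cis x) * g (cis x)) = cis (- (real (n + m) * x)) * poly (p * r) (cis x)" for x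
  proof -
    have "cis (- (real (n + m) * x)) = cis (- (real n * x)) * cis (- (real m * x))"
      by (simp add: cis_mult algebra_simps)
    then show ?thesis by (simp add: f g)
  qed
  then show ?case by blast
qed

text \<open>The indicator of \<open>U\<close> is a bounded pointwise limit of squares of trigonometric polynomials. The
  truncated multiples \<open>\<phi> n\<close> of the distance from the compact set \<open>C\<close>, the part of the circle outside \<open>U\<close>,
  increase to it, and the Stone-Weierstrass theorem approximates each of them uniformly. The end
  points of the interval are excluded from \<open>U\<close> because they are the same point of the circle.\<close>

lemma open_indicator_integral_nonneg:
  fixes v :: "real \<Rightarrow> real"
  assumes v: "integrable circ v"
    and pos: "\<And>p :: complex poly. 0 \<le> (LINT x|circ. (cmod (poly p (cis x)))\<^sup>2 * v x)"
    and U: "open U" "U \<subseteq> {-pi<..<pi}"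
  shows "0 \<le> (LINT x|circ. indicator U x * v x)"
proof -
  define C where "C = cis ` ({-pi..pi} - U)"
  have C: "compact C" unfolding C_def
    by (intro compact_continuous_image continuous_intros compact_diff U) auto
  have "pi \<in> {-pi..pi} - U" using U by auto
  then have "C \<noteq> {}" unfolding C_def by blast
  define \<phi> where "\<phi> n z = min 1 (real n * infdist z C)" for n z
  have cont: "continuous_on (sphere 0 1) (\<phi> n)" for n
    unfolding \<phi>_def by (intro continuous_intros)
  have "\<forall>n. \<exists>q. real_polynomial_function q \<and> (\<forall>z\<in>sphere 0 1. \<bar>\<phi> n z - q z\<bar> < 1 / real (Suc n))"
  proof
    fix n
    have "0 < 1 / real (Suc n)" by simp
    then obtain q where "real_polynomial_function q" "\<And>z. z \<in> sphere 0 1 \<Longrightarrow> \<bar>\<phi> n z - q z\<bar> < 1 / real (Suc n)"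
      using Stone_Weierstrass_real_polynomial_function[OF compact_sphere cont] by metis
    then show "\<exists>q. real_polynomial_function q \<and> (\<forall>z\<in>sphere 0 1. \<bar>\<phi> n z - q z\<bar> < 1 / real (Suc n))"
      by blast
  qed
  then obtain q where q': "\<forall>n. real_polynomial_function (q n) \<and> (\<forall>z\<in>sphere 0 1. \<bar>\<phi> n z - q n z\<bar> < 1 / real (Suc n))"
    unfolding choice_iff by (rule exE)
  have q: "real_polynomial_function (q n)" for n using q' by simp
  have q_near: "\<bar>\<phi> n z - q n z\<bar> < 1 / real (Suc n)" if "norm z = 1" for n z
    using q' that by (simp del: of_nat_Suc)
  have \<phi>_lim: "(\<lambda>n. \<phi> n (cis x)) \<longlonglongrightarrow> indicator U x" if x: "x \<in> {-pi..<pi}" for x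
  proof (cases "x \<in> U")
    case True
    have "cis x \<notin> C"
    proof
      assume "cis x \<in> C"
      then obtain y where "y \<in> {-pi..pi} - U" "cis x = cis y" by (auto simp: C_def)
      with cis_inj[of x y] True U show False by auto
    qed
    then have pos: "infdist (cis x) C > 0"
      using infdist_pos_not_in_closed[OF compact_imp_closed[OF C] \<open>C \<noteq> {}\<close>] by simp
    have "\<forall>\<^sub>F n in sequentially. real n > 1 / infdist (cis x) C"
      by (rule eventually_compose_filterlim[OF eventually_gt_at_top filterlim_real_sequentially])
    then have "\<forall>\<^sub>F n in sequentially. \<phi> n (cis x) = 1"
      by eventually_elim (use pos in \<open>simp add: \<phi>_def field_simps\<close>)
    then show ?thesis using True by (simp add: tendsto_eventually)
  next
    case False
    then have "cis x \<in> C" using x by (auto simp: C_def)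
    then have "infdist (cis x) C = 0" by simp
    then show ?thesis using False by (simp add: \<phi>_def)
  qed
  have q_lim: "(\<lambda>n. q n (cis x)) \<longlonglongrightarrow> indicator U x" if x: "x \<in> {-pi..<pi}" for x
  proof -
    have "(\<lambda>n. \<phi> n (cis x) - q n (cis x)) \<longlonglongrightarrow> 0"
    proof (rule Lim_null_comparison)
      show "\<forall>\<^sub>F n in sequentially. norm (\<phi> n (cis x) - q n (cis x)) \<le> 1 / real (Suc n)"
        using q_near by (simp add: less_imp_le)
      show "(\<lambda>n. 1 / real (Suc n)) \<longlonglongrightarrow> 0"
        using LIMSEQ_inverse_real_of_nat by (simp add: inverse_eq_divide)
    qed
    from tendsto_diff[OF \<phi>_lim[OF x] this] show ?thesis by simp
  qed
  have q_bound: "\<bar>q n (cis x)\<bar> \<le> 2" for n x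
  proof -
    have "0 \<le> \<phi> n (cis x)" "\<phi> n (cis x) \<le> 1" by (auto simp: \<phi>_def infdist_nonneg)
    moreover have "1 / real (Suc n) \<le> 1" by simp
    moreover have "\<bar>\<phi> n (cis x) - q n (cis x)\<bar> < 1 / real (Suc n)"
      by (rule q_near) simp
    ultimately show ?thesis by linarith
  qed
  have q_meas [measurable]: "(\<lambda>x. q n (cis x)) \<in> borel_measurable circ" for n
  proof (rule continuous_measurable_circ)
    have "continuous_on UNIV (q n)"
      using q continuous_on_polymonial_function real_polynomial_function_eq by blast
    then show "continuous_on UNIV (\<lambda>x. q n (cis x))"
      by (rule continuous_on_compose2) (auto intro: continuous_intros)
  qed
  have "(\<lambda>n. LINT x|circ. (q n (cis x))\<^sup>2 * v x) \<longlonglongrightarrow> (LINT x|circ. (indicator U x)\<^sup>2 * v x)"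
  proof (rule integral_dominated_convergence[where w = "\<lambda>x. 4 * \<bar>v x\<bar>"])
    have "U \<in> sets borel" using U by simp
    then show "(\<lambda>x. (indicator U x)\<^sup>2 * v x) \<in> borel_measurable circ"
      using v by (auto intro!: borel_measurable_times borel_measurable_power measurable_circ_borel)
    show "AE x in circ. (\<lambda>n. (q n (cis x))\<^sup>2 * v x) \<longlonglongrightarrow> (indicator U x)\<^sup>2 * v x"
      using q_lim by (intro AE_I2 tendsto_intros) auto
    have "(q n (cis x))\<^sup>2 \<le> 2\<^sup>2" for n x
      using power_mono[OF q_bound[of n x], of 2] by simp
    then show "AE x in circ. norm ((q n (cis x))\<^sup>2 * v x) \<le> 4 * \<bar>v x\<bar>" for n
      by (auto simp: abs_mult intro!: mult_right_mono)
  qed (use v in auto)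
  moreover have "0 \<le> (LINT x|circ. (q n (cis x))\<^sup>2 * v x)" for n
  proof -
    obtain m p where mp: "\<And>x. of_real (q n (cis x)) = cis (- (real m * x)) * poly p (cis x)"
      using real_polynomial_on_circle[OF q[of n]] by blast
    have "(q n (cis x))\<^sup>2 = (cmod (poly p (cis x)))\<^sup>2" for x
    proof -
      have "cmod (of_real (q n (cis x))) = cmod (poly p (cis x))" by (subst mp) (simp add: norm_mult)
      then show ?thesis by (metis norm_of_real power2_abs)
    qed
    then show ?thesis using pos[of p] by simp
  qed
  ultimately have "0 \<le> (LINT x|circ. (indicator U x)\<^sup>2 * v x)"
    by (intro LIMSEQ_le_const) auto
  also have "(\<lambda>x. (indicator U x)\<^sup>2 * v x) = (\<lambda>x. indicator U x * v x)"
    by (auto simp: indicator_def)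
  finally show ?thesis .
qed

text \<open>A density is nonnegative as soon as it has nonnegative integrals against all squared moduli of
  polynomials. The preceding lemma compares the measures with the densities \<open>v\<^sup>-\<close> and \<open>v\<^sup>+\<close> on open
  sets, outer regularity extends the comparison to Borel sets, and on \<open>{x. v x < 0}\<close> the measure with
  density \<open>v\<^sup>+\<close> vanishes.\<close>

lemma AE_nonneg_circ_if_trig_squares:
  fixes v :: "real \<Rightarrow> real"
  assumes v: "integrable circ v"
    and pos: "\<And>p :: complex poly. 0 \<le> (LINT x|circ. (cmod (poly p (cis x)))\<^sup>2 * v x)"
  shows "AE x in circ. 0 \<le> v x"
proof -
  have vm [measurable]: "v \<in> borel_measurable circ" using v by auto
  \<comment> \<open>for \<open>s = 1\<close> and \<open>s = -1\<close> the density is \<open>v\<^sup>+\<close> and \<open>v\<^sup>-\<close>, as \<open>ennreal\<close> maps negative numbers to \<open>0\<close>\<close>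
  define \<nu> where "\<nu> s = distr (density circ (\<lambda>x. ennreal (s * v x))) borel (\<lambda>x. x)" for s
  have \<nu>: "emeasure (\<nu> s) B = (\<integral>\<^sup>+x. ennreal (s * v x) * indicator B x \<partial>circ)" if [measurable]: "B \<in> sets borel" for s B
  proof -
    have [measurable]: "(\<lambda>x. x) \<in> borel_measurable circ" by measurable
    have "emeasure (\<nu> s) B = emeasure (density circ (\<lambda>x. ennreal (s * v x))) ((\<lambda>x. x) -` B \<inter> space circ)"
      unfolding \<nu>_def by (subst emeasure_distr) auto
    also have "\<dots> = (\<integral>\<^sup>+x. ennreal (s * v x) * indicator ((\<lambda>x. x) -` B \<inter> space circ) x \<partial>circ)"
      by (rule emeasure_density) measurable
    also have "\<dots> = (\<integral>\<^sup>+x. ennreal (s * v x) * indicator B x \<partial>circ)"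
      by (rule nn_integral_cong) (auto simp: indicator_def)
    finally show ?thesis .
  qed
  have outer: "emeasure (\<nu> s) B = (INF U\<in>{U. B \<subseteq> U \<and> open U}. emeasure (\<nu> s) U)" if B: "B \<in> sets borel" for s B
  proof (rule outer_regular)
    show "sets (\<nu> s) = sets borel" "B \<in> sets borel" using B by (simp_all add: \<nu>_def)
    have "integrable circ (\<lambda>x. s * v x)" using v by auto
    then have "(\<integral>\<^sup>+x. ennreal (s * v x) \<partial>circ) < \<infinity>"
      using integrableD(2) by (smt (verit, ccfv_SIG) ennreal_leI infinity_ennreal_def integrable_iff_bounded le_less_trans nn_integral_mono norm_ge_zero real_norm_def abs_ge_self)
    then show "emeasure (\<nu> s) (space (\<nu> s)) \<noteq> \<infinity>"
      using \<nu>[of UNIV s] by (simp add: \<nu>_def)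
  qed
  have open_le: "emeasure (\<nu> (-1)) U \<le> emeasure (\<nu> 1) U" if U: "open U" for U
  proof -
    define U' where "U' = U \<inter> {-pi<..<pi}"
    have U': "open U'" "U' \<subseteq> {-pi<..<pi}" using U by (auto simp: U'_def)
    have [measurable]: "U' \<in> sets borel" "U \<in> sets borel" using U U' by auto
    have eq: "emeasure (\<nu> s) U = (\<integral>\<^sup>+x. ennreal (s * (indicator U' x * v x)) \<partial>circ)" for s
      unfolding \<nu>[OF \<open>U \<in> sets borel\<close>]
    proof (rule nn_integral_cong_AE)
      show "AE x in circ. ennreal (s * v x) * indicator U x = ennreal (s * (indicator U' x * v x))"
        using AE_circ_interior AE_space by eventually_elim (auto simp: U'_def indicator_def)
    qed
    have int: "integrable circ (\<lambda>x. indicator U' x * v x)"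
      by (rule integrable_bounded_mult[OF v, where K = 1]) (auto intro!: measurable_circ_borel simp: indicator_def)
    have fin: "(\<integral>\<^sup>+x. ennreal (indicator U' x * v x) \<partial>circ) \<noteq> \<infinity>" "(\<integral>\<^sup>+x. ennreal (- (indicator U' x * v x)) \<partial>circ) \<noteq> \<infinity>"
      using int unfolding real_integrable_def by auto
    have "0 \<le> (LINT x|circ. indicator U' x * v x)"
      by (rule open_indicator_integral_nonneg[OF v pos U'])
    then have "enn2real (\<integral>\<^sup>+x. ennreal (- (indicator U' x * v x)) \<partial>circ) \<le> enn2real (\<integral>\<^sup>+x. ennreal (indicator U' x * v x) \<partial>circ)"
      unfolding real_lebesgue_integral_def[OF int] by simp
    then have "ennreal (enn2real (\<integral>\<^sup>+x. ennreal (- (indicator U' x * v x)) \<partial>circ)) \<le> ennreal (enn2real (\<integral>\<^sup>+x. ennreal (indicator U' x * v x) \<partial>circ))"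
      by (rule ennreal_leI)
    then show ?thesis unfolding eq using fin
      by (subst (asm) (1 2) ennreal_enn2real) (simp_all add: less_top)
  qed
  define B where "B = {x \<in> space circ. v x < 0}"
  have "B \<in> sets circ" unfolding B_def by measurable
  then have B [measurable]: "B \<in> sets borel"
    unfolding sets_circ by (simp add: sets_restrict_space_iff)
  have "emeasure (\<nu> (-1)) B \<le> emeasure (\<nu> 1) B"
    unfolding outer[OF B] by (rule INF_mono) (use open_le in blast)
  also have "\<dots> = 0"
    unfolding \<nu>[OF B] by (subst nn_integral_0_iff_AE) (auto simp: B_def indicator_def ennreal_neg less_imp_le)
  finally have "(\<integral>\<^sup>+x. ennreal (-1 * v x) * indicator B x \<partial>circ) = 0"
    unfolding \<nu>[OF B] by simp
  then have "AE x in circ. ennreal (-1 * v x) * indicator B x = 0"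
    by (subst (asm) nn_integral_0_iff_AE) auto
  with AE_space show ?thesis
    by eventually_elim (auto simp: B_def indicator_def ennreal_eq_0_iff split: if_splits)
qed

text \<open>All integrals of \<open>F\<close> against squared moduli of polynomials vanish, so the criterion applies to the
  real parts of \<open>F\<close>, \<open>-F\<close>, \<open>\<i> F\<close> and \<open>-\<i> F\<close>.\<close>

lemma circ_fourier_unique:
  fixes F :: "real \<Rightarrow> complex"
  assumes F: "integrable circ F" and zero: "\<And>n::int. (LINT x|circ. cis (of_int n * x) * F x) = 0"
  shows "AE x in circ. F x = 0"
proof -
  have int_cis: "integrable circ (\<lambda>x. cis (of_int n * x) * F x)" for n :: int
    by (rule integrable_bounded_mult[OF F, where K = 1]) auto
  have sq: "complex_of_real ((cmod (poly p (cis x)))\<^sup>2)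
      = (\<Sum>j\<le>degree p. \<Sum>k\<le>degree p. coeff p j * cnj (coeff p k) * cis (of_int (int j - int k) * x))" for p x
  proof -
    have "complex_of_real ((cmod (poly p (cis x)))\<^sup>2) = poly p (cis x) * cnj (poly p (cis x))"
      by (rule complex_norm_square)
    also have "\<dots> = (\<Sum>j\<le>degree p. \<Sum>k\<le>degree p. (coeff p j * cis x ^ j) * cnj (coeff p k * cis x ^ k))"
      by (simp add: poly_altdef sum_product)
    also have "\<dots> = (\<Sum>j\<le>degree p. \<Sum>k\<le>degree p. coeff p j * cnj (coeff p k) * cis (of_int (int j - int k) * x))"
    proof (intro sum.cong refl)
      fix j k
      have "cis (of_int (int j - int k) * x) = cis x ^ j * cnj (cis x ^ k)"
        unfolding Complex.DeMoivre cis_cnj cis_mult by (simp add: algebra_simps)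
      then show "(coeff p j * cis x ^ j) * cnj (coeff p k * cis x ^ k) = coeff p j * cnj (coeff p k) * cis (of_int (int j - int k) * x)"
        by simp
    qed
    finally show ?thesis .
  qed
  have zero': "(LINT x|circ. complex_of_real ((cmod (poly p (cis x)))\<^sup>2) * F x) = 0" for p
  proof -
    define d where "d = degree p"
    define g where "g j k x = coeff p j * cnj (coeff p k) * (cis (of_int (int j - int k) * x) * F x)" for j k x
    have int_g: "integrable circ (g j k)" for j k
      unfolding g_def by (intro integrable_mult_right int_cis)
    have "(LINT x|circ. complex_of_real ((cmod (poly p (cis x)))\<^sup>2) * F x) = (LINT x|circ. (\<Sum>j\<le>d. \<Sum>k\<le>d. g j k x))"
      unfolding sq sum_distrib_right g_def d_def by (simp add: mult.assoc)
    also have "\<dots> = (\<Sum>j\<le>d. LINT x|circ. (\<Sum>k\<le>d. g j k x))"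
      by (rule Bochner_Integration.integral_sum) (intro Bochner_Integration.integrable_sum int_g)
    also have "\<dots> = (\<Sum>j\<le>d. \<Sum>k\<le>d. LINT x|circ. g j k x)"
      by (intro sum.cong refl Bochner_Integration.integral_sum int_g)
    also have "\<dots> = 0" unfolding g_def by (simp only: integral_mult_right_zero zero mult_zero_right sum.neutral_const)
    finally show ?thesis .
  qed
  have int_sq: "integrable circ (\<lambda>x. complex_of_real ((cmod (poly p (cis x)))\<^sup>2) * F x)" for p
    unfolding sq sum_distrib_right mult.assoc
    by (intro Bochner_Integration.integrable_sum integrable_mult_right int_cis)
  have nonneg: "AE x in circ. 0 \<le> Re (c * F x)" for c
  proof (rule AE_nonneg_circ_if_trig_squares)
    show "integrable circ (\<lambda>x. Re (c * F x))" using F by auto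
    fix p :: "complex poly"
    have "(LINT x|circ. (cmod (poly p (cis x)))\<^sup>2 * Re (c * F x))
        = (LINT x|circ. Re (c * (complex_of_real ((cmod (poly p (cis x)))\<^sup>2) * F x)))"
      by (intro Bochner_Integration.integral_cong) (simp_all add: algebra_simps)
    also have "\<dots> = Re (c * (LINT x|circ. complex_of_real ((cmod (poly p (cis x)))\<^sup>2) * F x))"
    proof -
      have "(LINT x|circ. Re (c * (complex_of_real ((cmod (poly p (cis x)))\<^sup>2) * F x)))
          = Re (LINT x|circ. c * (complex_of_real ((cmod (poly p (cis x)))\<^sup>2) * F x))"
        by (rule integral_Re[OF integrable_mult_right[OF int_sq]])
      then show ?thesis by (simp only: integral_mult_right_zero)
    qed
    finally show "0 \<le> (LINT x|circ. (cmod (poly p (cis x)))\<^sup>2 * Re (c * F x))"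
      unfolding zero' by simp
  qed
  from nonneg[of 1] nonneg[of "-1"] nonneg[of "\<i>"] nonneg[of "-\<i>"]
  show ?thesis by eventually_elim (simp add: complex_eq_iff)
qed

section \<open>Fourier series in mean square\<close>

definition fourier :: "(real \<Rightarrow> complex) \<Rightarrow> int \<Rightarrow> complex" where
  "fourier F n = circ_mean (\<lambda>x. cis (- (of_int n * x)) * F x)"

lemma sq_int_circ_bounded:
  assumes "F \<in> borel_measurable circ" "\<And>x. cmod (F x) \<le> K" shows "sq_int circ F"
  unfolding sq_int_def
proof
  have "(cmod (F x))\<^sup>2 \<le> K\<^sup>2" for x using assms(2)[of x] by (intro power_mono) auto
  then show "integrable circ (\<lambda>x. (cmod (F x))\<^sup>2)"
    using assms(1) by (intro integrable_circ_bounded[where K = "K\<^sup>2"]) auto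
qed (rule assms)

lemma sq_int_cis [simp]: "sq_int circ (\<lambda>x. cis (c * x))"
  by (rule sq_int_circ_bounded[where K = 1]) auto

lemma sq_int_circ_integrable: "sq_int circ F \<Longrightarrow> integrable circ F"
  using integrable_mult_sq_int[of circ F "\<lambda>x. cis (0 * x)"] sq_int_cis[of 0] by simp

lemma fourier_cov: "fourier F n = cov circ F (\<lambda>x. cis (of_int n * x)) / (2 * of_real pi)"
  unfolding fourier_def circ_mean_def cov_def cis_cnj by (simp add: mult.commute)

lemma integral_cis_circ: "(LINT x|circ. cis (of_int n * x)) = (if n = 0 then 2 * of_real pi else 0)"
proof (cases "n = 0")
  case True
  have "(LINT x|circ. (1::complex)) = of_real (measure circ (space circ))" by (simp add: scaleR_conv_of_real)
  also have "measure circ (space circ) = 2 * pi"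
    unfolding measure_def emeasure_circ by simp
  finally show ?thesis using True by simp
next
  case False
  have [measurable]: "(\<lambda>x. cis (of_int n * x)) \<in> borel_measurable borel"
    by (intro borel_measurable_continuous_onI continuous_intros)
  define G where "G x = cis (of_int n * x) / (\<i> * of_int n)" for x
  have "(LINT x|circ. cis (of_int n * x)) = (LINT x|lborel. indicator {-pi..<pi} x *\<^sub>R cis (of_int n * x))"
    unfolding circ_def by (rule integral_restrict_space) simp
  also have "\<dots> = (LINT x|lborel. indicator {-pi..pi} x *\<^sub>R cis (of_int n * x))"
  proof (rule integral_cong_AE)
    show "AE x in lborel. indicator {-pi..<pi} x *\<^sub>R cis (of_int n * x) = indicator {-pi..pi} x *\<^sub>R cis (of_int n * x)"
      using AE_lborel_singleton[of pi] by eventually_elim (auto simp: indicator_def)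
  qed measurable
  also have "\<dots> = G pi - G (-pi)"
  proof (rule integral_FTC_Icc)
    show "(G has_vector_derivative cis (of_int n * x)) (at x within {-pi..pi})" for x
      unfolding G_def has_vector_derivative_def
      by (rule derivative_eq_intros refl | simp add: False)+
        (use False in \<open>simp add: field_simps scaleR_conv_of_real\<close>)
  qed (auto intro!: continuous_intros)
  also have "\<dots> = 0"
  proof -
    have "cis (of_int n * pi) = cis (of_int n * (-pi)) * cis (2 * pi * of_int n)"
      unfolding cis_mult by (simp add: algebra_simps)
    then show ?thesis by (simp add: G_def)
  qed
  finally show ?thesis using False by simp
qed

lemma cov_cis: "cov circ (\<lambda>x. cis (of_int m * x)) (\<lambda>x. cis (of_int n * x)) = (if m = n then 2 * of_real pi else 0)"
proof -
  have "cis (of_int m * x) * cnj (cis (of_int n * x)) = cis (of_int (m - n) * x)" for x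
    unfolding cis_cnj cis_mult by (simp add: algebra_simps)
  then show ?thesis unfolding cov_def using integral_cis_circ[of "m - n"] by simp
qed

lemma L2norm_trig_sum:
  assumes e: "inj e" and A: "finite A"
  shows "(L2norm circ (\<lambda>x. \<Sum>k\<in>A. c k * cis (of_int (e k) * x)))\<^sup>2 = 2 * pi * (\<Sum>k\<in>A. (cmod (c k))\<^sup>2)"
proof -
  define E where "E k x = cis (of_int (e k) * x)" for k x
  have E: "sq_int circ (E k)" for k unfolding E_def by simp
  let ?S = "\<lambda>x. \<Sum>k\<in>A. c k * E k x"
  have S: "sq_int circ ?S" by (intro sq_int_sum sq_int_scale E)
  have "cov circ ?S ?S = (\<Sum>k\<in>A. c k * cov circ (E k) ?S)"
    by (subst cov_sum_left[OF sq_int_scale[OF E] S]) (simp only: cov_scale_left)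
  also have "\<dots> = (\<Sum>k\<in>A. c k * (\<Sum>j\<in>A. cnj (c j) * cov circ (E k) (E j)))"
    by (subst cov_sum_right[OF sq_int_scale[OF E] E]) (simp only: cov_scale_right)
  also have "\<dots> = (\<Sum>k\<in>A. \<Sum>j\<in>A. c k * cnj (c j) * cov circ (E k) (E j))"
    by (simp only: sum_distrib_left mult.assoc)
  also have "\<dots> = (\<Sum>k\<in>A. c k * cnj (c k) * (2 * of_real pi))"
    unfolding E_def cov_cis using A e by (intro sum.cong refl) (simp add: if_distrib[of "(*) _"] inj_eq cong: if_cong)
  also have "\<dots> = of_real (2 * pi * (\<Sum>k\<in>A. (cmod (c k))\<^sup>2))"
    by (simp add: sum_distrib_left complex_norm_square mult_ac del: of_real_power)
  finally show ?thesis unfolding cov_self of_real_eq_iff E_def .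
qed

text \<open>Orthogonality makes the partial sums a Cauchy sequence, so the choice in the definition of
  \<open>trig_series\<close> is realised.\<close>

lemma trig_series_ms_tendsto:
  assumes c: "c \<in> l2" and e: "inj e"
  shows "ms_tendsto circ (\<lambda>n x. \<Sum>k<n. c k * cis (of_int (e k) * x)) (trig_series e c)"
proof -
  define S where "S n x = (\<Sum>k<n. c k * cis (of_int (e k) * x))" for n :: nat and x
  have sq: "sq_int circ (S n)" for n unfolding S_def by (intro sq_int_sum sq_int_scale sq_int_cis)
  have diff: "(L2norm circ (\<lambda>x. S m x - S n x))\<^sup>2 = 2 * pi * (\<Sum>k\<in>{n..<m}. (cmod (c k))\<^sup>2)" if "n \<le> m" for m n
  proof -
    have "S m x - S n x = (\<Sum>k\<in>{n..<m}. c k * cis (of_int (e k) * x))" for x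
      unfolding S_def lessThan_atLeast0 by (subst sum_diff_nat_ivl) (use that in auto)
    then show ?thesis by (simp add: L2norm_trig_sum[OF e])
  qed
  have "\<exists>F. ms_tendsto circ S F"
  proof (rule L2_complete[OF sq])
    fix \<epsilon> :: real assume \<epsilon>: "\<epsilon> > 0"
    have "summable (\<lambda>k. (cmod (c k))\<^sup>2)" using c by (simp add: l2_def)
    then obtain N where N: "\<And>m n. m \<ge> N \<Longrightarrow> norm (\<Sum>k\<in>{m..<n}. (cmod (c k))\<^sup>2) < \<epsilon>\<^sup>2 / (2 * pi)"
      unfolding summable_Cauchy using \<epsilon> by (meson divide_pos_pos mult_pos_pos pi_gt_zero zero_less_numeral zero_less_power)
    have le: "L2norm circ (\<lambda>x. S m x - S n x) < \<epsilon>" if "n \<le> m" "n \<ge> N" for m n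
    proof (rule power2_less_imp_less)
      have "(\<Sum>k\<in>{n..<m}. (cmod (c k))\<^sup>2) < \<epsilon>\<^sup>2 / (2 * pi)" using N[OF that(2), of m] by simp
      then show "(L2norm circ (\<lambda>x. S m x - S n x))\<^sup>2 < \<epsilon>\<^sup>2"
        unfolding diff[OF that(1)] by (simp add: field_simps)
    qed (use \<epsilon> in simp)
    have "L2norm circ (\<lambda>x. S m x - S n x) < \<epsilon>" if "m \<ge> N" "n \<ge> N" for m n
      using le[of n m] le[of m n] that L2norm_minus_commute[of circ "S m" "S n"] by (cases "n \<le> m") auto
    then show "\<exists>N. \<forall>m\<ge>N. \<forall>n\<ge>N. L2norm circ (\<lambda>x. S m x - S n x) < \<epsilon>" by blast
  qed
  then have "\<exists>F. ms_tendsto circ (\<lambda>n x. \<Sum>k<n. c k * cis (of_int (e k) * x)) F"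
    unfolding S_def .
  then show ?thesis unfolding trig_series_def by (rule someI_ex)
qed

lemma sq_int_trig_series: "c \<in> l2 \<Longrightarrow> inj e \<Longrightarrow> sq_int circ (trig_series e c)"
  using trig_series_ms_tendsto by (auto simp: ms_tendsto_iff)

text \<open>Continuity of the inner product. Parseval's identity and the convolution formula for the
  coefficients of a product are both instances.\<close>

lemma cov_trig_series_sums:
  assumes c: "c \<in> l2" and e: "inj e" and G: "sq_int circ G"
  shows "(\<lambda>k. c k * cov circ (\<lambda>x. cis (of_int (e k) * x)) G) sums cov circ (trig_series e c) G"
proof -
  have "(\<lambda>n. cov circ (\<lambda>x. \<Sum>k<n. c k * cis (of_int (e k) * x)) G) \<longlonglongrightarrow> cov circ (trig_series e c) G"
    by (rule ms_tendsto_cov[OF trig_series_ms_tendsto[OF c e] ms_tendsto_const[OF G]])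
  then show ?thesis unfolding sums_def
    by (simp add: cov_sum_left sq_int_scale cov_scale_left G)
qed

text \<open>The product is integrable, and each of its coefficients is an inner product of two
  square-integrable functions.\<close>

lemma fourier_mult_trig_series_sums:
  assumes c: "c \<in> l2" and e: "inj e" and F: "sq_int circ F"
  shows "(\<lambda>k. fourier F (n - e k) * c k) sums fourier (\<lambda>x. F x * trig_series e c x) n"
proof -
  define G where "G x = cnj (cis (- (of_int n * x)) * F x)" for x
  have G: "sq_int circ G" unfolding G_def
    using sq_int_mult_bounded[OF F, of "\<lambda>x. cis (- (of_int n) * x)" 1] by (intro sq_int_cnj) simp
  have "cov circ (\<lambda>x. cis (of_int (e k) * x)) G = fourier F (n - e k) * (2 * of_real pi)" for k
  proof -
    have "cis (of_int (e k) * x) * cnj (G x) = cis (- (of_int (n - e k) * x)) * F x" for x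
      unfolding G_def complex_cnj_cnj mult.assoc[symmetric] cis_mult by (simp add: algebra_simps)
    then show ?thesis by (simp add: cov_def fourier_def circ_mean_def)
  qed
  moreover have "cov circ (trig_series e c) G = fourier (\<lambda>x. F x * trig_series e c x) n * (2 * of_real pi)"
    by (simp add: cov_def fourier_def circ_mean_def G_def mult_ac)
  ultimately have "(\<lambda>k. c k * (fourier F (n - e k) * (2 * of_real pi))) sums (fourier (\<lambda>x. F x * trig_series e c x) n * (2 * of_real pi))"
    using cov_trig_series_sums[OF c e G] by simp
  from sums_divide[OF this, of "2 * of_real pi"] show ?thesis by (simp add: mult_ac)
qed

lemma fourier_trig_series:
  assumes c: "c \<in> l2" and e: "inj e"
  shows "fourier (trig_series e c) n = (if n \<in> range e then c (inv e n) else 0)"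
proof -
  have "(\<lambda>k. c k * (if e k = n then 2 * of_real pi else 0)) sums cov circ (trig_series e c) (\<lambda>x. cis (of_int n * x))"
    using cov_trig_series_sums[OF c e sq_int_cis[of "of_int n"]] by (simp add: cov_cis cong: if_cong)
  moreover have "(\<lambda>k. c k * (if e k = n then 2 * of_real pi else 0)) sums (if n \<in> range e then c (inv e n) * (2 * of_real pi) else 0)"
  proof (cases "n \<in> range e")
    case True
    then obtain j where j: "n = e j" by blast
    then have "(\<lambda>k. c k * (if e k = n then 2 * of_real pi else 0)) = (\<lambda>k. if k = j then c k * (2 * of_real pi) else 0)"
      using e by (auto simp: fun_eq_iff inj_eq)
    then show ?thesis using True j e sums_single[of j "\<lambda>k. c k * (2 * of_real pi)"] by simp
  next
    case False
    then have "(\<lambda>k. c k * (if e k = n then 2 * of_real pi else 0)) = (\<lambda>k. 0)"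
      by (intro ext) (metis mult_zero_right rangeI)
    then show ?thesis using False by simp
  qed
  ultimately have "cov circ (trig_series e c) (\<lambda>x. cis (of_int n * x)) = (if n \<in> range e then c (inv e n) * (2 * of_real pi) else 0)"
    using sums_unique2 by blast
  then show ?thesis unfolding fourier_cov by simp
qed

lemma fourier_trig_series_in: "c \<in> l2 \<Longrightarrow> inj e \<Longrightarrow> fourier (trig_series e c) (e k) = c k"
  by (simp add: fourier_trig_series)

lemma fourier_trig_series_notin: "c \<in> l2 \<Longrightarrow> inj e \<Longrightarrow> n \<notin> range e \<Longrightarrow> fourier (trig_series e c) n = 0"
  by (simp add: fourier_trig_series)

lemma Bessel:
  assumes F: "sq_int circ F" and e: "inj e"
  shows "(\<lambda>k. fourier F (e k)) \<in> l2" "(\<Sum>k. (cmod (fourier F (e k)))\<^sup>2) \<le> (L2norm circ F)\<^sup>2 / (2 * pi)"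
proof -
  have bound: "(\<Sum>k<n. (cmod (fourier F (e k)))\<^sup>2) \<le> (L2norm circ F)\<^sup>2 / (2 * pi)" for n
  proof -
    define S where "S x = (\<Sum>k<n. fourier F (e k) * cis (of_int (e k) * x))" for x
    have sq: "sq_int circ S" unfolding S_def by (intro sq_int_sum sq_int_scale sq_int_cis)
    have "cov circ F S = (\<Sum>k<n. cnj (fourier F (e k)) * cov circ F (\<lambda>x. cis (of_int (e k) * x)))"
      unfolding S_def by (simp add: cov_sum_right sq_int_scale F cov_scale_right)
    also have "\<dots> = (\<Sum>k<n. of_real (2 * pi * (cmod (fourier F (e k)))\<^sup>2))"
    proof (rule sum.cong[OF refl])
      fix k
      have "cov circ F (\<lambda>x. cis (of_int (e k) * x)) = of_real (2 * pi) * fourier F (e k)"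
        by (simp add: fourier_cov)
      then show "cnj (fourier F (e k)) * cov circ F (\<lambda>x. cis (of_int (e k) * x)) = of_real (2 * pi * (cmod (fourier F (e k)))\<^sup>2)"
        unfolding of_real_mult[of "2 * pi"] complex_norm_square by simp
    qed
    finally have "Re (cov circ F S) = 2 * pi * (\<Sum>k<n. (cmod (fourier F (e k)))\<^sup>2)"
      by (simp add: sum_distrib_left)
    moreover have "(L2norm circ S)\<^sup>2 = 2 * pi * (\<Sum>k<n. (cmod (fourier F (e k)))\<^sup>2)"
      unfolding S_def by (rule L2norm_trig_sum[OF e]) simp
    moreover have "0 \<le> (L2norm circ (\<lambda>x. F x - S x))\<^sup>2" by simp
    ultimately have "2 * pi * (\<Sum>k<n. (cmod (fourier F (e k)))\<^sup>2) \<le> (L2norm circ F)\<^sup>2"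
      unfolding L2norm_diff_square[OF F sq] by linarith
    then show ?thesis by (simp add: field_simps)
  qed
  have s: "summable (\<lambda>k. (cmod (fourier F (e k)))\<^sup>2)"
    by (rule bounded_imp_summable[OF _ bound[of "Suc _", unfolded lessThan_Suc_atMost]]) simp
  then show "(\<lambda>k. fourier F (e k)) \<in> l2" by (simp add: l2_def)
  show "(\<Sum>k. (cmod (fourier F (e k)))\<^sup>2) \<le> (L2norm circ F)\<^sup>2 / (2 * pi)"
    by (rule suminf_le_const[OF s bound])
qed

lemma fourier_diff:
  assumes "integrable circ F" "integrable circ G"
  shows "fourier (\<lambda>x. F x - G x) n = fourier F n - fourier G n"
proof -
  have "integrable circ (\<lambda>x. cis (- (of_int n * x)) * H x)" if "integrable circ H" for H
    using integrable_bounded_mult[OF that, of "\<lambda>x. cis (- of_int n * x)" 1] by simp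
  from this[OF assms(1)] this[OF assms(2)] show ?thesis
    by (simp add: fourier_def circ_mean_def right_diff_distrib diff_divide_distrib)
qed

lemma fourier_cnj: "fourier (\<lambda>x. cnj (F x)) n = cnj (fourier F (- n))"
proof -
  have "(\<lambda>x. cis (- (of_int n * x)) * cnj (F x)) = (\<lambda>x. cnj (cis (- (of_int (- n) * x)) * F x))"
    by (simp add: cis_cnj)
  then have "fourier (\<lambda>x. cnj (F x)) n = cnj (LINT x|circ. cis (- (of_int (- n) * x)) * F x) / (2 * of_real pi)"
    unfolding fourier_def circ_mean_def by (simp only: Bochner_Integration.integral_cnj)
  then show ?thesis unfolding fourier_def circ_mean_def by simp
qed

lemma fourier_cong_AE:
  assumes "AE x in circ. F x = G x" "F \<in> borel_measurable circ" "G \<in> borel_measurable circ"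
  shows "fourier F n = fourier G n"
proof -
  show ?thesis unfolding fourier_def circ_mean_def
    by (intro arg_cong2[where f = "(/)"] refl integral_cong_AE) (use assms in auto)
qed

lemma fourier_eq_imp_AE_eq:
  assumes "integrable circ F" "integrable circ G" "\<And>n. fourier F n = fourier G n"
  shows "AE x in circ. F x = G x"
proof -
  have "AE x in circ. F x - G x = 0"
  proof (rule circ_fourier_unique)
    show "integrable circ (\<lambda>x. F x - G x)" using assms by auto
    fix n :: int
    have "fourier (\<lambda>x. F x - G x) (- n) = 0" using assms by (simp add: fourier_diff)
    then show "(LINT x|circ. cis (of_int n * x) * (F x - G x)) = 0"
      by (simp add: fourier_def circ_mean_def)
  qed
  then show ?thesis by simp
qed

lemma AE_eq_trig_series:
  assumes F: "integrable circ F" and c: "c \<in> l2" and e: "inj e"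
    and coeffs: "\<And>k. fourier F (e k) = c k" "\<And>n. n \<notin> range e \<Longrightarrow> fourier F n = 0"
  shows "AE x in circ. F x = trig_series e c x"
proof (rule fourier_eq_imp_AE_eq[OF F])
  show "integrable circ (trig_series e c)" by (intro sq_int_circ_integrable sq_int_trig_series c e)
  show "fourier F n = fourier (trig_series e c) n" for n
    using coeffs by (cases "n \<in> range e") (auto simp: fourier_trig_series_in fourier_trig_series_notin c e)
qed

section \<open>Toeplitz matrices and their symbols\<close>

text \<open>A form of the closed graph theorem: the norms of the first \<open>n\<close> coordinates of \<open>T x\<close> are seminorms
  that are bounded for each \<open>n\<close> and, as functions of \<open>n\<close>, bounded at each \<open>x\<close>.\<close>

lemma coordinatewise_bounded_imp_bounded:
  fixes T :: "(nat \<Rightarrow> complex) \<Rightarrow> nat \<Rightarrow> complex"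
  assumes maps: "\<And>x. x \<in> l2 \<Longrightarrow> T x \<in> l2"
    and add: "\<And>x y l. x \<in> l2 \<Longrightarrow> y \<in> l2 \<Longrightarrow> T (\<lambda>k. x k + y k) l = T x l + T y l"
    and scale: "\<And>c x l. x \<in> l2 \<Longrightarrow> T (\<lambda>k. c * x k) l = c * T x l"
    and coord: "\<And>l. \<exists>K. \<forall>x\<in>l2. cmod (T x l) \<le> K * L2norm (count_space UNIV) x"
  shows "\<exists>K. \<forall>x\<in>l2. L2norm (count_space UNIV) (T x) \<le> K * L2norm (count_space UNIV) x"
proof -
  let ?C = "count_space UNIV :: nat measure"
  define q where "q n x = L2_set (\<lambda>l. cmod (T x l)) {..<n}" for n x
  have "\<exists>K. \<forall>n x. sq_int ?C x \<longrightarrow> q n x \<le> K * L2norm ?C x"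
  proof (rule L2_uniform_boundedness; unfold sq_int_count_space)
    fix n x y assume xy: "x \<in> l2" "y \<in> l2"
    have "q n (\<lambda>k. x k + y k) \<le> L2_set (\<lambda>l. cmod (T x l) + cmod (T y l)) {..<n}"
      unfolding q_def add[OF xy] by (intro L2_set_mono norm_triangle_ineq) auto
    also have "\<dots> \<le> q n x + q n y" unfolding q_def by (rule L2_set_triangle_ineq)
    finally show "q n (\<lambda>k. x k + y k) \<le> q n x + q n y" .
  next
    fix n x and c :: complex assume x: "x \<in> l2"
    show "q n (\<lambda>k. c * x k) = cmod c * q n x"
      unfolding q_def scale[OF x] norm_mult by (rule L2_set_right_distrib[symmetric]) simp
  next
    fix n
    obtain K where K: "\<forall>l. \<forall>x\<in>l2. cmod (T x l) \<le> K l * L2norm ?C x"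
    proof -
      have "\<forall>l. \<exists>K. \<forall>x\<in>l2. cmod (T x l) \<le> K * L2norm ?C x" using coord by blast
      then show ?thesis using that unfolding choice_iff by blast
    qed
    have "q n x \<le> (\<Sum>l<n. K l) * L2norm ?C x" if "x \<in> l2" for x
    proof -
      have "q n x \<le> (\<Sum>l<n. cmod (T x l))" unfolding q_def by (rule L2_set_le_sum) simp
      also have "\<dots> \<le> (\<Sum>l<n. K l * L2norm ?C x)" by (rule sum_mono) (use K that in blast)
      finally show ?thesis by (simp add: sum_distrib_right)
    qed
    then show "\<exists>K. \<forall>x. x \<in> l2 \<longrightarrow> q n x \<le> K * L2norm ?C x" by blast
  next
    fix x assume x: "x \<in> l2"
    have "q n x \<le> L2norm ?C (T x)" for n
    proof (rule power2_le_imp_le)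
      have "(q n x)\<^sup>2 = (\<Sum>l<n. (cmod (T x l))\<^sup>2)"
        unfolding q_def L2_set_def by (simp add: sum_nonneg)
      also have "\<dots> \<le> (\<Sum>l. (cmod (T x l))\<^sup>2)"
        by (rule sum_le_suminf) (use maps[OF x] in \<open>auto simp: l2_def\<close>)
      finally show "(q n x)\<^sup>2 \<le> (L2norm ?C (T x))\<^sup>2" using L2norm_count_space[OF maps[OF x]] by simp
    qed simp
    then show "\<exists>B. \<forall>n. q n x \<le> B" by blast
  qed
  then obtain K where K: "\<forall>n x. sq_int ?C x \<longrightarrow> q n x \<le> K * L2norm ?C x" by blast
  have "L2norm ?C (T x) \<le> K * L2norm ?C x" if x: "x \<in> l2" for x
  proof (rule power2_le_imp_le)
    have q: "q n x \<le> K * L2norm ?C x" "0 \<le> q n x" for n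
      using K x by (auto simp: sq_int_count_space q_def)
    show "0 \<le> K * L2norm ?C x" using q[of 0] by linarith
    have "(\<Sum>l. (cmod (T x l))\<^sup>2) \<le> (K * L2norm ?C x)\<^sup>2"
    proof (rule suminf_le_const)
      show "summable (\<lambda>l. (cmod (T x l))\<^sup>2)" using maps[OF x] by (simp add: l2_def)
      have "(q n x)\<^sup>2 = (\<Sum>l<n. (cmod (T x l))\<^sup>2)" for n
        unfolding q_def L2_set_def by (simp add: sum_nonneg)
      then show "(\<Sum>l<n. (cmod (T x l))\<^sup>2) \<le> (K * L2norm ?C x)\<^sup>2" for n
        using power_mono[OF q, of n 2] by simp
    qed
    then show "(L2norm ?C (T x))\<^sup>2 \<le> (K * L2norm ?C x)\<^sup>2"
      using L2norm_count_space[OF maps[OF x]] by simp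
  qed
  then show ?thesis by blast
qed

text \<open>The compression to nonnegative frequencies of the multiplication by the symbol \<open>F\<close>.\<close>

definition toeplitz :: "(real \<Rightarrow> complex) \<Rightarrow> nat \<Rightarrow> nat \<Rightarrow> complex" where
  "toeplitz F l k = fourier F (int l - int k)"

lemma inj_freq: "inj int" "inj (\<lambda>k. - int k)" "inj (\<lambda>k. int k + 1)" "inj (\<lambda>k. - int k - 1)" "inj (\<lambda>k. n - int k)"
  by (auto simp: inj_def)

lemma toeplitz_row_sums:
  assumes "sq_int circ F" "x \<in> l2"
  shows "(\<lambda>k. toeplitz F l k * x k) sums fourier (\<lambda>t. F t * trig_series int x t) (int l)"
  unfolding toeplitz_def by (rule fourier_mult_trig_series_sums[OF assms(2) inj_freq(1) assms(1)])

lemma mat_app_toeplitz: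
  assumes "sq_int circ F" "x \<in> l2"
  shows "mat_app (toeplitz F) x l = fourier (\<lambda>t. F t * trig_series int x t) (int l)"
  unfolding mat_app_def using sums_unique[OF toeplitz_row_sums[OF assms]] by simp

lemma l2_matrix_toeplitz:
  assumes F: "F \<in> borel_measurable circ" "AE t in circ. cmod (F t) \<le> K"
  shows "l2_matrix (toeplitz F)"
proof -
  have sqF: "sq_int circ F"
    using sq_int_mult_bounded[OF sq_int_cis[of 0] F] by simp
  show ?thesis unfolding l2_matrix_def
  proof (intro ballI conjI allI)
    fix x :: "nat \<Rightarrow> complex" assume x: "x \<in> l2"
    show "summable (\<lambda>k. toeplitz F l k * x k)" for l
      using toeplitz_row_sums[OF sqF x] by (rule sums_summable)
    have "sq_int circ (\<lambda>t. F t * trig_series int x t)"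
      by (rule sq_int_mult_bounded[OF sq_int_trig_series[OF x inj_freq(1)] F])
    from Bessel(1)[OF this inj_freq(1)] show "mat_app (toeplitz F) x \<in> l2"
      using mat_app_toeplitz[OF sqF x] by (simp add: l2_def)
  qed
qed

text \<open>The sesquilinear form of the matrix is that of the multiplication operator. This is the bridge
  between estimates for the matrix and estimates for the symbol.\<close>

lemma toeplitz_form:
  assumes F: "sq_int circ F" and x: "x \<in> l2" and y: "y \<in> l2"
    and sq: "sq_int circ (\<lambda>t. F t * trig_series int y t)"
  shows "cov circ (trig_series int x) (\<lambda>t. F t * trig_series int y t)
       = 2 * of_real pi * cov (count_space UNIV) x (mat_app (toeplitz F) y)"
proof -
  let ?G = "\<lambda>t. F t * trig_series int y t"
  have G: "cov circ (\<lambda>t. cis (of_int (int k) * t)) ?G = 2 * of_real pi * cnj (mat_app (toeplitz F) y k)" for k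
    unfolding mat_app_toeplitz[OF F y] fourier_cov by (subst cov_commute) simp
  have Py: "mat_app (toeplitz F) y \<in> l2"
    using Bessel(1)[OF sq inj_freq(1)] mat_app_toeplitz[OF F y] by (simp add: l2_def)
  have "(\<lambda>k. x k * (2 * of_real pi * cnj (mat_app (toeplitz F) y k))) sums cov circ (trig_series int x) ?G"
    using cov_trig_series_sums[OF x inj_freq(1) sq] unfolding G .
  moreover have "(\<lambda>k. 2 * of_real pi * (x k * cnj (mat_app (toeplitz F) y k))) sums (2 * of_real pi * cov (count_space UNIV) x (mat_app (toeplitz F) y))"
    by (rule sums_mult[OF cov_count_space_sums[OF x Py]])
  ultimately show ?thesis using sums_unique2 by (simp add: mult.left_commute)
qed

lemma l2_finite_support:
  fixes x :: "nat \<Rightarrow> complex"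
  assumes "\<And>k. k > n \<Longrightarrow> x k = 0" shows "x \<in> l2"
  unfolding l2_def mem_Collect_eq by (rule summable_finite[of "{..n}"]) (use assms in auto)

lemma coeff_l2: "coeff p \<in> l2"
  by (rule l2_finite_support[of "degree p"]) (rule coeff_eq_0)

lemma trig_series_coeff: "AE t in circ. trig_series int (coeff p) t = poly p (cis t)"
proof (rule ms_tendsto_unique[OF trig_series_ms_tendsto[OF coeff_l2 inj_freq(1)]])
  let ?S = "\<lambda>n t. \<Sum>k<n. coeff p k * cis (of_int (int k) * t)"
  have eq: "?S n t = poly p (cis t)" if "n > degree p" for n t
  proof -
    have "?S n t = (\<Sum>k\<le>degree p. coeff p k * cis (of_int (int k) * t))"
      by (rule sum.mono_neutral_right) (use that in \<open>auto simp: coeff_eq_0\<close>)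
    then show ?thesis by (simp add: poly_altdef Complex.DeMoivre)
  qed
  have sq: "sq_int circ (?S n)" for n by (intro sq_int_sum sq_int_scale sq_int_cis)
  have "sq_int circ (\<lambda>t. poly p (cis t))"
    using sq[of "Suc (degree p)"] unfolding eq[OF lessI] .
  moreover have "(\<lambda>n. L2norm circ (\<lambda>t. ?S n t - poly p (cis t))) \<longlonglongrightarrow> 0"
  proof (rule tendsto_eventually)
    show "\<forall>\<^sub>F n in sequentially. L2norm circ (\<lambda>t. ?S n t - poly p (cis t)) = 0"
      using eventually_gt_at_top[of "degree p"] 
    proof eventually_elim
      case (elim n)
      then show ?case unfolding eq[OF elim] by (simp add: L2norm_def)
    qed
  qed
  ultimately show "ms_tendsto circ ?S (\<lambda>t. poly p (cis t))"
    using sq by (simp add: ms_tendsto_iff)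
qed

lemma poly_cis_bounded: "\<exists>B. \<forall>t. cmod (poly p (cis t)) \<le> B"
proof -
  have "cmod (poly p (cis t)) \<le> (\<Sum>k\<le>degree p. cmod (coeff p k))" for t
    unfolding poly_altdef by (rule order_trans[OF norm_sum]) (simp add: norm_mult norm_power)
  then show ?thesis by blast
qed

lemma poly_cis_measurable [measurable, simp]: "(\<lambda>t. poly p (cis t)) \<in> borel_measurable circ"
  by (rule continuous_measurable_circ) (intro continuous_intros)

lemma L2norm_trig_series:
  assumes c: "c \<in> l2" and e: "inj e"
  shows "(L2norm circ (trig_series e c))\<^sup>2 = 2 * pi * (L2norm (count_space UNIV) c)\<^sup>2"
proof -
  have "(\<lambda>n. (L2norm circ (\<lambda>x. \<Sum>k<n. c k * cis (of_int (e k) * x)))\<^sup>2) \<longlonglongrightarrow> (L2norm circ (trig_series e c))\<^sup>2"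
    by (intro tendsto_power ms_tendsto_L2norm[OF trig_series_ms_tendsto[OF c e]])
  then have "(\<lambda>n. 2 * pi * (\<Sum>k<n. (cmod (c k))\<^sup>2)) \<longlonglongrightarrow> (L2norm circ (trig_series e c))\<^sup>2"
    by (simp add: L2norm_trig_sum[OF e])
  moreover have "(\<lambda>n. 2 * pi * (\<Sum>k<n. (cmod (c k))\<^sup>2)) \<longlonglongrightarrow> 2 * pi * (\<Sum>k. (cmod (c k))\<^sup>2)"
    using c by (intro tendsto_mult_left summable_LIMSEQ) (simp add: l2_def)
  ultimately show ?thesis unfolding L2norm_count_space[OF c] using LIMSEQ_unique by blast
qed

lemma L2norm_poly: "(L2norm circ (\<lambda>t. poly p (cis t)))\<^sup>2 = 2 * pi * (L2norm (count_space UNIV) (coeff p))\<^sup>2"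
proof -
  have "L2norm circ (\<lambda>t. poly p (cis t)) = L2norm circ (trig_series int (coeff p))"
    by (rule L2norm_cong_AE) (use trig_series_coeff[of p] sq_int_trig_series[OF coeff_l2 inj_freq(1), of p] in \<open>auto dest: sq_int_measurable\<close>)
  then show ?thesis using L2norm_trig_series[OF coeff_l2 inj_freq(1)] by simp
qed

text \<open>The first column of the matrix contains the coefficients of \<open>u\<close> at nonnegative frequencies, and
  since \<open>u\<close> is real the others are their conjugates. Hence \<open>u\<close> has the coefficients of a
  square-integrable function.\<close>

lemma toeplitz_symbol_sq_int:
  assumes u: "integrable circ u" and P: "l2_matrix (toeplitz (\<lambda>t. of_real (u t)))"
  shows "sq_int circ (\<lambda>t. complex_of_real (u t))"
proof -
  let ?U = "\<lambda>t. complex_of_real (u t)"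
  have e0: "(\<lambda>k. if k = 0 then 1 else 0) \<in> l2" by (rule l2_finite_support[of 0]) auto
  have "mat_app (toeplitz ?U) (\<lambda>k. if k = 0 then 1 else 0) = (\<lambda>l. fourier ?U (int l))"
  proof
    fix l
    have "(\<lambda>k. toeplitz ?U l k * (if k = 0 then 1 else 0)) = (\<lambda>k. if k = 0 then toeplitz ?U l k else 0)" by auto
    then show "mat_app (toeplitz ?U) (\<lambda>k. if k = 0 then 1 else 0) l = fourier ?U (int l)"
      unfolding mat_app_def using sums_unique[OF sums_single[of 0 "toeplitz ?U l"]] by (simp add: toeplitz_def)
  qed
  then have c: "(\<lambda>l. fourier ?U (int l)) \<in> l2"
    using P e0 unfolding l2_matrix_def by metis
  have neg: "fourier ?U (- n) = cnj (fourier ?U n)" for n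
    using fourier_cnj[of ?U "- n"] by simp
  have d: "(\<lambda>l. fourier ?U (- int l - 1)) \<in> l2"
  proof -
    have "summable (\<lambda>l. (cmod (fourier ?U (int (Suc l))))\<^sup>2)"
      using c summable_Suc_iff[of "\<lambda>l. (cmod (fourier ?U (int l)))\<^sup>2"] by (simp add: l2_def del: of_nat_Suc)
    moreover have "cmod (fourier ?U (- int l - 1)) = cmod (fourier ?U (int (Suc l)))" for l
    proof -
      have "- int l - 1 = - int (Suc l)" by simp
      then show ?thesis by (simp only: neg complex_mod_cnj)
    qed
    ultimately show ?thesis by (simp add: l2_def)
  qed
  \<comment> \<open>the two halves of the Fourier series of \<open>u\<close>, at nonnegative and at negative frequencies\<close>
  define F where "F t = trig_series int (\<lambda>l. fourier ?U (int l)) t - trig_series (\<lambda>k. - int k - 1) (\<lambda>l. - fourier ?U (- int l - 1)) t" for t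
  have d': "(\<lambda>l. - fourier ?U (- int l - 1)) \<in> l2" using d by (simp add: l2_def)
  have F: "sq_int circ F" unfolding F_def
    by (intro sq_int_diff sq_int_trig_series c d' inj_freq)
  have "AE t in circ. F t = ?U t"
  proof (rule fourier_eq_imp_AE_eq)
    show "integrable circ F" by (rule sq_int_circ_integrable[OF F])
    show "integrable circ ?U" using u by (rule integrable_of_real)
    fix n :: int
    have "fourier F n = fourier (trig_series int (\<lambda>l. fourier ?U (int l))) n - fourier (trig_series (\<lambda>k. - int k - 1) (\<lambda>l. - fourier ?U (- int l - 1))) n"
      unfolding F_def by (intro fourier_diff sq_int_circ_integrable sq_int_trig_series c d' inj_freq)
    also have "\<dots> = fourier ?U n"
    proof (cases "n \<ge> 0")
      case True
      then obtain l where l: "n = int l" using nonneg_int_cases by blast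
      have "n \<notin> range (\<lambda>k. - int k - 1)" using True by auto
      then show ?thesis using fourier_trig_series_in[OF c inj_freq(1), of l] fourier_trig_series_notin[OF d' inj_freq(4)] l by simp
    next
      case False
      then obtain l where l: "n = - int l - 1" by (metis add.commute diff_0 int_cases minus_diff_commute negative_eq_positive not_le of_nat_0_le_iff uminus_add_conv_diff minus_add_distrib of_nat_Suc)
      have "n \<notin> range int" using False by auto
      then show ?thesis using fourier_trig_series_in[OF d' inj_freq(4), of l] fourier_trig_series_notin[OF c inj_freq(1)] l by simp
    qed
    finally show "fourier F n = fourier ?U n" .
  qed
  from sq_int_cong_AE[OF F this] show ?thesis using u by auto
qed

lemma l2_add: "x \<in> l2 \<Longrightarrow> y \<in> l2 \<Longrightarrow> (\<lambda>k. x k + y k) \<in> l2"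
  unfolding sq_int_count_space[symmetric] by (rule sq_int_add)

lemma l2_scale: "x \<in> l2 \<Longrightarrow> (\<lambda>k. c * x k) \<in> l2"
  unfolding sq_int_count_space[symmetric] by (rule sq_int_scale)

lemma mat_app_add:
  assumes "l2_matrix A" "x \<in> l2" "y \<in> l2"
  shows "mat_app A (\<lambda>k. x k + y k) l = mat_app A x l + mat_app A y l"
  using assms unfolding l2_matrix_def mat_app_def by (simp add: distrib_left suminf_add)

lemma mat_app_scale:
  assumes "l2_matrix A" "x \<in> l2"
  shows "mat_app A (\<lambda>k. c * x k) l = c * mat_app A x l"
  using assms unfolding l2_matrix_def mat_app_def by (simp add: mult.left_commute suminf_mult)

text \<open>The rows are square-summable by Bessel's inequality, so each coordinate of the image is a bounded
  functional.\<close>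

lemma toeplitz_bounded:
  assumes U: "sq_int circ U" and P: "l2_matrix (toeplitz U)"
  shows "\<exists>K. \<forall>x\<in>l2. L2norm (count_space UNIV) (mat_app (toeplitz U) x) \<le> K * L2norm (count_space UNIV) x"
proof (rule coordinatewise_bounded_imp_bounded)
  fix l
  define r where "r k = cnj (toeplitz U l k)" for k
  have r: "r \<in> l2"
    using Bessel(1)[OF U inj_freq(5)[of "int l"]] by (simp add: r_def toeplitz_def l2_def)
  have "cmod (mat_app (toeplitz U) x l) \<le> L2norm (count_space UNIV) r * L2norm (count_space UNIV) x" if x: "x \<in> l2" for x
  proof -
    have "mat_app (toeplitz U) x l = cov (count_space UNIV) x r"
      unfolding mat_app_def using sums_unique[OF cov_count_space_sums[OF x r]] by (simp add: r_def mult.commute)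
    then show ?thesis using L2norm_Cauchy_Schwarz[of "count_space UNIV" x r] x r by (simp add: sq_int_count_space mult.commute)
  qed
  then show "\<exists>K. \<forall>x\<in>l2. cmod (mat_app (toeplitz U) x l) \<le> K * L2norm (count_space UNIV) x" by blast
qed (use P in \<open>auto simp: mat_app_add mat_app_scale l2_matrix_def\<close>)

text \<open>With \<open>x\<close> the coefficients of a polynomial \<open>p\<close> and \<open>K\<close> a bound of the operator, the form at \<open>x\<close> is at
  most \<open>K * \<parallel>x\<parallel>\<^sup>2\<close>, that is, \<open>\<bar>p\<bar>\<^sup>2 * (K - u)\<close> has nonnegative mean on the circle.\<close>

lemma toeplitz_symbol_bounded:
  assumes u: "integrable circ u" and P: "l2_matrix (toeplitz (\<lambda>t. of_real (u t)))"
  shows "\<exists>K. AE t in circ. u t \<le> K"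
proof -
  let ?U = "\<lambda>t. complex_of_real (u t)"
  let ?C = "count_space UNIV :: nat measure"
  have U: "sq_int circ ?U" by (rule toeplitz_symbol_sq_int[OF assms])
  obtain K where K: "\<forall>x\<in>l2. L2norm ?C (mat_app (toeplitz ?U) x) \<le> K * L2norm ?C x"
    using toeplitz_bounded[OF U P] by blast
  have "AE t in circ. 0 \<le> K - u t"
  proof (rule AE_nonneg_circ_if_trig_squares)
    show "integrable circ (\<lambda>t. K - u t)" by (rule Bochner_Integration.integrable_diff[OF finite_measure.integrable_const[OF finite_measure_circ] u])
    fix p :: "complex poly"
    let ?x = "coeff p" and ?p = "\<lambda>t. poly p (cis t)"
    let ?X = "trig_series int ?x"
    have X: "sq_int circ ?X" by (intro sq_int_trig_series coeff_l2 inj_freq)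
    obtain B where B: "\<And>t. cmod (?p t) \<le> B" using poly_cis_bounded by blast
    have p: "sq_int circ ?p" by (rule sq_int_circ_bounded[OF _ B]) simp
    have Up: "sq_int circ (\<lambda>t. ?U t * ?p t)"
      using sq_int_mult_bounded[OF U, of ?p B] B by (simp add: mult.commute)
    have UX: "sq_int circ (\<lambda>t. ?U t * ?X t)"
      by (rule sq_int_cong_AE[OF Up]) (use trig_series_coeff[of p] sq_int_measurable[OF X] sq_int_measurable[OF U] in auto)
    have Px: "mat_app (toeplitz ?U) ?x \<in> l2" using P coeff_l2 by (auto simp: l2_matrix_def)
    have "cov circ ?p (\<lambda>t. ?U t * ?p t) = cov circ ?X (\<lambda>t. ?U t * ?X t)"
      by (rule cov_cong_AE) (use trig_series_coeff[of p] sq_int_measurable[OF X] sq_int_measurable[OF U] in auto)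
    also have "\<dots> = 2 * of_real pi * cov ?C ?x (mat_app (toeplitz ?U) ?x)"
      by (rule toeplitz_form[OF U coeff_l2 coeff_l2 UX])
    finally have form: "cov circ ?p (\<lambda>t. ?U t * ?p t) = 2 * of_real pi * cov ?C ?x (mat_app (toeplitz ?U) ?x)" .
    have "cov circ ?p (\<lambda>t. ?U t * ?p t) = of_real (LINT t|circ. (cmod (?p t))\<^sup>2 * u t)"
    proof -
      have "?p t * cnj (?U t * ?p t) = of_real ((cmod (?p t))\<^sup>2 * u t)" for t
        unfolding of_real_mult complex_norm_square by simp
      then show ?thesis unfolding cov_def by (simp only: integral_complex_of_real)
    qed
    then have "(LINT t|circ. (cmod (?p t))\<^sup>2 * u t) = 2 * pi * Re (cov ?C ?x (mat_app (toeplitz ?U) ?x))"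
      using arg_cong[OF form, of Re] by simp
    also have "\<dots> \<le> 2 * pi * (L2norm ?C ?x * L2norm ?C (mat_app (toeplitz ?U) ?x))"
      using order_trans[OF complex_Re_le_cmod L2norm_Cauchy_Schwarz[of ?C ?x "mat_app (toeplitz ?U) ?x"]] coeff_l2 Px
      by (auto simp: sq_int_count_space)
    also have "\<dots> \<le> 2 * pi * (L2norm ?C ?x * (K * L2norm ?C ?x))"
      using K coeff_l2 by (intro mult_left_mono) auto
    also have "\<dots> = K * (L2norm circ ?p)\<^sup>2" unfolding L2norm_poly by (simp add: power2_eq_square)
    also have "\<dots> = (LINT t|circ. (cmod (?p t))\<^sup>2 * K)" unfolding L2norm_square by simp
    finally have le: "(LINT t|circ. (cmod (?p t))\<^sup>2 * u t) \<le> (LINT t|circ. (cmod (?p t))\<^sup>2 * K)" .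
    have "integrable circ (\<lambda>t. (cmod (?p t))\<^sup>2)" using p by (simp add: sq_int_def)
    moreover have "integrable circ (\<lambda>t. (cmod (?p t))\<^sup>2 * u t)"
    proof (rule integrable_bounded_mult[OF u, where K = "B\<^sup>2"])
      show "AE t in circ. norm ((cmod (?p t))\<^sup>2) \<le> B\<^sup>2" using B by (auto intro!: power_mono)
    qed simp
    ultimately show "0 \<le> (LINT t|circ. (cmod (?p t))\<^sup>2 * (K - u t))"
      using le by (simp add: right_diff_distrib)
  qed
  then show ?thesis by (intro exI[of _ K]) auto
qed

lemma toeplitz_symmetric:
  assumes u: "u \<in> borel_measurable circ" "AE t in circ. \<bar>u t\<bar> \<le> K" and x: "x \<in> l2" and y: "y \<in> l2"
  shows "cov (count_space UNIV) (mat_app (toeplitz (\<lambda>t. of_real (u t))) x) y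
       = cov (count_space UNIV) x (mat_app (toeplitz (\<lambda>t. of_real (u t))) y)"
proof -
  let ?U = "\<lambda>t. complex_of_real (u t)"
  let ?C = "count_space UNIV :: nat measure"
  have Um: "?U \<in> borel_measurable circ" "AE t in circ. cmod (?U t) \<le> K" using u by auto
  have U: "sq_int circ ?U" using sq_int_mult_bounded[OF sq_int_cis[of 0] Um] by simp
  have sq: "sq_int circ (\<lambda>t. ?U t * trig_series int z t)" if "z \<in> l2" for z
    by (rule sq_int_mult_bounded[OF sq_int_trig_series[OF that inj_freq(1)] Um])
  have "2 * of_real pi * cov ?C x (mat_app (toeplitz ?U) y) = cov circ (trig_series int x) (\<lambda>t. ?U t * trig_series int y t)"
    by (rule toeplitz_form[OF U x y sq[OF y], symmetric])
  also have "\<dots> = cov circ (\<lambda>t. ?U t * trig_series int x t) (trig_series int y)"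
    unfolding cov_def by (intro Bochner_Integration.integral_cong) (simp_all add: mult_ac)
  also have "\<dots> = cnj (2 * of_real pi * cov ?C y (mat_app (toeplitz ?U) x))"
    unfolding toeplitz_form[OF U y x sq[OF x], symmetric] by (rule cov_commute)
  also have "\<dots> = 2 * of_real pi * cov ?C (mat_app (toeplitz ?U) x) y"
    unfolding cov_commute[of ?C "mat_app (toeplitz ?U) x" y] by simp
  finally show ?thesis by simp
qed

text \<open>The inverse \<open>A\<close> of a symmetric operator is symmetric, so its \<open>l\<close>-th coordinate is the inner product
  with the image under \<open>A\<close> of the \<open>l\<close>-th unit vector. Thus \<open>A\<close> is coordinatewise bounded, hence bounded.\<close>

lemma toeplitz_bounded_below:
  assumes u: "u \<in> borel_measurable circ" "AE t in circ. \<bar>u t\<bar> \<le> K"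
    and P: "l2_matrix (toeplitz (\<lambda>t. of_real (u t)))" and inv: "l2_invertible (toeplitz (\<lambda>t. of_real (u t)))"
  shows "\<exists>K'. \<forall>x\<in>l2. L2norm (count_space UNIV) x \<le> K' * L2norm (count_space UNIV) (mat_app (toeplitz (\<lambda>t. of_real (u t))) x)"
proof -
  let ?C = "count_space UNIV :: nat measure"
  define P where "P = mat_app (toeplitz (\<lambda>t. of_real (u t)))"
  define A where "A = inv_into l2 P"
  have bij: "bij_betw P l2 l2" using inv unfolding l2_invertible_def P_def .
  then have inj: "inj_on P l2" by (rule bij_betw_imp_inj_on)
  have A: "A y \<in> l2" "P (A y) = y" if "y \<in> l2" for y
    unfolding A_def using that bij_betw_imp_surj_on[OF bij]
    by (auto intro: inv_into_into f_inv_into_f[of y P l2])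
  have AP: "A (P x) = x" if "x \<in> l2" for x unfolding A_def using inj that by (rule inv_into_f_f)
  have P_l2: "P x \<in> l2" if "x \<in> l2" for x using bij that by (auto simp: bij_betw_def)
  have sym: "cov ?C (P x) y = cov ?C x (P y)" if "x \<in> l2" "y \<in> l2" for x y
    unfolding P_def by (rule toeplitz_symmetric[OF u that])
  have "\<exists>K'. \<forall>y\<in>l2. L2norm ?C (A y) \<le> K' * L2norm ?C y"
  proof (rule coordinatewise_bounded_imp_bounded)
    show "A x \<in> l2" if "x \<in> l2" for x using A that by blast
    fix x y :: "nat \<Rightarrow> complex" and c l assume x: "x \<in> l2" 
    { assume y: "y \<in> l2"
      have "P (\<lambda>k. A x k + A y k) = (\<lambda>k. x k + y k)"
        unfolding P_def using mat_app_add[OF P A(1)[OF x] A(1)[OF y]] A(2)[OF x] A(2)[OF y] by (auto simp: P_def)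
      then have "A (\<lambda>k. x k + y k) = (\<lambda>k. A x k + A y k)"
        using AP[OF l2_add[OF A(1)[OF x] A(1)[OF y]]] by simp
      then show "A (\<lambda>k. x k + y k) l = A x l + A y l" by simp }
    have "P (\<lambda>k. c * A x k) = (\<lambda>k. c * x k)"
      unfolding P_def using mat_app_scale[OF P A(1)[OF x]] A(2)[OF x] by (auto simp: P_def)
    then have "A (\<lambda>k. c * x k) = (\<lambda>k. c * A x k)"
      using AP[OF l2_scale[OF A(1)[OF x], of c]] by simp
    then show "A (\<lambda>k. c * x k) l = c * A x l" by simp
  next
    fix l :: nat
    define e where "e k = (if k = l then 1 else 0 :: complex)" for k
    have e: "e \<in> l2" by (rule l2_finite_support[of l]) (auto simp: e_def)
    have "cmod (A x l) \<le> L2norm ?C (A e) * L2norm ?C x" if x: "x \<in> l2" for x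
    proof -
      have "(\<lambda>k. A x k * cnj (e k)) = (\<lambda>k. if k = l then A x k else 0)" by (auto simp: e_def)
      then have "A x l = cov ?C (A x) e"
        using sums_unique2[OF cov_count_space_sums[OF A(1)[OF x] e]] sums_single[of l "A x"] by simp
      also have "\<dots> = cov ?C (A x) (P (A e))" using A(2)[OF e] by simp
      also have "\<dots> = cov ?C (P (A x)) (A e)" by (rule sym[symmetric]) (use A x e in auto)
      also have "\<dots> = cov ?C x (A e)" using A(2)[OF x] by simp
      finally show ?thesis
        using L2norm_Cauchy_Schwarz[of ?C x "A e"] x A(1)[OF e] by (simp add: sq_int_count_space mult.commute)
    qed
    then show "\<exists>K. \<forall>x\<in>l2. cmod (A x l) \<le> K * L2norm ?C x" by blast
  qed
  then obtain K' where K': "\<forall>y\<in>l2. L2norm ?C (A y) \<le> K' * L2norm ?C y" by blast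
  have "L2norm ?C x \<le> K' * L2norm ?C (P x)" if "x \<in> l2" for x
    using K' P_l2[OF that] AP[OF that] by (metis (full_types))
  then show ?thesis unfolding P_def by blast
qed

text \<open>For a polynomial \<open>p\<close> with coefficients \<open>x\<close>, the norm of \<open>x\<close> is at most \<open>K'\<close> times the norm of its
  image, which by Bessel's inequality is controlled by the norm of \<open>u * p\<close>. Hence \<open>\<bar>p\<bar>\<^sup>2 * (K'\<^sup>2 * u\<^sup>2 - 1)\<close>
  has nonnegative mean.\<close>

lemma toeplitz_symbol_bounded_below:
  assumes u: "u \<in> borel_measurable circ" "AE t in circ. \<bar>u t\<bar> \<le> K"
    and P: "l2_matrix (toeplitz (\<lambda>t. of_real (u t)))" and inv: "l2_invertible (toeplitz (\<lambda>t. of_real (u t)))"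
  shows "\<exists>K'. AE t in circ. 1 \<le> K' * (u t)\<^sup>2"
proof -
  let ?U = "\<lambda>t. complex_of_real (u t)"
  let ?C = "count_space UNIV :: nat measure"
  have Um: "?U \<in> borel_measurable circ" "AE t in circ. cmod (?U t) \<le> K" using u by auto
  have U: "sq_int circ ?U" using sq_int_mult_bounded[OF sq_int_cis[of 0] Um] by simp
  obtain K' where K': "\<forall>x\<in>l2. L2norm ?C x \<le> K' * L2norm ?C (mat_app (toeplitz ?U) x)"
    using toeplitz_bounded_below[OF assms] by blast
  have u2: "integrable circ (\<lambda>t. (u t)\<^sup>2)" using U by (simp add: sq_int_def)
  have "AE t in circ. 0 \<le> K'\<^sup>2 * (u t)\<^sup>2 - 1"
  proof (rule AE_nonneg_circ_if_trig_squares)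
    show "integrable circ (\<lambda>t. K'\<^sup>2 * (u t)\<^sup>2 - 1)"
      by (intro Bochner_Integration.integrable_diff finite_measure.integrable_const[OF finite_measure_circ] integrable_mult_right u2)
    fix p :: "complex poly"
    let ?x = "coeff p" and ?p = "\<lambda>t. poly p (cis t)"
    let ?X = "trig_series int ?x"
    obtain B where B: "\<And>t. cmod (?p t) \<le> B" using poly_cis_bounded by blast
    have p: "sq_int circ ?p" by (rule sq_int_circ_bounded[OF _ B]) simp
    have X: "sq_int circ ?X" by (intro sq_int_trig_series coeff_l2 inj_freq)
    have Up: "sq_int circ (\<lambda>t. ?U t * ?p t)" and UX: "sq_int circ (\<lambda>t. ?U t * ?X t)"
      using sq_int_mult_bounded[OF p Um] sq_int_mult_bounded[OF X Um] .
    have Px: "mat_app (toeplitz ?U) ?x \<in> l2" using P coeff_l2 by (auto simp: l2_matrix_def)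
    have "(L2norm circ ?p)\<^sup>2 = 2 * pi * (L2norm ?C ?x)\<^sup>2" by (rule L2norm_poly)
    also have "\<dots> \<le> 2 * pi * (K' * L2norm ?C (mat_app (toeplitz ?U) ?x))\<^sup>2"
      using K' coeff_l2 by (intro mult_left_mono power_mono) auto
    also have "\<dots> = 2 * pi * K'\<^sup>2 * (\<Sum>k. (cmod (fourier (\<lambda>t. ?U t * ?X t) (int k)))\<^sup>2)"
      unfolding power_mult_distrib L2norm_count_space[OF Px] mat_app_toeplitz[OF U coeff_l2] by simp
    also have "\<dots> \<le> 2 * pi * K'\<^sup>2 * ((L2norm circ (\<lambda>t. ?U t * ?X t))\<^sup>2 / (2 * pi))"
      by (intro mult_left_mono Bessel UX inj_freq) simp
    also have "L2norm circ (\<lambda>t. ?U t * ?X t) = L2norm circ (\<lambda>t. ?U t * ?p t)"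
      by (rule L2norm_cong_AE) (use trig_series_coeff[of p] UX Up in \<open>auto dest: sq_int_measurable\<close>)
    finally have "(L2norm circ ?p)\<^sup>2 \<le> K'\<^sup>2 * (L2norm circ (\<lambda>t. ?U t * ?p t))\<^sup>2" by simp
    moreover have "K'\<^sup>2 * (L2norm circ (\<lambda>t. ?U t * ?p t))\<^sup>2 = (LINT t|circ. (cmod (?p t))\<^sup>2 * (K'\<^sup>2 * (u t)\<^sup>2))"
      unfolding L2norm_square integral_mult_right_zero[symmetric]
      by (intro Bochner_Integration.integral_cong) (auto simp: norm_mult power_mult_distrib)
    ultimately have le: "(LINT t|circ. (cmod (?p t))\<^sup>2) \<le> (LINT t|circ. (cmod (?p t))\<^sup>2 * (K'\<^sup>2 * (u t)\<^sup>2))"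
      unfolding L2norm_square by simp
    have "integrable circ (\<lambda>t. (cmod (?p t))\<^sup>2)" using p by (simp add: sq_int_def)
    moreover have "integrable circ (\<lambda>t. (cmod (?p t))\<^sup>2 * (K'\<^sup>2 * (u t)\<^sup>2))"
    proof (rule integrable_bounded_mult[OF integrable_mult_right[OF u2], where K = "B\<^sup>2"])
      show "AE t in circ. norm ((cmod (?p t))\<^sup>2) \<le> B\<^sup>2" using B by (auto intro!: power_mono)
    qed simp
    ultimately show "0 \<le> (LINT t|circ. (cmod (?p t))\<^sup>2 * (K'\<^sup>2 * (u t)\<^sup>2 - 1))"
      using le by (simp add: right_diff_distrib)
  qed
  then show ?thesis by (intro exI[of _ "K'\<^sup>2"]) auto
qed

lemma P_mat_toeplitz: "P_mat f g = toeplitz (\<lambda>t. of_real (1 / (f t + g t)))"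
proof (intro ext)
  fix l k
  have "x * (real k - real l) = - (of_int (int l - int k) * x)" for x
    by (simp add: algebra_simps)
  then have "cis (x * (real k - real l)) / of_real (f x + g x) = cis (- (of_int (int l - int k) * x)) * of_real (1 / (f x + g x))" for x
    by simp
  then show "P_mat f g l k = toeplitz (\<lambda>t. of_real (1 / (f t + g t))) l k"
    unfolding P_mat_def toeplitz_def fourier_def by (simp only:)
qed

text \<open>The analytic content of the assumption that \<open>P_mat f g\<close> is an invertible operator: \<open>f + g\<close> is bounded
  and bounded away from zero, so \<open>L\<^sub>2\<close> of the circle and \<open>L\<^sub>2(f + g)\<close> are the same space with equivalent
  norms.\<close>

lemma spectral_density_bounds:
  assumes f: "spectral_density f" and g: "spectral_density g"
    and fin: "(\<integral>\<^sup>+x. 1 / ennreal (f x + g x) \<partial>circ) < \<infinity>"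
    and P: "l2_matrix (P_mat f g)" and inv: "l2_invertible (P_mat f g)"
  shows "\<exists>K. AE x in circ. 0 < f x + g x \<and> f x + g x \<le> K \<and> 1 / (f x + g x) \<le> K"
proof -
  define u where "u x = 1 / (f x + g x)" for x
  have [measurable]: "f \<in> borel_measurable circ" "g \<in> borel_measurable circ"
    using f g by (auto simp: spectral_density_def)
  have um [measurable]: "u \<in> borel_measurable circ" unfolding u_def by measurable
  have nonneg: "AE x in circ. 0 \<le> f x \<and> 0 \<le> g x"
    using AE_space by eventually_elim (use f g in \<open>auto simp: spectral_density_def\<close>)
  have "AE x in circ. 1 / ennreal (f x + g x) \<noteq> \<infinity>"
    by (rule nn_integral_PInf_AE) (use fin in auto)
  then have pos: "AE x in circ. 0 < f x + g x"
    using nonneg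
  proof eventually_elim
    case (elim x)
    have "1 / ennreal 0 = \<infinity>" by (simp add: divide_ennreal_def)
    with elim(1) have "f x + g x \<noteq> 0" by metis
    with elim show ?case by auto
  qed
  have "(\<integral>\<^sup>+x. ennreal (norm (u x)) \<partial>circ) = (\<integral>\<^sup>+x. 1 / ennreal (f x + g x) \<partial>circ)"
  proof (rule nn_integral_cong_AE)
    show "AE x in circ. ennreal (norm (u x)) = 1 / ennreal (f x + g x)"
      using pos by eventually_elim (simp add: u_def divide_ennreal[symmetric] flip: ennreal_1)
  qed
  then have u: "integrable circ u" using fin by (intro integrableI_bounded) auto
  have T: "l2_matrix (toeplitz (\<lambda>t. of_real (u t)))" "l2_invertible (toeplitz (\<lambda>t. of_real (u t)))"
    using P inv unfolding P_mat_toeplitz u_def by auto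
  obtain K where K: "AE t in circ. u t \<le> K" using toeplitz_symbol_bounded[OF u T(1)] by blast
  have "AE t in circ. \<bar>u t\<bar> \<le> K" using K pos by eventually_elim (simp add: u_def)
  from toeplitz_symbol_bounded_below[OF um this T] obtain K' where K': "AE t in circ. 1 \<le> K' * (u t)\<^sup>2" by blast
  have "AE x in circ. 0 < f x + g x \<and> f x + g x \<le> max (K' * K) K \<and> 1 / (f x + g x) \<le> max (K' * K) K"
    using K K' pos
  proof eventually_elim
    case (elim x)
    have w: "(f x + g x) * u x = 1" "u x > 0" using elim by (auto simp: u_def)
    have K'_nonneg: "0 \<le> K'" using elim(2) w(2) by (smt (verit) mult_nonpos_nonneg zero_le_power2)
    have "f x + g x = (f x + g x) * 1" by simp
    also have "\<dots> \<le> (f x + g x) * (K' * (u x)\<^sup>2)" using elim by (intro mult_left_mono) auto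
    also have "\<dots> = K' * u x * ((f x + g x) * u x)" by (simp add: power2_eq_square mult_ac)
    also have "\<dots> = K' * u x" using w by simp
    also have "\<dots> \<le> K' * K" using elim K'_nonneg by (intro mult_left_mono) auto
    finally show ?case using elim by (auto simp: u_def)
  qed
  then show ?thesis by blast
qed

section \<open>Inversion by canonical factorization\<close>

text \<open>Neither factor has negative frequencies.\<close>

lemma fourier_mult_analytic:
  assumes F: "sq_int circ F" "\<And>n. n < 0 \<Longrightarrow> fourier F n = 0" and x: "x \<in> l2" and n: "n < 0"
  shows "fourier (\<lambda>t. F t * trig_series int x t) n = 0"
proof -
  have "fourier F (n - int k) = 0" for k using F(2) n by auto
  then show ?thesis
    using sums_unique2[OF fourier_mult_trig_series_sums[OF x inj_freq(1) F(1), of n] ] by simp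
qed

text \<open>In terms of symbols, \<open>T\<close> and \<open>T'\<close> are the Toeplitz matrices of \<open>\<Theta>\<close> and of its conjugate. The conjugate
  of \<open>\<Theta>\<close> is analytic, so \<open>T' v\<close> is the coefficient sequence of \<open>cnj \<Theta> * V\<close> without any loss. Multiplying by
  \<open>1 / w = \<bar>\<Psi>\<bar>\<^sup>2\<close> gives \<open>\<Psi> * V = Y - \<Psi> * D\<close>, where \<open>D = \<Theta> * Y - V\<close> contains the negative frequencies that
  the passage from \<open>\<Theta> * Y\<close> to \<open>v\<close> has discarded. As \<open>\<Psi>\<close> is antianalytic, \<open>\<Psi> * D\<close> has negative frequencies
  only, and the coefficients at nonnegative frequencies are those of \<open>Y\<close>.\<close>

lemma factorization_inverse:
  assumes fact: "canonical_factorization w \<psi> \<theta>"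
    and w: "w \<in> borel_measurable circ" "AE x in circ. 0 < w x \<and> w x \<le> K \<and> 1 / w x \<le> K"
  defines "T \<equiv> \<lambda>k j. Theta_mat \<theta> j k" and "T' \<equiv> \<lambda>k j. cnj (Theta_mat \<theta> k j)"
  shows "l2_matrix T" "l2_matrix T'"
    "y \<in> l2 \<Longrightarrow> mat_app (toeplitz (\<lambda>t. of_real (1 / w t))) (mat_app T' (mat_app T y)) = y"
proof -
  define \<Theta> where "\<Theta> = trig_series (\<lambda>k. - int k) \<theta>"
  define \<Psi> where "\<Psi> = trig_series (\<lambda>k. - int k) \<psi>"
  have l2: "\<psi> \<in> l2" "\<theta> \<in> l2" using fact by (auto simp: canonical_factorization_def)
  have sq: "sq_int circ \<Theta>" "sq_int circ \<Psi>"
    unfolding \<Theta>_def \<Psi>_def by (intro sq_int_trig_series l2 inj_freq)+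
  have m [measurable]: "\<Theta> \<in> borel_measurable circ" "\<Psi> \<in> borel_measurable circ" "w \<in> borel_measurable circ"
    using sq w by (auto dest: sq_int_measurable)
  have ae: "AE x in circ. \<Psi> x * \<Theta> x = 1 \<and> 1 / w x = (cmod (\<Psi> x))\<^sup>2 \<and> 1 / w x = 1 / (cmod (\<Theta> x))\<^sup>2"
    using fact unfolding canonical_factorization_def \<Theta>_def \<Psi>_def by blast
  have bnd: "AE x in circ. cmod (\<Theta> x) \<le> sqrt K" "AE x in circ. cmod (\<Psi> x) \<le> sqrt K"
    using ae w(2) by (eventually_elim, auto intro!: real_le_rsqrt)+
  have bnd': "AE x in circ. cmod (cnj (\<Theta> x)) \<le> sqrt K" using bnd(1) by simp
  have mcnj: "(\<lambda>t. cnj (\<Theta> t)) \<in> borel_measurable circ" by measurable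
  have sqcnj: "sq_int circ (\<lambda>t. cnj (\<Theta> t))" by (rule sq_int_cnj[OF sq(1)])
  have fourier\<Theta>: "fourier \<Theta> (- int i) = \<theta> i" "n > 0 \<Longrightarrow> fourier \<Theta> n = 0" for i n
    using fourier_trig_series_in[OF l2(2) inj_freq(2), of i] fourier_trig_series_notin[OF l2(2) inj_freq(2), of n]
    by (auto simp: \<Theta>_def image_iff)
  have fourier\<Psi>: "n > 0 \<Longrightarrow> fourier \<Psi> n = 0" for n
    using fourier_trig_series_notin[OF l2(1) inj_freq(2), of n] by (auto simp: \<Psi>_def image_iff)
  have T: "T = toeplitz \<Theta>"
    using fourier\<Theta>(1) fourier\<Theta>(2)[of "int _ - int _"] by (auto simp: T_def Theta_mat_def toeplitz_def fun_eq_iff of_nat_diff)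
      (metis minus_diff_eq of_nat_diff)
  have T': "T' = toeplitz (\<lambda>t. cnj (\<Theta> t))"
    using T by (auto simp: T_def T'_def toeplitz_def fourier_cnj fun_eq_iff)
  show "l2_matrix T" unfolding T by (rule l2_matrix_toeplitz[OF m(1) bnd(1)])
  show lT': "l2_matrix T'" unfolding T' by (rule l2_matrix_toeplitz[OF mcnj bnd'])
  assume y: "y \<in> l2"
  define v where "v = mat_app T y"
  define x where "x = mat_app T' v"
  define Y where "Y = trig_series int y"
  define V where "V = trig_series int v"
  have v: "v \<in> l2" using \<open>l2_matrix T\<close> y by (simp add: v_def l2_matrix_def)
  have x: "x \<in> l2" using lT' v by (simp add: x_def l2_matrix_def)
  have YV: "sq_int circ Y" "sq_int circ V" unfolding Y_def V_def by (intro sq_int_trig_series v y inj_freq)+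
  note YVm [measurable] = sq_int_measurable[OF YV(1)] sq_int_measurable[OF YV(2)]
  have \<Theta>Y: "sq_int circ (\<lambda>t. \<Theta> t * Y t)" by (rule sq_int_mult_bounded[OF YV(1) m(1) bnd(1)])
  have \<Theta>V: "sq_int circ (\<lambda>t. cnj (\<Theta> t) * V t)" by (rule sq_int_mult_bounded[OF YV(2) mcnj bnd'])
  have v_eq: "v l = fourier (\<lambda>t. \<Theta> t * Y t) (int l)" for l
    unfolding v_def T Y_def by (rule mat_app_toeplitz[OF sq(1) y])
  have x_eq: "x l = fourier (\<lambda>t. cnj (\<Theta> t) * V t) (int l)" for l
    unfolding x_def T' V_def by (rule mat_app_toeplitz[OF sqcnj v])
  have X: "AE t in circ. cnj (\<Theta> t) * V t = trig_series int x t"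
  proof (rule AE_eq_trig_series[OF sq_int_circ_integrable[OF \<Theta>V] x inj_freq(1)])
    fix n assume "n \<notin> range int"
    then have "n < 0" by (metis not_le rangeI zero_le_imp_eq_int)
    then show "fourier (\<lambda>t. cnj (\<Theta> t) * V t) n = 0"
      unfolding V_def by (intro fourier_mult_analytic[OF sqcnj _ v]) (auto simp: fourier_cnj fourier\<Theta>)
  qed (rule x_eq[symmetric])
  define D where "D t = \<Theta> t * Y t - V t" for t
  have D: "sq_int circ D" unfolding D_def by (rule sq_int_diff[OF \<Theta>Y YV(2)])
  have fourierD: "fourier D n = 0" if "n \<ge> 0" for n
  proof -
    obtain l where l: "n = int l" by (rule nonneg_int_cases[OF \<open>n \<ge> 0\<close>])
    show ?thesis unfolding D_def l fourier_diff[OF sq_int_circ_integrable[OF \<Theta>Y] sq_int_circ_integrable[OF YV(2)]]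
      using v_eq[of l] fourier_trig_series_in[OF v inj_freq(1), of l] by (simp add: V_def)
  qed
  define d where "d k = fourier D (- int k - 1)" for k
  have d: "d \<in> l2" unfolding d_def by (rule Bessel(1)[OF D inj_freq(4)])
  have Dser: "AE t in circ. D t = trig_series (\<lambda>k. - int k - 1) d t"
  proof (rule AE_eq_trig_series[OF sq_int_circ_integrable[OF D] d inj_freq(4)])
    fix n assume n: "n \<notin> range (\<lambda>k. - int k - 1)"
    have "n \<ge> 0"
    proof (rule ccontr)
      assume "\<not> n \<ge> 0"
      then have "n = - int (nat (- n - 1)) - 1" by simp
      with n show False by blast
    qed
    then show "fourier D n = 0" by (rule fourierD)
  qed (simp add: d_def)
  have fourier\<Psi>D: "fourier (\<lambda>t. \<Psi> t * D t) (int l) = 0" for l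
  proof -
    have "sq_int circ (trig_series (\<lambda>k. - int k - 1) d)" by (rule sq_int_trig_series[OF d inj_freq(4)])
    note [measurable] = sq_int_measurable[OF this] sq_int_measurable[OF D]
    have "fourier (\<lambda>t. \<Psi> t * D t) (int l) = fourier (\<lambda>t. \<Psi> t * trig_series (\<lambda>k. - int k - 1) d t) (int l)"
      by (rule fourier_cong_AE) (use Dser in auto)
    moreover have "fourier \<Psi> (int l - (- int k - 1)) = 0" for k by (rule fourier\<Psi>) simp
    ultimately show ?thesis
      using sums_unique2[OF fourier_mult_trig_series_sums[OF d inj_freq(4) sq(2), of "int l"]] by simp
  qed
  let ?U = "\<lambda>t. complex_of_real (1 / w t)"
  have Um: "?U \<in> borel_measurable circ" by measurable
  have Ub: "AE t in circ. cmod (?U t) \<le> K" using w(2) by eventually_elim (simp add: norm_divide)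
  have U: "sq_int circ ?U" using sq_int_mult_bounded[OF sq_int_cis[of 0] Um Ub] by simp
  have X': "sq_int circ (trig_series int x)" by (rule sq_int_trig_series[OF x inj_freq(1)])
  note [measurable] = sq_int_measurable[OF X'] sq_int_measurable[OF D]
  show "mat_app (toeplitz ?U) (mat_app T' (mat_app T y)) = y"
  proof
    fix l
    have "mat_app (toeplitz ?U) x l = fourier (\<lambda>t. ?U t * trig_series int x t) (int l)"
      by (rule mat_app_toeplitz[OF U x])
    also have "\<dots> = fourier (\<lambda>t. Y t - \<Psi> t * D t) (int l)"
    proof (rule fourier_cong_AE)
      show "AE t in circ. ?U t * trig_series int x t = Y t - \<Psi> t * D t"
        using X ae
      proof eventually_elim
        case (elim t)
        then have "\<Theta> t \<noteq> 0" by auto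
        have "?U t * cnj (\<Theta> t) = \<Psi> t"
        proof -
          have "1 / w t = (cmod (\<Psi> t))\<^sup>2" using elim(2) by blast
          then have "?U t = \<Psi> t * cnj (\<Psi> t)" by (simp only: complex_norm_square)
          moreover have "cnj (\<Psi> t) * cnj (\<Theta> t) = 1" using elim by (metis complex_cnj_mult complex_cnj_one)
          ultimately show ?thesis by (simp add: mult.assoc)
        qed
        then have "?U t * trig_series int x t = \<Psi> t * V t"
          unfolding elim(1)[symmetric] by (simp add: mult.assoc[symmetric])
        moreover have "Y t - \<Psi> t * D t = \<Psi> t * V t + (1 - \<Psi> t * \<Theta> t) * Y t"
          by (simp add: D_def algebra_simps)
        moreover have "\<Psi> t * \<Theta> t = 1" using elim(2) by blast
        ultimately show ?case by (simp only:) simp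
      qed
    qed measurable
    also have "\<dots> = fourier Y (int l) - fourier (\<lambda>t. \<Psi> t * D t) (int l)"
      by (intro fourier_diff sq_int_circ_integrable YV sq_int_mult_bounded[OF D m(2) bnd(2)])
    also have "\<dots> = y l" using fourier\<Psi>D fourier_trig_series_in[OF y inj_freq(1)] by (simp add: Y_def)
    finally show "mat_app (toeplitz ?U) (mat_app T' (mat_app T y)) l = y l"
      by (simp add: x_def v_def)
  qed
qed

section \<open>Spectral measures and stochastic integrals\<close>

lemma sets_spec_measure [simp, measurable_cong]: "sets (spec_measure w) = sets circ"
  by (simp add: spec_measure_def)

lemma space_spec_measure [simp]: "space (spec_measure w) = {-pi..<pi}"
  by (simp add: spec_measure_def)

lemma spectral_densityD:
  assumes "spectral_density w"
  shows "integrable circ w" "w \<in> borel_measurable circ" "AE x in circ. 0 \<le> w x"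
    "AE x in circ. 0 \<le> w x / (2 * pi)" "(\<lambda>x. w x / (2 * pi)) \<in> borel_measurable circ"
  using assms by (auto simp: spectral_density_def intro!: AE_I2)

lemma spectral_density_add: "spectral_density f \<Longrightarrow> spectral_density g \<Longrightarrow> spectral_density (\<lambda>x. f x + g x)"
  by (auto simp: spectral_density_def)

lemma integral_spec_measure:
  fixes F :: "real \<Rightarrow> 'a::{banach, second_countable_topology}"
  assumes w: "spectral_density w" and F: "F \<in> borel_measurable circ"
  shows "(LINT x|spec_measure w. F x) = (LINT x|circ. (w x / (2 * pi)) *\<^sub>R F x)"
  unfolding spec_measure_def
  by (rule integral_density[OF F spectral_densityD(5,4)[OF w]])

lemma integrable_spec_measure:
  fixes F :: "real \<Rightarrow> 'a::{banach, second_countable_topology}"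
  assumes w: "spectral_density w" and F: "F \<in> borel_measurable circ"
  shows "integrable (spec_measure w) F \<longleftrightarrow> integrable circ (\<lambda>x. (w x / (2 * pi)) *\<^sub>R F x)"
  unfolding spec_measure_def
  by (rule integrable_density[OF F spectral_densityD(5,4)[OF w]])

lemma cov_spec_measure:
  assumes w: "spectral_density w" and F: "F \<in> borel_measurable circ" "G \<in> borel_measurable circ"
  shows "cov (spec_measure w) F G = circ_mean (\<lambda>x. F x * cnj (G x) * of_real (w x))"
proof -
  have [measurable]: "F \<in> borel_measurable circ" "G \<in> borel_measurable circ" by fact+
  have "cov (spec_measure w) F G = (LINT x|circ. (w x / (2 * pi)) *\<^sub>R (F x * cnj (G x)))"
    unfolding cov_def by (rule integral_spec_measure[OF w]) measurable
  also have "\<dots> = (LINT x|circ. (F x * cnj (G x) * of_real (w x)) / (2 * of_real pi))"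
    by (simp add: scaleR_conv_of_real field_simps)
  finally show ?thesis unfolding circ_mean_def by simp
qed

lemma L2norm_square_spec_measure:
  assumes w: "spectral_density w" and F: "F \<in> borel_measurable circ"
  shows "(L2norm (spec_measure w) F)\<^sup>2 = 1 / (2 * pi) * (LINT x|circ. (cmod (F x))\<^sup>2 * w x)"
proof -
  have [measurable]: "F \<in> borel_measurable circ" by fact
  have "(L2norm (spec_measure w) F)\<^sup>2 = (LINT x|circ. (w x / (2 * pi)) *\<^sub>R (cmod (F x))\<^sup>2)"
    unfolding L2norm_square by (rule integral_spec_measure[OF w]) measurable
  also have "\<dots> = (LINT x|circ. 1 / (2 * pi) * ((cmod (F x))\<^sup>2 * w x))"
    by (simp add: field_simps)
  finally show ?thesis by (simp only: integral_mult_right_zero)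
qed

lemma sq_int_spec_measure_iff:
  assumes w: "spectral_density w"
  shows "sq_int (spec_measure w) F \<longleftrightarrow> F \<in> borel_measurable circ \<and> integrable circ (\<lambda>x. (cmod (F x))\<^sup>2 * w x)"
proof (cases "F \<in> borel_measurable circ")
  case [measurable]: True
  have "integrable (spec_measure w) (\<lambda>x. (cmod (F x))\<^sup>2) \<longleftrightarrow> integrable circ (\<lambda>x. (w x / (2 * pi)) *\<^sub>R (cmod (F x))\<^sup>2)"
    by (rule integrable_spec_measure[OF w]) measurable
  also have "\<dots> \<longleftrightarrow> integrable circ (\<lambda>x. (1 / (2 * pi)) * ((cmod (F x))\<^sup>2 * w x))"
    by (simp add: field_simps)
  also have "\<dots> \<longleftrightarrow> integrable circ (\<lambda>x. (cmod (F x))\<^sup>2 * w x)"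
    by (subst integrable_mult_left_iff) simp
  finally show ?thesis using True by (simp add: sq_int_def measurable_cong_sets[OF sets_spec_measure refl])
next
  case False
  then show ?thesis by (simp add: sq_int_def measurable_cong_sets[OF sets_spec_measure refl])
qed

lemma sq_int_spec_measure_bounded:
  assumes w: "spectral_density w" and F: "F \<in> borel_measurable circ" and B: "\<And>x. x \<in> {-pi..<pi} \<Longrightarrow> cmod (F x) \<le> B"
  shows "sq_int (spec_measure w) F" "(L2norm (spec_measure w) F)\<^sup>2 \<le> B\<^sup>2 * (1 / (2 * pi) * (LINT x|circ. w x))"
proof -
  have [measurable]: "F \<in> borel_measurable circ" by fact
  have B': "AE x in circ. (cmod (F x))\<^sup>2 \<le> B\<^sup>2" using B by (intro AE_I2 power_mono) auto
  have int: "integrable circ (\<lambda>x. (cmod (F x))\<^sup>2 * w x)"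
    by (rule integrable_bounded_mult[OF spectral_densityD(1)[OF w], where K = "B\<^sup>2"]) (use B' in auto)
  then show "sq_int (spec_measure w) F" unfolding sq_int_spec_measure_iff[OF w] using F by simp
  have "(LINT x|circ. (cmod (F x))\<^sup>2 * w x) \<le> (LINT x|circ. B\<^sup>2 * w x)"
  proof (rule integral_mono_AE[OF int])
    show "integrable circ (\<lambda>x. B\<^sup>2 * w x)" using spectral_densityD(1)[OF w] by simp
    show "AE x in circ. (cmod (F x))\<^sup>2 * w x \<le> B\<^sup>2 * w x"
      using B' spectral_densityD(3)[OF w] by eventually_elim (rule mult_right_mono)
  qed
  then show "(L2norm (spec_measure w) F)\<^sup>2 \<le> B\<^sup>2 * (1 / (2 * pi) * (LINT x|circ. w x))"
    unfolding L2norm_square_spec_measure[OF w F] by (simp add: field_simps)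
qed

lemma sq_int_spec_measure_add:
  assumes f: "spectral_density f" and g: "spectral_density g" and F: "sq_int (spec_measure (\<lambda>x. f x + g x)) F"
  shows "sq_int (spec_measure f) F" "sq_int (spec_measure g) F"
    "(L2norm (spec_measure (\<lambda>x. f x + g x)) F)\<^sup>2 = (L2norm (spec_measure f) F)\<^sup>2 + (L2norm (spec_measure g) F)\<^sup>2"
proof -
  note fg = spectral_density_add[OF f g]
  have Fm [measurable]: "F \<in> borel_measurable circ" and int: "integrable circ (\<lambda>x. (cmod (F x))\<^sup>2 * (f x + g x))"
    using F unfolding sq_int_spec_measure_iff[OF fg] by auto
  note [measurable] = spectral_densityD(2)[OF f] spectral_densityD(2)[OF g]
  note nn = spectral_densityD(3)[OF f] spectral_densityD(3)[OF g]
  have part: "integrable circ (\<lambda>x. (cmod (F x))\<^sup>2 * v x)"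
    if [measurable]: "v \<in> borel_measurable circ" and v: "AE x in circ. 0 \<le> v x \<and> v x \<le> f x + g x" for v
  proof (rule Bochner_Integration.integrable_bound[OF int])
    show "AE x in circ. norm ((cmod (F x))\<^sup>2 * v x) \<le> norm ((cmod (F x))\<^sup>2 * (f x + g x))"
      using v by eventually_elim (auto simp: abs_mult intro!: mult_left_mono)
  qed measurable
  have i: "integrable circ (\<lambda>x. (cmod (F x))\<^sup>2 * f x)" "integrable circ (\<lambda>x. (cmod (F x))\<^sup>2 * g x)"
    using nn by (auto intro!: part elim: eventually_elim2)
  show "sq_int (spec_measure f) F" "sq_int (spec_measure g) F"
    using i Fm by (auto simp: sq_int_spec_measure_iff f g)
  show "(L2norm (spec_measure (\<lambda>x. f x + g x)) F)\<^sup>2 = (L2norm (spec_measure f) F)\<^sup>2 + (L2norm (spec_measure g) F)\<^sup>2"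
    unfolding L2norm_square_spec_measure[OF fg Fm] L2norm_square_spec_measure[OF f Fm] L2norm_square_spec_measure[OF g Fm]
    using i by (simp add: distrib_left)
qed

lemma L2norm_spec_measure_add_le:
  assumes f: "spectral_density f" and g: "spectral_density g" and F: "sq_int (spec_measure (\<lambda>x. f x + g x)) F"
  shows "L2norm (spec_measure f) F \<le> L2norm (spec_measure (\<lambda>x. f x + g x)) F"
    "L2norm (spec_measure g) F \<le> L2norm (spec_measure (\<lambda>x. f x + g x)) F"
  by (rule power2_le_imp_le; simp add: sq_int_spec_measure_add(3)[OF assms])+

lemma ms_tendsto_spec_measure_add:
  assumes f: "spectral_density f" and g: "spectral_density g" and l: "ms_tendsto (spec_measure (\<lambda>x. f x + g x)) s h"
  shows "ms_tendsto (spec_measure f) s h" "ms_tendsto (spec_measure g) s h"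
proof -
  have sq: "sq_int (spec_measure (\<lambda>x. f x + g x)) (s n)" "sq_int (spec_measure (\<lambda>x. f x + g x)) h" for n
    using l by (auto simp: ms_tendsto_iff)
  have lim: "(\<lambda>n. L2norm (spec_measure (\<lambda>x. f x + g x)) (\<lambda>x. s n x - h x)) \<longlonglongrightarrow> 0"
    using l by (auto simp: ms_tendsto_iff)
  note d = sq_int_diff[OF sq]
  have "(\<lambda>n. L2norm (spec_measure f) (\<lambda>x. s n x - h x)) \<longlonglongrightarrow> 0" "(\<lambda>n. L2norm (spec_measure g) (\<lambda>x. s n x - h x)) \<longlonglongrightarrow> 0"
    by (rule tendsto_sandwich[OF _ _ tendsto_const lim]; simp add: L2norm_spec_measure_add_le[OF f g d])+
  then show "ms_tendsto (spec_measure f) s h" "ms_tendsto (spec_measure g) s h"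
    using sq_int_spec_measure_add(1,2)[OF f g] sq by (auto simp: ms_tendsto_iff)
qed

text \<open>A bounded density makes mean-square convergence on the circle the stronger one.\<close>

lemma ms_tendsto_circ_spec_measure:
  assumes w: "spectral_density w" and K: "AE x in circ. w x \<le> K" and l: "ms_tendsto circ s h"
  shows "ms_tendsto (spec_measure w) s h"
proof -
  have K': "AE x in circ. norm (w x) \<le> K" using K spectral_densityD(3)[OF w] by eventually_elim simp

  have sq: "sq_int (spec_measure w) F \<and> (L2norm (spec_measure w) F)\<^sup>2 \<le> max K 0 / (2 * pi) * (L2norm circ F)\<^sup>2" if F: "sq_int circ F" for F
  proof -
    have int: "integrable circ (\<lambda>x. (cmod (F x))\<^sup>2 * w x)"
      using integrable_bounded_mult[OF _ spectral_densityD(2)[OF w] K', of "\<lambda>x. (cmod (F x))\<^sup>2"] F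
      by (simp add: sq_int_def mult.commute)
    have "(LINT x|circ. (cmod (F x))\<^sup>2 * w x) \<le> (LINT x|circ. max K 0 * (cmod (F x))\<^sup>2)"
    proof (rule integral_mono_AE[OF int])
      show "integrable circ (\<lambda>x. max K 0 * (cmod (F x))\<^sup>2)" using F by (simp add: sq_int_def)
      show "AE x in circ. (cmod (F x))\<^sup>2 * w x \<le> max K 0 * (cmod (F x))\<^sup>2"
        using K by eventually_elim (simp add: mult.commute mult_right_mono)
    qed
    then show ?thesis
      using F int by (auto simp: sq_int_spec_measure_iff[OF w] L2norm_square_spec_measure[OF w] L2norm_square[of circ] sq_int_measurable field_simps)
  qed
  have l': "\<And>n. sq_int circ (s n)" "sq_int circ h" "(\<lambda>n. L2norm circ (\<lambda>x. s n x - h x)) \<longlonglongrightarrow> 0"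
    using l by (auto simp: ms_tendsto_iff)
  have "(\<lambda>n. (L2norm (spec_measure w) (\<lambda>x. s n x - h x))\<^sup>2) \<longlonglongrightarrow> 0"
  proof (rule tendsto_sandwich[OF _ _ tendsto_const])
    show "(\<lambda>n. max K 0 / (2 * pi) * (L2norm circ (\<lambda>x. s n x - h x))\<^sup>2) \<longlonglongrightarrow> 0"
      using tendsto_mult_left[OF tendsto_power[OF l'(3), of 2], of "max K 0 / (2 * pi)"] by simp
    show "\<forall>\<^sub>F n in sequentially. (L2norm (spec_measure w) (\<lambda>x. s n x - h x))\<^sup>2 \<le> max K 0 / (2 * pi) * (L2norm circ (\<lambda>x. s n x - h x))\<^sup>2"
      using sq sq_int_diff[OF l'(1,2)] by (intro always_eventually) blast
  qed simp
  then show ?thesis using sq l' by (auto simp: ms_tendsto_def L2norm_square)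
qed

lemma cov_linear_combinations:
  assumes X: "\<And>i. i \<in> I \<Longrightarrow> sq_int \<mu> (X i)" and Y: "\<And>j. j \<in> J \<Longrightarrow> sq_int \<mu> (Y j)"
  shows "cov \<mu> (\<lambda>t. \<Sum>i\<in>I. c i * X i t) (\<lambda>t. \<Sum>j\<in>J. d j * Y j t)
       = (\<Sum>i\<in>I. \<Sum>j\<in>J. c i * (cnj (d j) * cov \<mu> (X i) (Y j)))"
proof -
  have sY: "sq_int \<mu> (\<lambda>t. \<Sum>j\<in>J. d j * Y j t)" by (intro sq_int_sum sq_int_scale Y)
  have "cov \<mu> (\<lambda>t. \<Sum>i\<in>I. c i * X i t) (\<lambda>t. \<Sum>j\<in>J. d j * Y j t) = (\<Sum>i\<in>I. c i * cov \<mu> (X i) (\<lambda>t. \<Sum>j\<in>J. d j * Y j t))"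
    by (subst cov_sum_left[OF sq_int_scale[OF X] sY]) (simp_all only: cov_scale_left)
  also have "\<dots> = (\<Sum>i\<in>I. c i * (\<Sum>j\<in>J. cnj (d j) * cov \<mu> (X i) (Y j)))"
  proof (rule sum.cong[OF refl])
    fix i assume "i \<in> I"
    then show "c i * cov \<mu> (X i) (\<lambda>t. \<Sum>j\<in>J. d j * Y j t) = c i * (\<Sum>j\<in>J. cnj (d j) * cov \<mu> (X i) (Y j))"
      by (subst cov_sum_right[OF sq_int_scale[OF Y] X]) (simp_all only: cov_scale_right)
  qed
  finally show ?thesis by (simp only: sum_distrib_left)
qed

lemma cov_linear_combinations_cong:
  assumes X: "\<And>i. i \<in> I \<Longrightarrow> sq_int \<mu> (X i)" "\<And>i. i \<in> J \<Longrightarrow> sq_int \<mu> (Y i)"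
    and X': "\<And>i. i \<in> I \<Longrightarrow> sq_int \<mu>' (X' i)" "\<And>i. i \<in> J \<Longrightarrow> sq_int \<mu>' (Y' i)"
    and eq: "\<And>i j. i \<in> I \<Longrightarrow> j \<in> J \<Longrightarrow> cov \<mu> (X i) (Y j) = cov \<mu>' (X' i) (Y' j)"
  shows "cov \<mu> (\<lambda>t. \<Sum>i\<in>I. c i * X i t) (\<lambda>t. \<Sum>j\<in>J. d j * Y j t) = cov \<mu>' (\<lambda>t. \<Sum>i\<in>I. c i * X' i t) (\<lambda>t. \<Sum>j\<in>J. d j * Y' j t)"
proof -
  have "cov \<mu> (\<lambda>t. \<Sum>i\<in>I. c i * X i t) (\<lambda>t. \<Sum>j\<in>J. d j * Y j t) = (\<Sum>i\<in>I. \<Sum>j\<in>J. c i * (cnj (d j) * cov \<mu> (X i) (Y j)))"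
    by (rule cov_linear_combinations) (use X in auto)
  also have "\<dots> = (\<Sum>i\<in>I. \<Sum>j\<in>J. c i * (cnj (d j) * cov \<mu>' (X' i) (Y' j)))"
    using eq by (intro sum.cong refl) simp
  also have "\<dots> = cov \<mu>' (\<lambda>t. \<Sum>i\<in>I. c i * X' i t) (\<lambda>t. \<Sum>j\<in>J. d j * Y' j t)"
    by (rule cov_linear_combinations[symmetric]) (use X' in auto)
  finally show ?thesis .
qed

text \<open>For \<open>a \<le> b\<close> split the increment up to \<open>b\<close> at \<open>a\<close>: the second part is orthogonal to the increment up
  to \<open>a\<close>. Both sides are therefore the mass of the interval that ends at \<open>min a b\<close>.\<close>

lemma spectral_process_cov:
  assumes Z: "spectral_process M w Z" and w: "spectral_density w"
    and a: "a \<in> {-pi..pi}" and b: "b \<in> {-pi..pi}"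
  shows "cov M (\<lambda>\<omega>. Z a \<omega> - Z (-pi) \<omega>) (\<lambda>\<omega>. Z b \<omega> - Z (-pi) \<omega>)
       = cov (spec_measure w) (indicator {-pi..<a}) (indicator {-pi..<b})"
proof -
  define W where "W t = complex_of_real ((LBINT x:{-pi..<t}. w x) / (2 * pi))" for t
  have sqZ: "sq_int M (Z t)" if "t \<in> {-pi..pi}" for t
    using Z that by (auto simp: spectral_process_def rv_space_def)
  have sqG: "sq_int M (\<lambda>\<omega>. Z t \<omega> - Z s \<omega>)" if "t \<in> {-pi..pi}" "s \<in> {-pi..pi}" for t s
    using sqZ that by auto
  have le: "cov M (\<lambda>\<omega>. Z a \<omega> - Z (-pi) \<omega>) (\<lambda>\<omega>. Z b \<omega> - Z (-pi) \<omega>) = W a"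
    if a: "a \<in> {-pi..pi}" and b: "b \<in> {-pi..pi}" and ab: "a \<le> b" for a b
  proof -
    have "cov M (\<lambda>\<omega>. Z a \<omega> - Z (-pi) \<omega>) (\<lambda>\<omega>. Z b \<omega> - Z (-pi) \<omega>)
        = cov M (\<lambda>\<omega>. Z a \<omega> - Z (-pi) \<omega>) (\<lambda>\<omega>. (Z a \<omega> - Z (-pi) \<omega>) + (Z b \<omega> - Z a \<omega>))"
      by simp
    also have "\<dots> = cov M (\<lambda>\<omega>. Z a \<omega> - Z (-pi) \<omega>) (\<lambda>\<omega>. Z a \<omega> - Z (-pi) \<omega>) + cov M (\<lambda>\<omega>. Z a \<omega> - Z (-pi) \<omega>) (\<lambda>\<omega>. Z b \<omega> - Z a \<omega>)"
      by (rule cov_add_right) (use sqG a b in auto)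
    also have "cov M (\<lambda>\<omega>. Z a \<omega> - Z (-pi) \<omega>) (\<lambda>\<omega>. Z b \<omega> - Z a \<omega>) = 0"
      using Z a b ab unfolding spectral_process_def by auto
    also have "cov M (\<lambda>\<omega>. Z a \<omega> - Z (-pi) \<omega>) (\<lambda>\<omega>. Z a \<omega> - Z (-pi) \<omega>) = W a"
      unfolding cov_self L2norm_square W_def using Z a unfolding spectral_process_def by auto
    finally show ?thesis by simp
  qed
  have real: "cnj (W t) = W t" for t by (simp add: W_def)
  have "cov M (\<lambda>\<omega>. Z a \<omega> - Z (-pi) \<omega>) (\<lambda>\<omega>. Z b \<omega> - Z (-pi) \<omega>) = W (min a b)"
  proof (cases "a \<le> b")
    case True
    then show ?thesis using le[OF a b] by simp
  next
    case False
    then show ?thesis using le[OF b a] cov_commute[of M "\<lambda>\<omega>. Z a \<omega> - Z (-pi) \<omega>" "\<lambda>\<omega>. Z b \<omega> - Z (-pi) \<omega>"] real by simp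
  qed
  also have "W (min a b) = circ_mean (\<lambda>x. of_real (indicator {-pi..<min a b} x * w x))"
  proof -
    have "(LINT x|circ. indicator {-pi..<min a b} x * w x) = (LINT x|lborel. indicator {-pi..<pi} x *\<^sub>R (indicator {-pi..<min a b} x * w x))"
      unfolding circ_def by (rule integral_restrict_space) simp
    also have "\<dots> = (LBINT x:{-pi..<min a b}. w x)"
      unfolding set_lebesgue_integral_def
      by (intro Bochner_Integration.integral_cong) (use a b in \<open>auto simp: indicator_def\<close>)
    finally show ?thesis unfolding W_def circ_mean_def integral_complex_of_real by simp
  qed
  also have "\<dots> = cov (spec_measure w) (indicator {-pi..<a}) (indicator {-pi..<b})"
  proof -
    have m: "(indicator {-pi..<c} :: real \<Rightarrow> complex) \<in> borel_measurable circ" for c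
      by (rule measurable_circ_borel) measurable
    have "of_real (indicator {-pi..<min a b} x * w x) = indicator {-pi..<a} x * cnj (indicator {-pi..<b} x) * complex_of_real (w x)" for x
      by (auto simp: indicator_def)
    then show ?thesis unfolding cov_spec_measure[OF w m m] by (simp only:)
  qed
  finally show ?thesis .
qed

lemma indicator_circ_measurable: "(\<lambda>x. indicator {a..<b} x :: complex) \<in> borel_measurable circ"
  by (rule measurable_circ_borel) measurable

lemma sq_int_indicator_spec: "spectral_density w \<Longrightarrow> sq_int (spec_measure w) (\<lambda>x. indicator {a..<b} x)"
  by (rule sq_int_spec_measure_bounded(1)[where B = 1]) (auto simp: indicator_circ_measurable indicator_def)

text \<open>Every increment of \<open>Z\<close> is a difference of increments that start at \<open>-pi\<close>, and every indicator of an
  interval is a difference of indicators of intervals that start at \<open>-pi\<close>. These two families have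
  the same covariances, and both sides of the claim are built from them by the same linear
  combination.\<close>

lemma step_integral_isometry:
  assumes Z: "spectral_process M w Z" and w: "spectral_density w" and S: "step_integral Z s S"
  shows "sq_int M S" "sq_int (spec_measure w) s" "L2norm M S = L2norm (spec_measure w) s"
proof -
  obtain n :: nat and c u v where uv: "\<And>j. j < n \<Longrightarrow> -pi \<le> u j \<and> u j \<le> v j \<and> v j \<le> pi"
    and s: "s = (\<lambda>x. \<Sum>j<n. c j * indicator {u j..<v j} x)" and S: "S = (\<lambda>\<omega>. \<Sum>j<n. c j * (Z (v j) \<omega> - Z (u j) \<omega>))"
    using S unfolding step_integral_def by blast
  define D where "D j \<omega> = Z (v j) \<omega> - Z (u j) \<omega>" for j \<omega>
  define I where "I j x = (indicator {u j..<v j} x :: complex)" for j x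
  have sqZ: "sq_int M (Z t)" if "t \<in> {-pi..pi}" for t
    using Z that by (auto simp: spectral_process_def rv_space_def)
  define G where "G t \<omega> = Z t \<omega> - Z (-pi) \<omega>" for t \<omega>
  have G: "sq_int M (G t)" if "t \<in> {-pi..pi}" for t unfolding G_def using sqZ that by auto
  define J where "J t x = (indicator {-pi..<t} x :: complex)" for t x
  have J: "sq_int (spec_measure w) (J t)" for t unfolding J_def by (rule sq_int_indicator_spec[OF w])
  have GJ: "cov M (G a) (G b) = cov (spec_measure w) (J a) (J b)" if "a \<in> {-pi..pi}" "b \<in> {-pi..pi}" for a b
    using spectral_process_cov[OF Z w that] unfolding G_def J_def by simp
  have D: "sq_int M (D j)" if "j < n" for j unfolding D_def using sqZ uv[OF that] by auto
  have I: "sq_int (spec_measure w) (I j)" for j unfolding I_def by (rule sq_int_indicator_spec[OF w])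
  have D_eq: "D j = (\<lambda>\<omega>. G (v j) \<omega> - G (u j) \<omega>)" for j by (auto simp: D_def G_def)
  have I_eq: "I j = (\<lambda>x. J (v j) x - J (u j) x)" if "j < n" for j
    using uv[OF that] by (auto simp: I_def J_def indicator_def fun_eq_iff)
  have DI: "cov M (D j) (D k) = cov (spec_measure w) (I j) (I k)" if "j < n" "k < n" for j k
    using uv[OF that(1)] uv[OF that(2)]
    by (simp add: D_eq I_eq that cov_diff_left cov_diff_right sq_int_diff G J GJ)
  show sqS: "sq_int M S" unfolding S D_def[symmetric] by (intro sq_int_sum sq_int_scale D) simp
  show "sq_int (spec_measure w) s" unfolding s I_def[symmetric] by (intro sq_int_sum sq_int_scale I)
  have "cov M S S = cov (spec_measure w) s s"
    unfolding s S D_def[symmetric] I_def[symmetric]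
    by (rule cov_linear_combinations_cong) (use D I DI in auto)
  then have "(L2norm M S)\<^sup>2 = (L2norm (spec_measure w) s)\<^sup>2" unfolding cov_self of_real_eq_iff .
  then show "L2norm M S = L2norm (spec_measure w) s" by (simp add: power2_eq_iff_nonneg)
qed

text \<open>The triangle inequality applied to the two summands. The constant is crude, but the bound serves
  only to extend the integral by continuity.\<close>

lemma step_integral_sum_process:
  assumes f: "spectral_density f" and g: "spectral_density g"
    and Z: "spectral_process M f Z" and Z': "spectral_process M g Z'"
    and S: "step_integral (\<lambda>t \<omega>. Z t \<omega> + Z' t \<omega>) s S"
  shows "sq_int M S" "L2norm M S \<le> 2 * L2norm (spec_measure (\<lambda>x. f x + g x)) s"
proof -
  obtain n :: nat and c u v where uv: "\<forall>j<n. -pi \<le> u j \<and> u j \<le> v j \<and> v j \<le> pi"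
    and s: "s = (\<lambda>x. \<Sum>j<n. c j * indicator {u j..<v j} x)"
    and S: "S = (\<lambda>\<omega>. \<Sum>j<n. c j * (Z (v j) \<omega> + Z' (v j) \<omega> - (Z (u j) \<omega> + Z' (u j) \<omega>)))"
    using S unfolding step_integral_def by blast
  define S1 where "S1 \<omega> = (\<Sum>j<n. c j * (Z (v j) \<omega> - Z (u j) \<omega>))" for \<omega>
  define S2 where "S2 \<omega> = (\<Sum>j<n. c j * (Z' (v j) \<omega> - Z' (u j) \<omega>))" for \<omega>
  have 1: "step_integral Z s S1" unfolding step_integral_def S1_def using uv s by blast
  have 2: "step_integral Z' s S2" unfolding step_integral_def S2_def using uv s by blast
  note i1 = step_integral_isometry[OF Z f 1] and i2 = step_integral_isometry[OF Z' g 2]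
  have eq: "S = (\<lambda>\<omega>. S1 \<omega> + S2 \<omega>)"
    unfolding S S1_def S2_def by (simp add: sum.distrib[symmetric] algebra_simps)
  show "sq_int M S" unfolding eq using i1 i2 by auto
  have sq: "sq_int (spec_measure (\<lambda>x. f x + g x)) s"
    unfolding s by (intro sq_int_sum sq_int_scale sq_int_indicator_spec spectral_density_add f g)
  have "L2norm M S \<le> L2norm M S1 + L2norm M S2" unfolding eq by (rule L2norm_triangle[OF i1(1) i2(1)])
  also have "\<dots> \<le> 2 * L2norm (spec_measure (\<lambda>x. f x + g x)) s"
    using L2norm_spec_measure_add_le[OF f g sq] i1 i2 by simp
  finally show "L2norm M S \<le> 2 * L2norm (spec_measure (\<lambda>x. f x + g x)) s" .
qed

lemma step_integral_add:
  assumes "step_integral Z s S" "step_integral Z s' S'"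
  shows "step_integral Z (\<lambda>x. s x + s' x) (\<lambda>\<omega>. S \<omega> + S' \<omega>)"
proof -
  obtain n :: nat and c u v where 1: "\<forall>j<n. -pi \<le> u j \<and> u j \<le> v j \<and> v j \<le> pi"
    "s = (\<lambda>x. \<Sum>j<n. c j * indicator {u j..<v j} x)" "S = (\<lambda>\<omega>. \<Sum>j<n. c j * (Z (v j) \<omega> - Z (u j) \<omega>))"
    using assms(1) unfolding step_integral_def by blast
  obtain n' :: nat and c' u' v' where 2: "\<forall>j<n'. -pi \<le> u' j \<and> u' j \<le> v' j \<and> v' j \<le> pi"
    "s' = (\<lambda>x. \<Sum>j<n'. c' j * indicator {u' j..<v' j} x)" "S' = (\<lambda>\<omega>. \<Sum>j<n'. c' j * (Z (v' j) \<omega> - Z (u' j) \<omega>))"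
    using assms(2) unfolding step_integral_def by blast
  define C where "C j = (if j < n then c j else c' (j - n))" for j
  define U where "U j = (if j < n then u j else u' (j - n))" for j
  define V where "V j = (if j < n then v j else v' (j - n))" for j
  have split: "(\<Sum>j<n + n'. F (C j) (U j) (V j)) = (\<Sum>j<n. F (c j) (u j) (v j)) + (\<Sum>j<n'. F (c' j) (u' j) (v' j))"
    for F :: "complex \<Rightarrow> real \<Rightarrow> real \<Rightarrow> complex"
  proof -
    have "(\<Sum>j<n + n'. F (C j) (U j) (V j)) = (\<Sum>j<n. F (C j) (U j) (V j)) + (\<Sum>j=n..<n + n'. F (C j) (U j) (V j))"
      unfolding lessThan_atLeast0 by (subst sum.atLeastLessThan_concat) auto
    also have "(\<Sum>j=n..<n + n'. F (C j) (U j) (V j)) = (\<Sum>j<n'. F (C (j + n)) (U (j + n)) (V (j + n)))"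
      using sum.shift_bounds_nat_ivl[of "\<lambda>j. F (C j) (U j) (V j)" 0 n n'] by (simp add: add.commute lessThan_atLeast0)
    finally show ?thesis by (simp add: C_def U_def V_def)
  qed
  have "\<forall>j<n + n'. -pi \<le> U j \<and> U j \<le> V j \<and> V j \<le> pi"
  proof (intro allI impI)
    fix j assume "j < n + n'"
    then show "-pi \<le> U j \<and> U j \<le> V j \<and> V j \<le> pi"
      using 1(1) 2(1)[rule_format, of "j - n"] by (auto simp: U_def V_def)
  qed
  moreover have "(\<lambda>x. s x + s' x) = (\<lambda>x. \<Sum>j<n + n'. C j * indicator {U j..<V j} x)"
    unfolding 1 2 by (simp add: split[where F = "\<lambda>c u v. c * indicator {u..<v} _"])
  moreover have "(\<lambda>\<omega>. S \<omega> + S' \<omega>) = (\<lambda>\<omega>. \<Sum>j<n + n'. C j * (Z (V j) \<omega> - Z (U j) \<omega>))"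
    unfolding 1 2 by (simp add: split[where F = "\<lambda>c u v. c * (Z v _ - Z u _)"])
  ultimately show ?thesis unfolding step_integral_def by blast
qed

lemma step_integral_scale:
  assumes "step_integral Z s S" shows "step_integral Z (\<lambda>x. a * s x) (\<lambda>\<omega>. a * S \<omega>)"
proof -
  obtain n :: nat and c u v where 1: "\<forall>j<n. -pi \<le> u j \<and> u j \<le> v j \<and> v j \<le> pi"
    "s = (\<lambda>x. \<Sum>j<n. c j * indicator {u j..<v j} x)" "S = (\<lambda>\<omega>. \<Sum>j<n. c j * (Z (v j) \<omega> - Z (u j) \<omega>))"
    using assms(1) unfolding step_integral_def by blast
  have "(\<lambda>x. a * s x) = (\<lambda>x. \<Sum>j<n. (a * c j) * indicator {u j..<v j} x)"
    "(\<lambda>\<omega>. a * S \<omega>) = (\<lambda>\<omega>. \<Sum>j<n. (a * c j) * (Z (v j) \<omega> - Z (u j) \<omega>))"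
    unfolding 1 by (simp_all only: sum_distrib_left mult.assoc)
  then show ?thesis unfolding step_integral_def using 1(1) by (intro exI[of _ n] exI[of _ "\<lambda>j. a * c j"]) blast
qed

lemma has_stoch_integral_add:
  assumes "has_stoch_integral M w Z h X" "has_stoch_integral M w Z h' X'"
  shows "has_stoch_integral M w Z (\<lambda>x. h x + h' x) (\<lambda>\<omega>. X \<omega> + X' \<omega>)"
proof -
  obtain s S where s: "\<forall>n. step_integral Z (s n) (S n)" "ms_tendsto (spec_measure w) s h" "ms_tendsto M S X"
    using assms(1) unfolding has_stoch_integral_def by blast
  obtain s' S' where s': "\<forall>n. step_integral Z (s' n) (S' n)" "ms_tendsto (spec_measure w) s' h'" "ms_tendsto M S' X'"
    using assms(2) unfolding has_stoch_integral_def by blast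
  show ?thesis unfolding has_stoch_integral_def
  proof (rule exI[of _ "\<lambda>n x. s n x + s' n x"], rule exI[of _ "\<lambda>n \<omega>. S n \<omega> + S' n \<omega>"], intro conjI allI)
    show "step_integral Z (\<lambda>x. s n x + s' n x) (\<lambda>\<omega>. S n \<omega> + S' n \<omega>)" for n
      using s(1) s'(1) by (intro step_integral_add) auto
  qed (intro ms_tendsto_add s s')+
qed

lemma has_stoch_integral_scale:
  assumes "has_stoch_integral M w Z h X"
  shows "has_stoch_integral M w Z (\<lambda>x. a * h x) (\<lambda>\<omega>. a * X \<omega>)"
proof -
  obtain s S where s: "\<forall>n. step_integral Z (s n) (S n)" "ms_tendsto (spec_measure w) s h" "ms_tendsto M S X"
    using assms unfolding has_stoch_integral_def by blast
  show ?thesis unfolding has_stoch_integral_def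
  proof (rule exI[of _ "\<lambda>n x. a * s n x"], rule exI[of _ "\<lambda>n \<omega>. a * S n \<omega>"], intro conjI allI)
    show "step_integral Z (\<lambda>x. a * s n x) (\<lambda>\<omega>. a * S n \<omega>)" for n
      using s(1) by (intro step_integral_scale) auto
  qed (intro ms_tendsto_scale s)+
qed

lemma has_stoch_integral_diff:
  assumes "has_stoch_integral M w Z h X" "has_stoch_integral M w Z h' X'"
  shows "has_stoch_integral M w Z (\<lambda>x. h x - h' x) (\<lambda>\<omega>. X \<omega> - X' \<omega>)"
  using has_stoch_integral_add[OF assms(1) has_stoch_integral_scale[OF assms(2), of "-1"]] by simp

lemma has_stoch_integral_sum:
  assumes "finite I" "I \<noteq> {}" "\<And>i. i \<in> I \<Longrightarrow> has_stoch_integral M w Z (h i) (X i)"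
  shows "has_stoch_integral M w Z (\<lambda>x. \<Sum>i\<in>I. h i x) (\<lambda>\<omega>. \<Sum>i\<in>I. X i \<omega>)"
  using assms by (induction I rule: finite_ne_induct) (auto intro: has_stoch_integral_add)

lemma has_stoch_integral_cong_AE:
  assumes "has_stoch_integral M w Z h X" "AE \<omega> in M. X \<omega> = X' \<omega>" "X' \<in> borel_measurable M"
  shows "has_stoch_integral M w Z h X'"
proof -
  obtain s S where s: "\<forall>n. step_integral Z (s n) (S n)" "ms_tendsto (spec_measure w) s h" "ms_tendsto M S X"
    using assms(1) unfolding has_stoch_integral_def by blast
  then show ?thesis
    unfolding has_stoch_integral_def using ms_tendsto_cong_AE[OF s(3) assms(2,3)] by blast
qed

lemma has_stoch_integral_sq_int:
  assumes "has_stoch_integral M w Z h X" shows "sq_int M X" "sq_int (spec_measure w) h"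
  using assms unfolding has_stoch_integral_def by (auto simp: ms_tendsto_iff)

lemma ms_tendsto_perturb:
  assumes A: "\<And>n. sq_int \<mu> (A n)" "\<And>n. L2norm \<mu> (\<lambda>x. A n x - B n x) < 1 / real (Suc n)" and B: "ms_tendsto \<mu> B L"
  shows "ms_tendsto \<mu> A L"
proof -
  have sqB: "\<And>n. sq_int \<mu> (B n)" "sq_int \<mu> L" and lB: "(\<lambda>n. L2norm \<mu> (\<lambda>x. B n x - L x)) \<longlonglongrightarrow> 0"
    using B by (auto simp: ms_tendsto_iff)
  have "(\<lambda>n. L2norm \<mu> (\<lambda>x. A n x - L x)) \<longlonglongrightarrow> 0"
  proof (rule tendsto_sandwich[OF _ _ tendsto_const])
    show "(\<lambda>n. 1 / real (Suc n) + L2norm \<mu> (\<lambda>x. B n x - L x)) \<longlonglongrightarrow> 0"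
      using tendsto_add[OF LIMSEQ_inverse_real_of_nat lB] by (simp add: inverse_eq_divide)
    show "\<forall>\<^sub>F n in sequentially. L2norm \<mu> (\<lambda>x. A n x - L x) \<le> 1 / real (Suc n) + L2norm \<mu> (\<lambda>x. B n x - L x)"
    proof (rule always_eventually, rule allI)
      fix n
      show "L2norm \<mu> (\<lambda>x. A n x - L x) \<le> 1 / real (Suc n) + L2norm \<mu> (\<lambda>x. B n x - L x)"
        using L2norm_triangle_diff[OF A(1)[of n] sqB(1)[of n] sqB(2)] A(2)[of n] by linarith
    qed
  qed simp
  then show ?thesis using A sqB by (simp add: ms_tendsto_iff)
qed

text \<open>A diagonal choice among the approximating step functions.\<close>

lemma has_stoch_integral_closed:
  assumes int: "\<And>n. has_stoch_integral M w Z (h n) (X n)"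
    and h: "ms_tendsto (spec_measure w) h h'" and X: "ms_tendsto M X X'"
  shows "has_stoch_integral M w Z h' X'"
proof -
  have "\<exists>s S. step_integral Z s S \<and> sq_int (spec_measure w) s \<and> sq_int M S \<and>
      L2norm (spec_measure w) (\<lambda>x. s x - h n x) < 1 / real (Suc n) \<and> L2norm M (\<lambda>\<omega>. S \<omega> - X n \<omega>) < 1 / real (Suc n)" for n
  proof -
    obtain s S where s: "\<forall>k. step_integral Z (s k) (S k)" "ms_tendsto (spec_measure w) s (h n)" "ms_tendsto M S (X n)"
      using int[of n] unfolding has_stoch_integral_def by blast
    have "\<forall>\<^sub>F k in sequentially. L2norm (spec_measure w) (\<lambda>x. s k x - h n x) < 1 / real (Suc n)"
      "\<forall>\<^sub>F k in sequentially. L2norm M (\<lambda>\<omega>. S k \<omega> - X n \<omega>) < 1 / real (Suc n)"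
      using s unfolding ms_tendsto_iff by (auto intro!: order_tendstoD(2)[where y = 0] simp del: of_nat_Suc)
    then have "\<forall>\<^sub>F k in sequentially. L2norm (spec_measure w) (\<lambda>x. s k x - h n x) < 1 / real (Suc n) \<and> L2norm M (\<lambda>\<omega>. S k \<omega> - X n \<omega>) < 1 / real (Suc n)"
      by eventually_elim simp
    then obtain k where "L2norm (spec_measure w) (\<lambda>x. s k x - h n x) < 1 / real (Suc n) \<and> L2norm M (\<lambda>\<omega>. S k \<omega> - X n \<omega>) < 1 / real (Suc n)"
      by (auto simp: eventually_sequentially simp del: of_nat_Suc)
    then show ?thesis using s unfolding ms_tendsto_iff by blast
  qed
  then have "\<forall>n. \<exists>p. step_integral Z (fst p) (snd p) \<and> sq_int (spec_measure w) (fst p) \<and> sq_int M (snd p) \<and>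
      L2norm (spec_measure w) (\<lambda>x. fst p x - h n x) < 1 / real (Suc n) \<and> L2norm M (\<lambda>\<omega>. snd p \<omega> - X n \<omega>) < 1 / real (Suc n)"
    by simp
  then obtain p where p: "\<forall>n. step_integral Z (fst (p n)) (snd (p n)) \<and> sq_int (spec_measure w) (fst (p n)) \<and> sq_int M (snd (p n)) \<and>
      L2norm (spec_measure w) (\<lambda>x. fst (p n) x - h n x) < 1 / real (Suc n) \<and> L2norm M (\<lambda>\<omega>. snd (p n) \<omega> - X n \<omega>) < 1 / real (Suc n)"
    unfolding choice_iff by (rule exE)
  define s where "s n = fst (p n)" for n
  define S where "S n = snd (p n)" for n
  have sS: "step_integral Z (s n) (S n)" "sq_int (spec_measure w) (s n)" "sq_int M (S n)"
      "L2norm (spec_measure w) (\<lambda>x. s n x - h n x) < 1 / real (Suc n)" "L2norm M (\<lambda>\<omega>. S n \<omega> - X n \<omega>) < 1 / real (Suc n)" for n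
    using p by (simp_all add: s_def S_def del: of_nat_Suc)
  show ?thesis unfolding has_stoch_integral_def
    using sS(1) ms_tendsto_perturb[OF sS(2,4) h] ms_tendsto_perturb[OF sS(3,5) X] by blast
qed

lemma has_stoch_integral_bound:
  assumes B: "\<And>s S. step_integral Z s S \<Longrightarrow> L2norm M S \<le> K * L2norm (spec_measure w) s"
    and int: "has_stoch_integral M w Z h X"
  shows "L2norm M X \<le> K * L2norm (spec_measure w) h"
proof -
  obtain s S where s: "\<forall>k. step_integral Z (s k) (S k)" "ms_tendsto (spec_measure w) s h" "ms_tendsto M S X"
    using int unfolding has_stoch_integral_def by blast
  show ?thesis
    by (rule LIMSEQ_le[OF ms_tendsto_L2norm[OF s(3)] tendsto_mult_left[OF ms_tendsto_L2norm[OF s(2)]]])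
      (use B s(1) in blast)
qed

lemma has_stoch_integral_ms_tendsto:
  assumes B: "\<And>s S. step_integral Z s S \<Longrightarrow> L2norm M S \<le> K * L2norm (spec_measure w) s"
    and int: "\<And>n. has_stoch_integral M w Z (h n) (X n)" "has_stoch_integral M w Z h' X'"
    and h: "ms_tendsto (spec_measure w) h h'"
  shows "ms_tendsto M X X'"
proof -
  have "(\<lambda>n. L2norm M (\<lambda>\<omega>. X n \<omega> - X' \<omega>)) \<longlonglongrightarrow> 0"
  proof (rule tendsto_sandwich[OF _ _ tendsto_const])
    show "(\<lambda>n. K * L2norm (spec_measure w) (\<lambda>x. h n x - h' x)) \<longlonglongrightarrow> 0"
      using h unfolding ms_tendsto_iff by (auto intro: tendsto_mult_right_zero)
    show "\<forall>\<^sub>F n in sequentially. L2norm M (\<lambda>\<omega>. X n \<omega> - X' \<omega>) \<le> K * L2norm (spec_measure w) (\<lambda>x. h n x - h' x)"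
      by (rule always_eventually, rule allI, rule has_stoch_integral_bound[OF B has_stoch_integral_diff[OF int(1) int(2)]])
  qed simp
  then show ?thesis using has_stoch_integral_sq_int[OF int(1)] has_stoch_integral_sq_int[OF int(2)]
    by (simp add: ms_tendsto_iff)
qed

text \<open>The bound for step functions makes the integrals of a mean-square convergent sequence a Cauchy
  sequence.\<close>

lemma has_stoch_integral_limit_exists:
  assumes B: "\<And>s S. step_integral Z s S \<Longrightarrow> L2norm M S \<le> K * L2norm (spec_measure w) s"
    and int: "\<And>n. has_stoch_integral M w Z (h n) (X n)"
    and h: "ms_tendsto (spec_measure w) h h'"
  shows "\<exists>X'. has_stoch_integral M w Z h' X'"
proof -
  let ?d = "\<lambda>n. L2norm (spec_measure w) (\<lambda>x. h n x - h' x)"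
  have d: "?d \<longlonglongrightarrow> 0" and sq: "\<And>n. sq_int (spec_measure w) (h n)" "sq_int (spec_measure w) h'"
    using h by (auto simp: ms_tendsto_iff)
  have le: "L2norm M (\<lambda>\<omega>. X m \<omega> - X n \<omega>) \<le> \<bar>K\<bar> * (?d m + ?d n)" for m n
  proof -
    have "L2norm M (\<lambda>\<omega>. X m \<omega> - X n \<omega>) \<le> K * L2norm (spec_measure w) (\<lambda>x. h m x - h n x)"
      by (rule has_stoch_integral_bound[OF B has_stoch_integral_diff[OF int int]])
    also have "\<dots> \<le> \<bar>K\<bar> * L2norm (spec_measure w) (\<lambda>x. h m x - h n x)" by (intro mult_right_mono) auto
    also have "\<dots> \<le> \<bar>K\<bar> * (?d m + ?d n)"
      using L2norm_triangle_diff[OF sq(1)[of m] sq(2) sq(1)[of n]] L2norm_minus_commute[of "spec_measure w" h' "h n"]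
      by (intro mult_left_mono) auto
    finally show ?thesis .
  qed
  have "\<exists>X'. ms_tendsto M X X'"
  proof (rule L2_complete)
    show "sq_int M (X n)" for n by (rule has_stoch_integral_sq_int[OF int])
    fix e :: real assume e: "e > 0"
    then have "e / (2 * (\<bar>K\<bar> + 1)) > 0" by simp
    from order_tendstoD(2)[OF d this] obtain N where N: "\<And>n. n \<ge> N \<Longrightarrow> ?d n < e / (2 * (\<bar>K\<bar> + 1))"
      by (auto simp: eventually_sequentially)
    have "L2norm M (\<lambda>\<omega>. X m \<omega> - X n \<omega>) < e" if "m \<ge> N" "n \<ge> N" for m n
    proof -
      have "L2norm M (\<lambda>\<omega>. X m \<omega> - X n \<omega>) \<le> (\<bar>K\<bar> + 1) * (?d m + ?d n)"
        using le[of m n] by (rule order_trans) (intro mult_right_mono, auto)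
      also have "\<dots> < (\<bar>K\<bar> + 1) * (e / (2 * (\<bar>K\<bar> + 1)) + e / (2 * (\<bar>K\<bar> + 1)))"
        using N[OF that(1)] N[OF that(2)] by (intro mult_strict_left_mono add_strict_mono) auto
      also have "\<dots> = e"
      proof -
        have half: "k * (e / (2 * k) + e / (2 * k)) = e" if "k > 0" for k :: real using that by (simp add: field_simps)
        show ?thesis by (rule half) linarith
      qed
      finally show ?thesis .
    qed
    then show "\<exists>N. \<forall>m\<ge>N. \<forall>n\<ge>N. L2norm M (\<lambda>t. X m t - X n t) < e" by blast
  qed
  then show ?thesis using has_stoch_integral_closed[OF int h] by blast
qed

section \<open>Linear statistics of a signal in noise\<close>

lemma cis_diff_le: "cmod (cis a - cis b) \<le> \<bar>a - b\<bar>"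
proof -
  have "cis a - cis b = cis b * (cis (a - b) - 1)"
    by (simp add: right_diff_distrib cis_mult)
  then have "cmod (cis a - cis b) = cmod (iexp (a - b) - 1)"
    by (simp add: norm_mult cis_conv_exp)
  also have "\<dots> \<le> \<bar>a - b\<bar>" using iexp_approx1[of "a - b" 0] by simp
  finally show ?thesis .
qed

definition grid :: "nat \<Rightarrow> nat \<Rightarrow> real" where
  "grid n j = - pi + 2 * pi * real j / real (Suc n)"

definition cis_step :: "int \<Rightarrow> nat \<Rightarrow> real \<Rightarrow> complex" where
  "cis_step m n x = (\<Sum>j<Suc n. cis (of_int m * grid n j) * indicator {grid n j..<grid n (Suc j)} x)"

definition cis_step_integral :: "(real \<Rightarrow> 'a \<Rightarrow> complex) \<Rightarrow> int \<Rightarrow> nat \<Rightarrow> 'a \<Rightarrow> complex" where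
  "cis_step_integral Z m n \<omega> = (\<Sum>j<Suc n. cis (of_int m * grid n j) * (Z (grid n (Suc j)) \<omega> - Z (grid n j) \<omega>))"

lemma step_integral_cis_step: "step_integral Z (cis_step m n) (cis_step_integral Z m n)"
proof -
  have "-pi \<le> grid n j \<and> grid n j \<le> grid n (Suc j) \<and> grid n (Suc j) \<le> pi" if "j < Suc n" for j
  proof -
    have "real (Suc j) / real (Suc n) \<le> 1" using that by (simp add: divide_le_eq_1)
    then have "2 * pi * (real (Suc j) / real (Suc n)) \<le> 2 * pi * 1" by (intro mult_left_mono) auto
    then have "2 * pi * real (Suc j) / real (Suc n) \<le> 2 * pi" by simp
    moreover have "2 * pi * real j / real (Suc n) \<le> 2 * pi * real (Suc j) / real (Suc n)"
      by (intro divide_right_mono mult_left_mono) auto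
    moreover have "0 \<le> 2 * pi * real j / real (Suc n)" by simp
    ultimately show ?thesis unfolding grid_def by linarith
  qed
  then show ?thesis unfolding step_integral_def
    by (intro exI[of _ "Suc n"] exI[of _ "\<lambda>j. cis (of_int m * grid n j)"] exI[of _ "grid n"] exI[of _ "\<lambda>j. grid n (Suc j)"])
      (auto simp: cis_step_def cis_step_integral_def fun_eq_iff)
qed

text \<open>The point \<open>x\<close> lies in exactly one cell of the grid, and \<open>cis (m * x)\<close> varies by at most \<open>\<bar>m\<bar>\<close> times the
  length of the cell.\<close>

lemma cis_step_near:
  assumes x: "x \<in> {-pi..<pi}"
  shows "cmod (cis_step m n x - cis (of_int m * x)) \<le> \<bar>of_int m\<bar> * (2 * pi / real (Suc n))"
proof -
  define y where "y = (x + pi) * real (Suc n) / (2 * pi)"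
  define j where "j = nat \<lfloor>y\<rfloor>"
  have x_eq: "x = - pi + 2 * pi * y / real (Suc n)" by (simp add: y_def)
  have "0 \<le> y" using x by (simp add: y_def)
  have "(x + pi) / (2 * pi) < 1" using x by simp
  then have "(x + pi) / (2 * pi) * real (Suc n) < 1 * real (Suc n)" by (rule mult_strict_right_mono) simp
  then have "y < real (Suc n)" by (simp add: y_def)
  have j: "real j \<le> y" "y < real j + 1" using \<open>0 \<le> y\<close> by (auto simp: j_def)
  have "j < Suc n" using j(1) \<open>y < real (Suc n)\<close> by linarith
  have mem: "x \<in> {grid n i..<grid n (Suc i)} \<longleftrightarrow> i = j" for i
  proof -
    have pos: "2 * pi / real (Suc n) > 0" by simp
    have "grid n i \<le> x \<longleftrightarrow> 2 * pi / real (Suc n) * real i \<le> 2 * pi / real (Suc n) * y"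
      unfolding grid_def x_eq by simp
    also have "\<dots> \<longleftrightarrow> real i \<le> y" using pos by (rule mult_le_cancel_left_pos)
    finally have 1: "grid n i \<le> x \<longleftrightarrow> real i \<le> y" .
    have "x < grid n (Suc i) \<longleftrightarrow> 2 * pi / real (Suc n) * y < 2 * pi / real (Suc n) * real (Suc i)"
      unfolding grid_def x_eq by simp
    also have "\<dots> \<longleftrightarrow> y < real (Suc i)" using pos by (rule mult_less_cancel_left_pos)
    finally have 2: "x < grid n (Suc i) \<longleftrightarrow> y < real (Suc i)" .
    show ?thesis using 1 2 j by auto
  qed
  have "cis_step m n x = (\<Sum>i<Suc n. if i = j then cis (of_int m * grid n i) else 0)"
    unfolding cis_step_def by (intro sum.cong refl) (use mem in \<open>auto simp: indicator_def\<close>)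
  also have "\<dots> = cis (of_int m * grid n j)" using \<open>j < Suc n\<close> by simp
  finally have "cmod (cis_step m n x - cis (of_int m * x)) \<le> \<bar>of_int m * grid n j - of_int m * x\<bar>"
    using cis_diff_le by simp
  also have "\<dots> = \<bar>of_int m\<bar> * \<bar>grid n j - x\<bar>" by (simp add: abs_mult flip: right_diff_distrib)
  also have "\<dots> \<le> \<bar>of_int m\<bar> * (2 * pi / real (Suc n))"
  proof (rule mult_left_mono)
    have "grid n (Suc j) - grid n j = 2 * pi / real (Suc n)"
      unfolding grid_def by (simp add: distrib_left add_divide_distrib)
    then show "\<bar>grid n j - x\<bar> \<le> 2 * pi / real (Suc n)" using mem[of j] by auto
  qed simp
  finally show ?thesis .
qed

lemma cis_step_ms_tendsto:
  assumes w: "spectral_density w"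
  shows "ms_tendsto (spec_measure w) (cis_step m) (\<lambda>x. cis (of_int m * x))"
proof -
  define b where "b n = \<bar>of_int m\<bar> * (2 * pi / real (Suc n))" for n
  define I where "I = 1 / (2 * pi) * (LINT x|circ. w x)"
  have meas [measurable]: "cis_step m n \<in> borel_measurable circ" for n
    unfolding cis_step_def[abs_def] by (intro borel_measurable_sum borel_measurable_times indicator_circ_measurable) simp
  have d: "(\<lambda>x. cis_step m n x - cis (of_int m * x)) \<in> borel_measurable circ" for n by measurable
  note bnd = sq_int_spec_measure_bounded[OF w d cis_step_near, folded b_def I_def]
  have sqc: "sq_int (spec_measure w) (\<lambda>x. cis (of_int m * x))"
    by (rule sq_int_spec_measure_bounded(1)[OF w, where B = 1]) auto
  have sqs: "sq_int (spec_measure w) (cis_step m n)" for n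
    using sq_int_add[OF bnd(1)[of n] sqc] by simp
  have "(\<lambda>n. \<bar>of_int m\<bar> * (2 * pi * inverse (real (Suc n)))) \<longlonglongrightarrow> \<bar>of_int m\<bar> * (2 * pi * 0)"
    by (intro tendsto_mult_left LIMSEQ_inverse_real_of_nat)
  then have "b \<longlonglongrightarrow> 0" by (simp add: b_def[abs_def] divide_inverse)
  from tendsto_mult_right[OF tendsto_power[OF this, of 2], of I]
  have "(\<lambda>n. (b n)\<^sup>2 * I) \<longlonglongrightarrow> 0" by simp
  then have "(\<lambda>n. (L2norm (spec_measure w) (\<lambda>x. cis_step m n x - cis (of_int m * x)))\<^sup>2) \<longlonglongrightarrow> 0"
    by (rule tendsto_sandwich[OF _ _ tendsto_const, rotated 2]) (use bnd(2) in auto)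
  then show ?thesis using sqc sqs by (simp add: ms_tendsto_def L2norm_square)
qed

text \<open>The same step functions approximate the exponential in \<open>L\<^sub>2\<close> of every spectral measure. So the
  integrals of one sequence converge for both processes, to \<open>\<xi> m\<close> and to \<open>\<eta> m\<close>.\<close>

lemma has_stoch_integral_cis_add:
  assumes f: "spectral_density f" and g: "spectral_density g"
    and \<xi>: "spectral_representation M \<xi> f Z" and \<eta>: "spectral_representation M \<eta> g Z'"
  shows "has_stoch_integral M (\<lambda>x. f x + g x) (\<lambda>t \<omega>. Z t \<omega> + Z' t \<omega>) (\<lambda>x. cis (of_int m * x)) (\<lambda>\<omega>. \<xi> m \<omega> + \<eta> m \<omega>)"
proof -
  have lim: "ms_tendsto M (cis_step_integral Y m) (\<zeta> m)"
    if w: "spectral_density w" and r: "spectral_representation M \<zeta> w Y" for w \<zeta> Y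
  proof (rule has_stoch_integral_ms_tendsto[where K = 1 and w = w and Z = Y])
    have Y: "spectral_process M w Y" using r by (simp add: spectral_representation_def)
    note iso = step_integral_isometry[OF Y w]
    show "L2norm M S \<le> 1 * L2norm (spec_measure w) s" if "step_integral Y s S" for s S
      using iso(3)[OF that] by simp
    show "has_stoch_integral M w Y (cis_step m n) (cis_step_integral Y m n)" for n
      unfolding has_stoch_integral_def
      using step_integral_cis_step[of Y m n] iso(1,2)[OF step_integral_cis_step[of Y m n]]
      by (intro exI[of _ "\<lambda>_. cis_step m n"] exI[of _ "\<lambda>_. cis_step_integral Y m n"]) (auto intro: ms_tendsto_const)
    show "has_stoch_integral M w Y (\<lambda>x. cis (of_int m * x)) (\<zeta> m)"
      using r by (simp add: spectral_representation_def)
    show "ms_tendsto (spec_measure w) (cis_step m) (\<lambda>x. cis (of_int m * x))"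
      by (rule cis_step_ms_tendsto[OF w])
  qed
  have eq: "cis_step_integral (\<lambda>t \<omega>. Z t \<omega> + Z' t \<omega>) m n = (\<lambda>\<omega>. cis_step_integral Z m n \<omega> + cis_step_integral Z' m n \<omega>)" for n
    unfolding cis_step_integral_def by (simp only: sum.distrib[symmetric]) (simp add: algebra_simps)
  show ?thesis unfolding has_stoch_integral_def
  proof (rule exI[of _ "cis_step m"], rule exI[of _ "cis_step_integral (\<lambda>t \<omega>. Z t \<omega> + Z' t \<omega>) m"], intro conjI allI)
    show "step_integral (\<lambda>t \<omega>. Z t \<omega> + Z' t \<omega>) (cis_step m n) (cis_step_integral (\<lambda>t \<omega>. Z t \<omega> + Z' t \<omega>) m n)" for n
      by (rule step_integral_cis_step)
    show "ms_tendsto (spec_measure (\<lambda>x. f x + g x)) (cis_step m) (\<lambda>x. cis (of_int m * x))"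
      by (rule cis_step_ms_tendsto[OF spectral_density_add[OF f g]])
    show "ms_tendsto M (cis_step_integral (\<lambda>t \<omega>. Z t \<omega> + Z' t \<omega>) m) (\<lambda>\<omega>. \<xi> m \<omega> + \<eta> m \<omega>)"
      using ms_tendsto_add[OF lim[OF f \<xi>] lim[OF g \<eta>]] unfolding eq[abs_def] .
  qed
qed

lemma A_poly_cis: "A_poly r c x = (\<Sum>k\<le>r. c k * cis (of_int (- int k) * x))"
  by (simp add: A_poly_def)

lemma A_functional_add: "A_functional r c (\<lambda>m \<omega>. \<xi> m \<omega> + \<eta> m \<omega>) = (\<lambda>\<omega>. A_functional r c \<xi> \<omega> + A_functional r c \<eta> \<omega>)"
  by (rule ext) (simp add: A_functional_def distrib_left sum.distrib)

lemma has_stoch_integral_A: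
  assumes "\<And>m. has_stoch_integral M w Z (\<lambda>x. cis (of_int m * x)) (\<zeta> m)"
  shows "has_stoch_integral M w Z (A_poly r c) (A_functional r c \<zeta>)"
  unfolding A_poly_cis[abs_def] A_functional_def[abs_def]
  by (intro has_stoch_integral_sum has_stoch_integral_scale assms) auto

lemma sq_int_A_functional: "(\<And>m. sq_int M (\<zeta> m)) \<Longrightarrow> sq_int M (A_functional r c \<zeta>)"
  unfolding A_functional_def[abs_def] by (intro sq_int_sum sq_int_scale)

lemma A_poly_bounded: "cmod (A_poly r c x) \<le> (\<Sum>k\<le>r. cmod (c k))"
  unfolding A_poly_def by (rule order_trans[OF norm_sum]) (simp add: norm_mult)

lemma A_poly_measurable [measurable]: "A_poly r c \<in> borel_measurable circ"
  unfolding A_poly_def[abs_def] by measurable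

lemma sq_int_A_poly: "spectral_density w \<Longrightarrow> sq_int (spec_measure w) (A_poly r c)"
  by (rule sq_int_spec_measure_bounded(1)[OF _ A_poly_measurable A_poly_bounded])

lemma cov_A_stationary:
  assumes "stationary_with M \<xi> f"
  shows "cov M (A_functional r c \<xi>) (A_functional s d \<xi>) = cov (spec_measure f) (A_poly r c) (A_poly s d)"
proof -
  have f: "spectral_density f" and sq: "\<And>m. sq_int M (\<xi> m)"
    and cv: "\<And>m k. cov M (\<xi> (m + k)) (\<xi> m) = circ_mean (\<lambda>x. cis (of_int k * x) * of_real (f x))"
    using assms by (auto simp: stationary_with_def rv_space_def)
  have cov_cis: "cov M (\<xi> a) (\<xi> b) = cov (spec_measure f) (\<lambda>x. cis (of_int a * x)) (\<lambda>x. cis (of_int b * x))" for a b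
  proof -
    have "cis (of_int a * x) * cnj (cis (of_int b * x)) = cis (of_int (a - b) * x)" for x
      unfolding cis_cnj cis_mult by (simp add: algebra_simps)
    then show ?thesis using cv[of b "a - b"] by (simp add: cov_spec_measure[OF f])
  qed
  have sq_cis: "sq_int (spec_measure f) (\<lambda>x. cis (of_int a * x))" for a
    by (rule sq_int_spec_measure_bounded(1)[OF f, where B = 1]) auto
  show ?thesis unfolding A_poly_cis[abs_def] A_functional_def[abs_def]
    by (rule cov_linear_combinations_cong[OF sq sq sq_cis sq_cis cov_cis])
qed

lemma cov_A_uncorrelated:
  assumes "uncorrelated M \<xi> \<eta>" "\<And>m. sq_int M (\<xi> m)" "\<And>m. sq_int M (\<eta> m)"
  shows "cov M (A_functional r c \<xi>) (A_functional s d \<eta>) = 0" "cov M (A_functional s d \<eta>) (A_functional r c \<xi>) = 0"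
proof -
  have "cov M (A_functional r c \<xi>) (A_functional s d \<eta>)
      = (\<Sum>i\<le>r. \<Sum>j\<le>s. c i * (cnj (d j) * cov M (\<xi> (- int i)) (\<eta> (- int j))))"
    unfolding A_functional_def[abs_def] by (rule cov_linear_combinations) (use assms in auto)
  then show "cov M (A_functional r c \<xi>) (A_functional s d \<eta>) = 0"
    using assms(1) by (simp add: uncorrelated_def)
  then show "cov M (A_functional s d \<eta>) (A_functional r c \<xi>) = 0"
    by (subst cov_commute) simp
qed

text \<open>Both residuals are orthogonal to \<open>X\<close> and to \<open>X'\<close>, so \<open>X - X'\<close> is orthogonal to itself.\<close>

lemma orth_projection_unique:
  assumes S: "\<And>U. U \<in> S \<Longrightarrow> sq_int M U" and Y: "sq_int M Y"
    and X: "orth_projection M S Y X" and X': "orth_projection M S Y X'"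
  shows "AE \<omega> in M. X \<omega> = X' \<omega>"
proof -
  have sq: "sq_int M X" "sq_int M X'" and mem: "X \<in> S" "X' \<in> S" using X X' S by (auto simp: orth_projection_def)
  have orth: "cov M Y U - cov M X U = 0" "cov M Y U - cov M X' U = 0" if "U \<in> S" for U
    using X X' that cov_diff_left[OF Y sq(1) S[OF that]] cov_diff_left[OF Y sq(2) S[OF that]]
    by (auto simp: orth_projection_def)
  have "cov M (\<lambda>\<omega>. X \<omega> - X' \<omega>) (\<lambda>\<omega>. X \<omega> - X' \<omega>) = 0"
    using orth[OF mem(1)] orth[OF mem(2)] sq by (simp add: cov_diff_left cov_diff_right sq_int_diff)
  then have "L2norm M (\<lambda>\<omega>. X \<omega> - X' \<omega>) = 0" unfolding cov_self by simp
  then show ?thesis using L2norm_eq_0_iff[OF sq_int_diff[OF sq]] by simp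
qed

text \<open>The probabilistic hypotheses. The results of this locale translate errors of estimates of linear
  functionals of the signal into the frequency domain.\<close>

locale signal_in_noise =
  fixes M :: "'a measure" and \<xi> \<eta> :: "int \<Rightarrow> 'a \<Rightarrow> complex" and f g :: "real \<Rightarrow> real"
    and Z\<^sub>\<xi> Z\<^sub>\<eta> :: "real \<Rightarrow> 'a \<Rightarrow> complex"
  assumes prob: "prob_space M"
    and stat\<xi>: "stationary_with M \<xi> f" and stat\<eta>: "stationary_with M \<eta> g"
    and uncorr: "uncorrelated M \<xi> \<eta>"
    and rep\<xi>: "spectral_representation M \<xi> f Z\<^sub>\<xi>" and rep\<eta>: "spectral_representation M \<eta> g Z\<^sub>\<eta>"
begin

abbreviation w where "w \<equiv> \<lambda>x. f x + g x"
abbreviation \<zeta> where "\<zeta> \<equiv> \<lambda>m \<omega>. \<xi> m \<omega> + \<eta> m \<omega>"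
abbreviation Z where "Z \<equiv> \<lambda>t \<omega>. Z\<^sub>\<xi> t \<omega> + Z\<^sub>\<eta> t \<omega>"

lemma f: "spectral_density f" and g: "spectral_density g" and w: "spectral_density w"
  using stat\<xi> stat\<eta> by (auto simp: stationary_with_def intro: spectral_density_add)

lemma rv: "\<xi> m \<in> rv_space M" "\<eta> m \<in> rv_space M"
  using stat\<xi> stat\<eta> by (auto simp: stationary_with_def)

lemma sq_rv: "sq_int M (\<xi> m)" "sq_int M (\<eta> m)"
  using rv by (auto simp: rv_space_def)

lemma sq_functional: "sq_int M (A_functional r c \<xi>)" "sq_int M (A_functional r c \<eta>)" "sq_int M (A_functional r c \<zeta>)"
  using sq_rv by (auto intro!: sq_int_A_functional)

lemma step_bound: "step_integral Z s S \<Longrightarrow> L2norm M S \<le> 2 * L2norm (spec_measure w) s"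
  by (rule step_integral_sum_process(2)[OF f g])
    (use rep\<xi> rep\<eta> in \<open>auto simp: spectral_representation_def\<close>)

lemma observation_integral: "has_stoch_integral M w Z (A_poly r c) (A_functional r c \<zeta>)"
  by (rule has_stoch_integral_A) (rule has_stoch_integral_cis_add[OF f g rep\<xi> rep\<eta>])

lemmas sq_poly = sq_int_A_poly[OF f] sq_int_A_poly[OF g] sq_int_A_poly[OF w]

text \<open>For a finite combination of observations the error is a combination of the signal with the
  characteristic \<open>A - p\<close> minus one of the noise with the characteristic \<open>p\<close>; stationarity computes the
  two covariances and the mixed terms vanish.\<close>

lemma error_cov_polynomial:
  "cov M (\<lambda>\<omega>. A_functional N a \<xi> \<omega> - A_functional r c \<zeta> \<omega>) (A_functional s d \<zeta>)
     = cov (spec_measure f) (\<lambda>x. A_poly N a x - A_poly r c x) (A_poly s d) - cov (spec_measure g) (A_poly r c) (A_poly s d)"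
  unfolding A_functional_add
  by (simp add: cov_diff_left cov_add_left cov_add_right sq_int_add sq_int_diff sq_functional sq_poly
      cov_A_stationary[OF stat\<xi>] cov_A_stationary[OF stat\<eta>] cov_A_uncorrelated[OF uncorr sq_rv])

lemma error_norm_polynomial:
  "(L2norm M (\<lambda>\<omega>. A_functional N a \<xi> \<omega> - A_functional r c \<zeta> \<omega>))\<^sup>2
     = (L2norm (spec_measure f) (\<lambda>x. A_poly N a x - A_poly r c x))\<^sup>2 + (L2norm (spec_measure g) (A_poly r c))\<^sup>2"
proof -
  have "complex_of_real ((L2norm M (\<lambda>\<omega>. A_functional N a \<xi> \<omega> - A_functional r c \<zeta> \<omega>))\<^sup>2)
     = of_real ((L2norm (spec_measure f) (\<lambda>x. A_poly N a x - A_poly r c x))\<^sup>2) + of_real ((L2norm (spec_measure g) (A_poly r c))\<^sup>2)"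
    unfolding cov_self[symmetric] A_functional_add
    by (simp add: cov_diff_left cov_diff_right cov_add_left cov_add_right sq_int_add sq_int_diff sq_functional sq_poly
      cov_A_stationary[OF stat\<xi>] cov_A_stationary[OF stat\<eta>] cov_A_uncorrelated[OF uncorr sq_rv])
  then show ?thesis unfolding of_real_add[symmetric] of_real_eq_iff .
qed

text \<open>From here on \<open>h\<close> is a limit of polynomials in nonpositive frequencies, and \<open>X\<close> is its stochastic
  integral. The formulas for finite combinations of observations pass to the limit.\<close>

context
  fixes r c h X
  assumes h: "ms_tendsto (spec_measure w) (\<lambda>n. A_poly (r n) (c n)) h"
    and X: "has_stoch_integral M w Z h X"
begin

lemma estimate_limit: "ms_tendsto M (\<lambda>n. A_functional (r n) (c n) \<zeta>) X"
  by (rule has_stoch_integral_ms_tendsto[OF step_bound observation_integral X h])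

lemma error_limit: "ms_tendsto M (\<lambda>n \<omega>. A_functional N a \<xi> \<omega> - A_functional (r n) (c n) \<zeta> \<omega>) (\<lambda>\<omega>. A_functional N a \<xi> \<omega> - X \<omega>)"
  by (rule ms_tendsto_diff[OF ms_tendsto_const[OF sq_functional(1)] estimate_limit])

lemma char_limit: "ms_tendsto (spec_measure f) (\<lambda>n x. A_poly N a x - A_poly (r n) (c n) x) (\<lambda>x. A_poly N a x - h x)"
  "ms_tendsto (spec_measure g) (\<lambda>n. A_poly (r n) (c n)) h"
  using ms_tendsto_diff[OF ms_tendsto_const[OF sq_poly(1)] ms_tendsto_spec_measure_add(1)[OF f g h]]
    ms_tendsto_spec_measure_add(2)[OF f g h] .

lemma error_cov:
  "cov M (\<lambda>\<omega>. A_functional N a \<xi> \<omega> - X \<omega>) (A_functional s d \<zeta>)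
     = cov (spec_measure f) (\<lambda>x. A_poly N a x - h x) (A_poly s d) - cov (spec_measure g) h (A_poly s d)"
proof (rule LIMSEQ_unique)
  show "(\<lambda>n. cov M (\<lambda>\<omega>. A_functional N a \<xi> \<omega> - A_functional (r n) (c n) \<zeta> \<omega>) (A_functional s d \<zeta>))
      \<longlonglongrightarrow> cov M (\<lambda>\<omega>. A_functional N a \<xi> \<omega> - X \<omega>) (A_functional s d \<zeta>)"
    by (rule ms_tendsto_cov[OF error_limit ms_tendsto_const[OF sq_functional(3)]])
  show "(\<lambda>n. cov M (\<lambda>\<omega>. A_functional N a \<xi> \<omega> - A_functional (r n) (c n) \<zeta> \<omega>) (A_functional s d \<zeta>))
      \<longlonglongrightarrow> cov (spec_measure f) (\<lambda>x. A_poly N a x - h x) (A_poly s d) - cov (spec_measure g) h (A_poly s d)"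
    unfolding error_cov_polynomial
    by (intro tendsto_diff ms_tendsto_cov char_limit ms_tendsto_const sq_poly)
qed

lemma error_norm:
  "(L2norm M (\<lambda>\<omega>. A_functional N a \<xi> \<omega> - X \<omega>))\<^sup>2
     = (L2norm (spec_measure f) (\<lambda>x. A_poly N a x - h x))\<^sup>2 + (L2norm (spec_measure g) h)\<^sup>2"
proof (rule LIMSEQ_unique)
  show "(\<lambda>n. (L2norm M (\<lambda>\<omega>. A_functional N a \<xi> \<omega> - A_functional (r n) (c n) \<zeta> \<omega>))\<^sup>2)
      \<longlonglongrightarrow> (L2norm M (\<lambda>\<omega>. A_functional N a \<xi> \<omega> - X \<omega>))\<^sup>2"
    by (intro tendsto_power ms_tendsto_L2norm error_limit)
  show "(\<lambda>n. (L2norm M (\<lambda>\<omega>. A_functional N a \<xi> \<omega> - A_functional (r n) (c n) \<zeta> \<omega>))\<^sup>2)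
      \<longlonglongrightarrow> (L2norm (spec_measure f) (\<lambda>x. A_poly N a x - h x))\<^sup>2 + (L2norm (spec_measure g) h)\<^sup>2"
    unfolding error_norm_polynomial
    by (intro tendsto_add tendsto_power ms_tendsto_L2norm char_limit)
qed

text \<open>The mean of a variable is its inner product with the constant \<open>1\<close>, so it is zero for limits of
  centred variables.\<close>

lemma estimate_in_past: "X \<in> past_space M \<zeta>"
proof -
  have one: "sq_int M (\<lambda>\<omega>. 1)"
    using prob by (simp add: sq_int_def prob_space.finite_measure finite_measure.integrable_const)
  have mean: "(LINT \<omega>|M. A \<omega>) = cov M A (\<lambda>\<omega>. 1)" for A by (simp add: cov_def)
  have "cov M (A_functional (r n) (c n) \<zeta>) (\<lambda>\<omega>. 1) = 0" for n
  proof -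
    have "cov M (\<lambda>\<omega>. \<zeta> m \<omega>) (\<lambda>\<omega>. 1) = 0" for m
      using rv[of m] cov_add_left[OF sq_rv one] by (simp add: rv_space_def mean)
    then show ?thesis unfolding A_functional_def[abs_def]
      by (subst cov_sum_left) (auto simp: cov_scale_left one intro!: sq_int_scale sq_int_add sq_rv)
  qed
  then have "cov M X (\<lambda>\<omega>. 1) = 0"
    using ms_tendsto_cov[OF estimate_limit ms_tendsto_const[OF one]] by (simp add: LIMSEQ_const_iff)
  then have "X \<in> rv_space M"
    using has_stoch_integral_sq_int(1)[OF X] by (simp add: rv_space_def mean)
  moreover have "\<exists>Y. ms_tendsto M Y X \<and> (\<forall>n. \<exists>r c. Y n = (\<lambda>\<omega>. \<Sum>j\<le>r. c j * \<zeta> (- int j) \<omega>))"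
  proof (rule exI[of _ "\<lambda>n. A_functional (r n) (c n) \<zeta>"], intro conjI allI)
    show "\<exists>s d. A_functional (r n) (c n) \<zeta> = (\<lambda>\<omega>. \<Sum>j\<le>s. d j * \<zeta> (- int j) \<omega>)" for n
      by (rule exI[of _ "r n"], rule exI[of _ "c n"]) (simp only: A_functional_def[abs_def])
  qed (rule estimate_limit)
  ultimately show ?thesis unfolding past_space_def by blast
qed

text \<open>The orthogonality condition says that the error is orthogonal to every finite combination of
  observations; continuity extends this to the closed span.\<close>

lemma estimate_optimal:
  assumes orth: "\<And>s d. cov (spec_measure f) (\<lambda>x. A_poly N a x - h x) (A_poly s d) = cov (spec_measure g) h (A_poly s d)"
  shows "optimal_estimate M \<zeta> (A_functional N a \<xi>) X"
  unfolding optimal_estimate_def orth_projection_def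
proof (intro conjI ballI estimate_in_past)
  let ?E = "\<lambda>\<omega>. A_functional N a \<xi> \<omega> - X \<omega>"
  fix U assume "U \<in> past_space M \<zeta>"
  then obtain Y where Y: "ms_tendsto M Y U" "\<forall>n. \<exists>s d. Y n = (\<lambda>\<omega>. \<Sum>j\<le>s. d j * \<zeta> (- int j) \<omega>)"
    unfolding past_space_def by blast
  have zero: "cov M ?E (Y n) = 0" for n
  proof -
    obtain s d where "Y n = A_functional s d \<zeta>" using Y(2) unfolding A_functional_def[abs_def] by blast
    then show ?thesis using error_cov[of N a s d] orth by simp
  qed
  have "sq_int M ?E" using has_stoch_integral_sq_int(1)[OF X] sq_functional by auto
  from ms_tendsto_cov[OF ms_tendsto_const[OF this] Y(1)] show "cov M ?E U = 0"
    by (simp add: zero LIMSEQ_const_iff)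
qed

end

end

section \<open>The filtering equation\<close>

lemma integrable_circ_AE_bounded:
  fixes F :: "real \<Rightarrow> 'a::{banach, second_countable_topology}"
  assumes "F \<in> borel_measurable circ" "AE x in circ. norm (F x) \<le> K"
  shows "integrable circ F"
  by (rule finite_measure.integrable_const_bound[OF finite_measure_circ assms(2,1)])

lemma sum_mult_pad: "(\<lambda>k. B k * pad N a k) sums (\<Sum>k\<le>N. B k * a k)"
proof -
  have "(\<lambda>k. B k * pad N a k) sums (\<Sum>k\<le>N. B k * pad N a k)"
    by (rule sums_finite) (auto simp: pad_def)
  then show ?thesis by (simp add: pad_def)
qed

lemma mat_app_pad: "mat_app B (pad N a) l = (\<Sum>k\<le>N. B l k * a k)"
  unfolding mat_app_def using sums_unique[OF sum_mult_pad] by simp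

lemma pad_l2: "pad N a \<in> l2"
  by (rule l2_finite_support[of N]) (simp add: pad_def)

lemma A_poly_square: "complex_of_real ((cmod (A_poly N a x))\<^sup>2) = (\<Sum>l\<le>N. \<Sum>k\<le>N. a k * cnj (a l) * cis (x * (real l - real k)))"
proof -
  have "complex_of_real ((cmod (A_poly N a x))\<^sup>2) = cnj (A_poly N a x) * A_poly N a x"
    unfolding complex_norm_square by (rule mult.commute)
  also have "\<dots> = (\<Sum>l\<le>N. \<Sum>k\<le>N. cnj (a l * cis (- (real l * x))) * (a k * cis (- (real k * x))))"
    unfolding A_poly_def cnj_sum sum_product ..
  also have "\<dots> = (\<Sum>l\<le>N. \<Sum>k\<le>N. a k * cnj (a l) * cis (x * (real l - real k)))"
  proof (intro sum.cong refl)
    fix l k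
    have "cis (x * (real l - real k)) = cnj (cis (- (real l * x))) * cis (- (real k * x))"
      unfolding cis_cnj cis_mult by (simp add: algebra_simps)
    then show "cnj (a l * cis (- (real l * x))) * (a k * cis (- (real k * x))) = a k * cnj (a l) * cis (x * (real l - real k))"
      by simp
  qed
  finally show ?thesis .
qed

text \<open>The mixed terms of the two squares have the coefficients \<open>g * f\<close> and \<open>- f * g\<close> and cancel.\<close>

lemma error_density_identity:
  fixes A C :: complex and f g :: real
  assumes "f + g > 0"
  shows "(cmod (A * of_real g + C))\<^sup>2 / (f + g)\<^sup>2 * f + (cmod (A * of_real f - C))\<^sup>2 / (f + g)\<^sup>2 * g
       = (cmod C)\<^sup>2 / (f + g) + (cmod A)\<^sup>2 * (f * g / (f + g))"
proof -
  have "(cmod (A * of_real g + C))\<^sup>2 * f + (cmod (A * of_real f - C))\<^sup>2 * g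
      = (f + g) * ((cmod C)\<^sup>2 + (cmod A)\<^sup>2 * (f * g))"
    unfolding cmod_power2 by (simp add: power2_eq_square algebra_simps)
  then have "((cmod (A * of_real g + C))\<^sup>2 * f + (cmod (A * of_real f - C))\<^sup>2 * g) / (f + g)\<^sup>2
      = ((cmod C)\<^sup>2 + (cmod A)\<^sup>2 * (f * g)) / (f + g)"
    using assms by (simp add: power2_eq_square)
  then show ?thesis by (simp add: add_divide_distrib)
qed

text \<open>The frequency domain problem for densities that are bounded together with the inverse of their
  sum. Here \<open>y\<close> is the right-hand side and \<open>c\<close> the solution of the linear system, \<open>U\<close> is the symbol of
  \<open>P_mat f g\<close>, and \<open>H\<close> is the characteristic of the best estimate from the observations at all times.
  The spectral characteristic \<open>h\<close> is \<open>H - U * C\<close>, where \<open>C\<close> has positive frequencies only.\<close>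

locale filtering_equation =
  fixes f g :: "real \<Rightarrow> real" and N :: nat and a :: "nat \<Rightarrow> complex" and K :: real
  assumes f: "spectral_density f" and g: "spectral_density g"
    and bounds: "AE x in circ. 0 < f x + g x \<and> f x + g x \<le> K \<and> 1 / (f x + g x) \<le> K"
    and P: "l2_matrix (P_mat f g)" and P_inv: "l2_invertible (P_mat f g)"
    and R: "l2_matrix (R_mat f g N)"
begin

abbreviation w where "w \<equiv> \<lambda>x. f x + g x"
definition y where "y = mat_app (R_mat f g N) (pad N a)"
definition c where "c = l2_inverse (P_mat f g) y"
definition U where "U x = complex_of_real (1 / (f x + g x))"
definition H where "H x = A_poly N a x * of_real (f x / (f x + g x))"
abbreviation A where "A \<equiv> A_poly N a"
abbreviation C where "C \<equiv> C_series f g N a"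
abbreviation h where "h \<equiv> spectral_char f g N a"

lemma w: "spectral_density w" by (rule spectral_density_add[OF f g])

lemmas fg_measurable [measurable] = spectral_densityD(2)[OF f] spectral_densityD(2)[OF g]

lemma nonneg: "AE x in circ. 0 \<le> f x \<and> 0 \<le> g x"
  using spectral_densityD(3)[OF f] spectral_densityD(3)[OF g] by eventually_elim simp

lemma ratio_bounds: "AE x in circ. f x / (f x + g x) \<le> 1 \<and> 0 \<le> f x / (f x + g x) \<and> f x * g x / (f x + g x) \<le> K \<and> 0 \<le> f x * g x / (f x + g x)"
  using bounds nonneg
proof eventually_elim
  case (elim x)
  have r: "f x / (f x + g x) \<le> 1" "0 \<le> f x / (f x + g x)" using elim by auto
  have "f x * g x / (f x + g x) = f x / (f x + g x) * g x" by simp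
  also have "\<dots> \<le> 1 * K" using r elim by (intro mult_mono) auto
  finally show ?case using r elim by auto
qed

lemma U_measurable [measurable]: "U \<in> borel_measurable circ"
  unfolding U_def[abs_def] by measurable

lemma U_bounded: "AE x in circ. cmod (U x) \<le> K"
  using bounds by eventually_elim (simp add: U_def norm_divide flip: of_real_add)

lemma sq_U: "sq_int circ U"
  using sq_int_mult_bounded[OF sq_int_cis[of 0] U_measurable U_bounded] by simp

lemma sq_H: "sq_int circ H"
proof -
  have 1: "sq_int circ A" by (rule sq_int_circ_bounded[OF A_poly_measurable A_poly_bounded])
  have 2: "AE x in circ. cmod (of_real (f x / (f x + g x))) \<le> 1"
    using ratio_bounds by eventually_elim (simp only: norm_of_real abs_of_nonneg)
  have "sq_int circ (\<lambda>x. of_real (f x / (f x + g x)) * A x)"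
    by (rule sq_int_mult_bounded[OF 1 _ 2]) measurable
  then show ?thesis by (simp add: H_def[abs_def] mult.commute)
qed

text \<open>The right-hand side of the system consists of the coefficients of \<open>H\<close> at positive frequencies.\<close>

lemma y_coeff: "y l = fourier H (int l + 1)"
proof -
  have int: "integrable circ (\<lambda>x. cis (- x * real (l + 1 + k)) * of_real (f x / (f x + g x)))" for k
  proof (rule integrable_circ_AE_bounded)
    show "AE x in circ. cmod (cis (- x * real (l + 1 + k)) * of_real (f x / (f x + g x))) \<le> 1"
      using ratio_bounds by eventually_elim (simp only: norm_mult norm_of_real abs_of_nonneg norm_cis mult_1_left)
    have "- x * real (l + 1 + k) = - (real (l + 1 + k) * x)" for x by simp
    then have [measurable]: "(\<lambda>x. cis (- x * real (l + 1 + k))) \<in> borel_measurable circ"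
      by (simp only: cis_measurable_circ(2))
    show "(\<lambda>x. cis (- x * real (l + 1 + k)) * of_real (f x / (f x + g x))) \<in> borel_measurable circ"
      by measurable
  qed
  have "y l = (\<Sum>k\<le>N. R_mat f g N l k * a k)" unfolding y_def by (rule mat_app_pad)
  also have "\<dots> = (\<Sum>k\<le>N. LINT x|circ. a k * (cis (- x * real (l + 1 + k)) * of_real (f x / (f x + g x)))) / (2 * of_real pi)"
    unfolding R_mat_def circ_mean_def sum_divide_distrib integral_mult_right_zero by (intro sum.cong refl) simp
  also have "(\<Sum>k\<le>N. LINT x|circ. a k * (cis (- x * real (l + 1 + k)) * of_real (f x / (f x + g x))))
      = (LINT x|circ. (\<Sum>k\<le>N. a k * (cis (- x * real (l + 1 + k)) * of_real (f x / (f x + g x)))))"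
    by (rule Bochner_Integration.integral_sum[symmetric]) (intro integrable_mult_right int)
  also have "(\<lambda>x. \<Sum>k\<le>N. a k * (cis (- x * real (l + 1 + k)) * of_real (f x / (f x + g x)))) = (\<lambda>x. cis (- (of_int (int l + 1) * x)) * H x)"
  proof
    fix x
    have "cis (- x * real (l + 1 + k)) = cis (- (of_int (int l + 1) * x)) * cis (- (real k * x))" for k
      unfolding cis_mult by (simp add: algebra_simps)
    then show "(\<Sum>k\<le>N. a k * (cis (- x * real (l + 1 + k)) * of_real (f x / (f x + g x)))) = cis (- (of_int (int l + 1) * x)) * H x"
      unfolding H_def A_poly_def by (simp only: sum_distrib_left sum_distrib_right) (simp only: mult_ac)
  qed
  finally show ?thesis unfolding fourier_def circ_mean_def .
qed

lemma y_l2: "y \<in> l2"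
  using R pad_l2 unfolding l2_matrix_def y_def by blast

lemma c_l2: "c \<in> l2" and P_c: "mat_app (P_mat f g) c = y"
proof -
  have img: "mat_app (P_mat f g) ` l2 = l2"
    using P_inv by (auto simp: l2_invertible_def bij_betw_def)
  then have "y \<in> mat_app (P_mat f g) ` l2" using y_l2 by simp
  then show "c \<in> l2" "mat_app (P_mat f g) c = y"
    unfolding c_def l2_inverse_def by (rule inv_into_into, rule f_inv_into_f)
qed

lemma C_eq: "C = trig_series (\<lambda>k. int k + 1) c"
  by (simp add: C_series_def c_def y_def)

lemma sq_C: "sq_int circ C"
  unfolding C_eq by (rule sq_int_trig_series[OF c_l2 inj_freq(3)])

lemmas C_measurable [measurable] = sq_int_measurable[OF sq_C]

lemma sq_UC: "sq_int circ (\<lambda>x. U x * C x)"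
  by (rule sq_int_mult_bounded[OF sq_C U_measurable U_bounded])

text \<open>The system \<open>P c = y\<close> says that \<open>U * C\<close> and \<open>H\<close> have the same coefficients at positive frequencies. The
  shift by one in the frequencies of \<open>C\<close> cancels in the Toeplitz matrix.\<close>

lemma fourier_UC: "fourier (\<lambda>x. U x * C x) (int l + 1) = y l"
proof -
  have "(\<lambda>k. fourier U (int l + 1 - (int k + 1)) * c k) sums fourier (\<lambda>x. U x * C x) (int l + 1)"
    unfolding C_eq by (rule fourier_mult_trig_series_sums[OF c_l2 inj_freq(3) sq_U])
  then have "(\<lambda>k. P_mat f g l k * c k) sums fourier (\<lambda>x. U x * C x) (int l + 1)"
    unfolding P_mat_toeplitz toeplitz_def U_def[abs_def] by simp
  from sums_unique[OF this] have "fourier (\<lambda>x. U x * C x) (int l + 1) = mat_app (P_mat f g) c l"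
    by (simp add: mat_app_def)
  then show ?thesis by (simp add: P_c)
qed

lemma h_eq: "h x = H x - U x * C x"
  by (simp add: spectral_char_def H_def U_def)

lemma sq_h: "sq_int circ h"
  unfolding h_eq[abs_def] by (rule sq_int_diff[OF sq_H sq_UC])

lemmas h_measurable [measurable] = sq_int_measurable[OF sq_h]

text \<open>The coefficients of \<open>h\<close> at positive frequencies vanish, so its Fourier series is a series of
  characteristics of past observations. It converges on the circle, and in \<open>L\<^sub>2(f + g)\<close> since \<open>f + g\<close> is
  bounded.\<close>

lemma h_ms_tendsto: "ms_tendsto (spec_measure w) (\<lambda>n. A_poly n (\<lambda>k. fourier h (- int k))) h"
proof -
  have d: "(\<lambda>k. fourier h (- int k)) \<in> l2" by (rule Bessel(1)[OF sq_h inj_freq(2)])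
  have "AE x in circ. h x = trig_series (\<lambda>k. - int k) (\<lambda>k. fourier h (- int k)) x"
  proof (rule AE_eq_trig_series[OF sq_int_circ_integrable[OF sq_h] d inj_freq(2) refl])
    fix n assume n: "n \<notin> range (\<lambda>k. - int k)"
    have "n > 0"
    proof (rule ccontr)
      assume "\<not> n > 0"
      then have "n = - int (nat (- n))" by simp
      with n show False by blast
    qed
    then obtain l where l: "n = int l + 1" by (metis add.commute zero_less_imp_eq_int of_nat_Suc Suc_pred)
    have "fourier h n = fourier H n - fourier (\<lambda>x. U x * C x) n"
      unfolding h_eq[abs_def] by (intro fourier_diff sq_int_circ_integrable sq_H sq_UC)
    then show "fourier h n = 0" unfolding l fourier_UC y_coeff by simp
  qed
  then have ae: "AE x in circ. trig_series (\<lambda>k. - int k) (\<lambda>k. fourier h (- int k)) x = h x"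
    by eventually_elim simp
  have S: "ms_tendsto circ (\<lambda>n x. \<Sum>k<n. fourier h (- int k) * cis (of_int (- int k) * x)) h"
    by (rule ms_tendsto_cong_AE[OF trig_series_ms_tendsto[OF d inj_freq(2)] ae h_measurable])
  have "ms_tendsto circ (\<lambda>n. A_poly n (\<lambda>k. fourier h (- int k))) h"
    using S LIMSEQ_Suc unfolding ms_tendsto_def A_poly_cis[abs_def] lessThan_Suc_atMost[symmetric] by blast
  moreover have "AE x in circ. w x \<le> K" using bounds by eventually_elim simp
  ultimately show ?thesis by (intro ms_tendsto_circ_spec_measure[OF w])
qed

lemma spectral_sq_h: "sq_int (spec_measure f) h" "sq_int (spec_measure g) h"
  using h_ms_tendsto sq_int_spec_measure_add(1,2)[OF f g] by (auto simp: ms_tendsto_iff)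

lemma spectral_sq_error: "sq_int (spec_measure f) (\<lambda>x. A x - h x)"
  by (rule sq_int_diff[OF sq_int_A_poly[OF f] spectral_sq_h(1)])

lemma error_eq: "AE x in circ. A x - h x = (A x * of_real (g x) + C x) / of_real (f x + g x)
    \<and> h x = (A x * of_real (f x) - C x) / of_real (f x + g x)"
  using bounds
proof eventually_elim
  case (elim x)
  then have "f x + g x \<noteq> 0" by auto
  then have nz: "complex_of_real (f x + g x) \<noteq> 0" by (simp only: of_real_eq_0_iff not_False_eq_True)
  have h: "h x = (A x * of_real (f x) - C x) / of_real (f x + g x)"
    by (simp add: spectral_char_def diff_divide_distrib)
  have "A x = A x * of_real (f x + g x) / of_real (f x + g x)" using nz by simp
  then have "A x - h x = (A x * of_real (f x + g x) - (A x * of_real (f x) - C x)) / of_real (f x + g x)"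
    unfolding h diff_divide_distrib by simp
  then show ?case using h by (simp add: distrib_left)
qed

text \<open>The difference of the two sides is the mean of \<open>(A * f - h * (f + g)) * cnj q\<close> with \<open>q = A_poly s d\<close>. The
  first factor is \<open>C\<close>, which has positive frequencies only, whereas those of \<open>q\<close> are nonpositive.\<close>

lemma error_orthogonal:
  "cov (spec_measure f) (\<lambda>x. A x - h x) (A_poly s d) = cov (spec_measure g) h (A_poly s d)"
proof -
  let ?q = "A_poly s d"
  have i1: "integrable circ (\<lambda>x. (A x - h x) * cnj (?q x) * of_real (f x))"
    and i2: "integrable circ (\<lambda>x. h x * cnj (?q x) * of_real (g x))"
  proof -
    have *: "integrable circ (\<lambda>x. F x * cnj (?q x) * of_real (v x))"
      if v: "spectral_density v" and F: "sq_int (spec_measure v) F" for F v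
    proof -
      have [measurable]: "F \<in> borel_measurable circ" using F by (simp add: sq_int_spec_measure_iff[OF v])
      note [measurable] = spectral_densityD(2)[OF v]
      have "integrable (spec_measure v) (\<lambda>x. F x * cnj (?q x))"
        by (rule integrable_cov[OF F sq_int_A_poly[OF v]])
      then have "integrable circ (\<lambda>x. (v x / (2 * pi)) *\<^sub>R (F x * cnj (?q x)))"
        by (subst (asm) integrable_spec_measure[OF v]) measurable
      from integrable_mult_right[OF this, of "2 * of_real pi"] show ?thesis
        by (simp add: scaleR_conv_of_real mult_ac)
    qed
    show "integrable circ (\<lambda>x. (A x - h x) * cnj (?q x) * of_real (f x))" by (rule *[OF f spectral_sq_error])
    show "integrable circ (\<lambda>x. h x * cnj (?q x) * of_real (g x))" by (rule *[OF g spectral_sq_h(2)])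
  qed
  have m: "(\<lambda>x. A x - h x) \<in> borel_measurable circ" by measurable
  have "cov (spec_measure f) (\<lambda>x. A x - h x) ?q - cov (spec_measure g) h ?q
      = (LINT x|circ. (A x - h x) * cnj (?q x) * of_real (f x) - h x * cnj (?q x) * of_real (g x)) / (2 * of_real pi)"
    unfolding Bochner_Integration.integral_diff[OF i1 i2] diff_divide_distrib circ_mean_def[symmetric]
      cov_spec_measure[OF f m A_poly_measurable] cov_spec_measure[OF g h_measurable A_poly_measurable] ..
  also have "\<dots> = cov circ C ?q / (2 * of_real pi)"
    unfolding cov_def
  proof (intro arg_cong2[where f = "(/)"] refl integral_cong_AE)
    show "AE x in circ. (A x - h x) * cnj (?q x) * of_real (f x) - h x * cnj (?q x) * of_real (g x) = C x * cnj (?q x)"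
      using error_eq bounds
    proof eventually_elim
      case (elim x)
      then have "f x + g x \<noteq> 0" by auto
      then have nz: "complex_of_real (f x + g x) \<noteq> 0" by (simp only: of_real_eq_0_iff not_False_eq_True)
      have "h x * of_real (f x + g x) = A x * of_real (f x) - C x"
        using elim nz by simp
      then have "(A x - h x) * of_real (f x) - h x * of_real (g x) = C x"
        by (simp add: algebra_simps)
      then have "((A x - h x) * of_real (f x) - h x * of_real (g x)) * cnj (?q x) = C x * cnj (?q x)" by simp
      then show ?case by (simp add: algebra_simps)
    qed
  qed measurable
  also have "cov circ C ?q = 0"
  proof -
    have "cov circ C (\<lambda>x. cis (of_int (- int j) * x)) = 0" for j
    proof -
      have "fourier C (- int j) = 0"
        unfolding C_eq by (rule fourier_trig_series_notin[OF c_l2 inj_freq(3)]) auto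
      then show ?thesis by (simp add: fourier_cov)
    qed
    then show ?thesis unfolding A_poly_cis[abs_def]
      by (subst cov_sum_right[OF sq_int_scale[OF sq_int_cis] sq_C]) (simp only: cov_scale_right mult_zero_right sum.neutral_const)
  qed
  finally show ?thesis by simp
qed

lemma error_norm_f: "(L2norm (spec_measure f) (\<lambda>x. A x - h x))\<^sup>2
    = 1 / (2 * pi) * (LINT x|circ. (cmod (A x * of_real (g x) + C x))\<^sup>2 / (f x + g x)\<^sup>2 * f x)"
  and error_norm_g: "(L2norm (spec_measure g) h)\<^sup>2
    = 1 / (2 * pi) * (LINT x|circ. (cmod (A x * of_real (f x) - C x))\<^sup>2 / (f x + g x)\<^sup>2 * g x)"
  and error_integrable_f: "integrable circ (\<lambda>x. (cmod (A x * of_real (g x) + C x))\<^sup>2 / (f x + g x)\<^sup>2 * f x)"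
  and error_integrable_g: "integrable circ (\<lambda>x. (cmod (A x * of_real (f x) - C x))\<^sup>2 / (f x + g x)\<^sup>2 * g x)"
proof -
  have m: "(\<lambda>x. A x - h x) \<in> borel_measurable circ" by measurable
  have q: "(cmod (z / of_real (f x + g x)))\<^sup>2 = (cmod z)\<^sup>2 / (f x + g x)\<^sup>2" for z x
    by (simp only: norm_divide norm_of_real power_divide power2_abs)
  have af: "AE x in circ. (cmod (A x - h x))\<^sup>2 * f x = (cmod (A x * of_real (g x) + C x))\<^sup>2 / (f x + g x)\<^sup>2 * f x"
    using error_eq
  proof eventually_elim
    case (elim x)
    show ?case unfolding conjunct1[OF elim] q ..
  qed
  have ag: "AE x in circ. (cmod (h x))\<^sup>2 * g x = (cmod (A x * of_real (f x) - C x))\<^sup>2 / (f x + g x)\<^sup>2 * g x"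
    using error_eq
  proof eventually_elim
    case (elim x)
    show ?case unfolding conjunct2[OF elim] q ..
  qed
  have mf: "(\<lambda>x. (cmod (A x - h x))\<^sup>2 * f x) \<in> borel_measurable circ" by measurable
  have mf': "(\<lambda>x. (cmod (A x * of_real (g x) + C x))\<^sup>2 / (f x + g x)\<^sup>2 * f x) \<in> borel_measurable circ" by measurable
  have mg: "(\<lambda>x. (cmod (h x))\<^sup>2 * g x) \<in> borel_measurable circ" by measurable
  have mg': "(\<lambda>x. (cmod (A x * of_real (f x) - C x))\<^sup>2 / (f x + g x)\<^sup>2 * g x) \<in> borel_measurable circ" by measurable
  show "(L2norm (spec_measure f) (\<lambda>x. A x - h x))\<^sup>2
    = 1 / (2 * pi) * (LINT x|circ. (cmod (A x * of_real (g x) + C x))\<^sup>2 / (f x + g x)\<^sup>2 * f x)"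
    unfolding L2norm_square_spec_measure[OF f m] integral_cong_AE[OF mf mf' af] ..
  show "(L2norm (spec_measure g) h)\<^sup>2
    = 1 / (2 * pi) * (LINT x|circ. (cmod (A x * of_real (f x) - C x))\<^sup>2 / (f x + g x)\<^sup>2 * g x)"
    unfolding L2norm_square_spec_measure[OF g h_measurable] integral_cong_AE[OF mg mg' ag] ..
  show "integrable circ (\<lambda>x. (cmod (A x * of_real (g x) + C x))\<^sup>2 / (f x + g x)\<^sup>2 * f x)"
    using spectral_sq_error integrable_cong_AE[OF mf mf' af] by (simp only: sq_int_spec_measure_iff[OF f])
  show "integrable circ (\<lambda>x. (cmod (A x * of_real (f x) - C x))\<^sup>2 / (f x + g x)\<^sup>2 * g x)"
    using spectral_sq_h(2) integrable_cong_AE[OF mg mg' ag] by (simp only: sq_int_spec_measure_iff[OF g])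
qed

text \<open>Parseval's identity for \<open>C\<close> and \<open>U * C\<close>, whose coefficients at the frequencies of \<open>C\<close> are the \<open>y k\<close>.\<close>

lemma inner_y_c: "l2_inner y c = of_real (1 / (2 * pi) * (LINT x|circ. (cmod (C x))\<^sup>2 / (f x + g x)))"
proof -
  have yc: "(\<lambda>k. c k * cnj (y k)) sums (cov circ C (\<lambda>x. U x * C x) / (2 * of_real pi))"
  proof -
    have "cov circ (\<lambda>x. cis (of_int (int k + 1) * x)) (\<lambda>x. U x * C x) = 2 * of_real pi * cnj (y k)" for k
      unfolding fourier_UC[symmetric] fourier_cov by (subst cov_commute) simp
    then have "(\<lambda>k. c k * (2 * of_real pi * cnj (y k))) sums cov circ C (\<lambda>x. U x * C x)"
      using cov_trig_series_sums[OF c_l2 inj_freq(3) sq_UC] unfolding C_eq by simp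
    from sums_divide[OF this, of "2 * of_real pi"] show ?thesis by simp
  qed
  have "cov circ C (\<lambda>x. U x * C x) = of_real (LINT x|circ. (cmod (C x))\<^sup>2 / (f x + g x))"
  proof -
    have "C x * cnj (U x * C x) = of_real ((cmod (C x))\<^sup>2 / (f x + g x))" for x
    proof -
      have "C x * cnj (U x * C x) = (C x * cnj (C x)) * of_real (1 / (f x + g x))" by (simp add: U_def)
      also have "\<dots> = of_real ((cmod (C x))\<^sup>2 * (1 / (f x + g x)))" by (simp only: complex_norm_square of_real_mult)
      finally show ?thesis by simp
    qed
    then show ?thesis unfolding cov_def by (simp only: integral_complex_of_real)
  qed
  then have "(\<lambda>k. c k * cnj (y k)) sums of_real (1 / (2 * pi) * (LINT x|circ. (cmod (C x))\<^sup>2 / (f x + g x)))"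
    using yc by simp
  then have "(\<lambda>k. cnj (c k * cnj (y k))) sums cnj (of_real (1 / (2 * pi) * (LINT x|circ. (cmod (C x))\<^sup>2 / (f x + g x))))"
    by (simp only: sums_cnj)
  then show ?thesis unfolding l2_inner_def by (simp add: sums_iff mult.commute)
qed

lemma inner_Q_a: "l2_inner (mat_app (Q_mat f g N) (pad N a)) (pad N a)
    = of_real (1 / (2 * pi) * (LINT x|circ. (cmod (A x))\<^sup>2 * (f x * g x / (f x + g x))))"
proof -
  define r where "r x = f x * g x / (f x + g x)" for x
  define e where "e l k x = cis (x * (real l - real k)) * complex_of_real (r x)" for l k :: nat and x
  have [measurable]: "r \<in> borel_measurable circ" unfolding r_def[abs_def] by measurable
  have int: "integrable circ (e l k)" for l k
  proof (rule integrable_circ_AE_bounded)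
    show "AE x in circ. cmod (e l k x) \<le> K"
      using ratio_bounds by eventually_elim (simp only: e_def r_def norm_mult norm_of_real abs_of_nonneg norm_cis mult_1_left)
    show "e l k \<in> borel_measurable circ" unfolding e_def[abs_def] by measurable
  qed
  have "l2_inner (mat_app (Q_mat f g N) (pad N a)) (pad N a) = (\<Sum>l\<le>N. mat_app (Q_mat f g N) (pad N a) l * cnj (a l))"
  proof -
    have "(\<lambda>l. mat_app (Q_mat f g N) (pad N a) l * cnj (pad N a l)) sums (\<Sum>l\<le>N. mat_app (Q_mat f g N) (pad N a) l * cnj (pad N a l))"
      by (rule sums_finite) (auto simp: pad_def)
    then have "l2_inner (mat_app (Q_mat f g N) (pad N a)) (pad N a) = (\<Sum>l\<le>N. mat_app (Q_mat f g N) (pad N a) l * cnj (pad N a l))"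
      unfolding l2_inner_def by (rule sums_unique[symmetric])
    also have "\<dots> = (\<Sum>l\<le>N. mat_app (Q_mat f g N) (pad N a) l * cnj (a l))"
      by (intro sum.cong refl) (simp add: pad_def)
    finally show ?thesis .
  qed
  also have "\<dots> = (\<Sum>l\<le>N. \<Sum>k\<le>N. (LINT x|circ. a k * cnj (a l) * e l k x)) / (2 * of_real pi)"
    unfolding mat_app_pad sum_distrib_right sum_divide_distrib
    unfolding integral_mult_right_zero
    by (intro sum.cong refl) (simp add: Q_mat_def circ_mean_def e_def r_def)
  also have "(\<Sum>l\<le>N. \<Sum>k\<le>N. (LINT x|circ. a k * cnj (a l) * e l k x)) = (\<Sum>l\<le>N. LINT x|circ. (\<Sum>k\<le>N. a k * cnj (a l) * e l k x))"
    by (intro sum.cong refl Bochner_Integration.integral_sum[symmetric] integrable_mult_right int)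
  also have "\<dots> = (LINT x|circ. (\<Sum>l\<le>N. \<Sum>k\<le>N. a k * cnj (a l) * e l k x))"
    by (intro Bochner_Integration.integral_sum[symmetric] Bochner_Integration.integrable_sum integrable_mult_right int)
  also have "\<dots> = (LINT x|circ. of_real ((cmod (A x))\<^sup>2 * r x))"
    unfolding of_real_mult A_poly_square sum_distrib_right e_def by (simp only: mult.assoc)
  also have "\<dots> = of_real (LINT x|circ. (cmod (A x))\<^sup>2 * r x)" by (rule integral_complex_of_real)
  finally show ?thesis by (simp add: r_def)
qed

lemma error_inner: "complex_of_real ((L2norm (spec_measure f) (\<lambda>x. A x - h x))\<^sup>2 + (L2norm (spec_measure g) h)\<^sup>2)
    = l2_inner y c + l2_inner (mat_app (Q_mat f g N) (pad N a)) (pad N a)"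
proof -
  have i1: "integrable circ (\<lambda>x. (cmod (C x))\<^sup>2 / (f x + g x))"
  proof -
    have "AE x in circ. cmod (complex_of_real (1 / (f x + g x))) \<le> K" using U_bounded by (simp add: U_def)
    then have "AE x in circ. norm (1 / (f x + g x)) \<le> K" by (simp only: norm_of_real real_norm_def)
    from integrable_bounded_mult[OF _ _ this, of "\<lambda>x. (cmod (C x))\<^sup>2"] show ?thesis
      using sq_C by (simp add: sq_int_def)
  qed
  have i2: "integrable circ (\<lambda>x. (cmod (A x))\<^sup>2 * (f x * g x / (f x + g x)))"
  proof (rule integrable_bounded_mult)
    show "integrable circ (\<lambda>x. f x * g x / (f x + g x))"
    proof (rule integrable_circ_AE_bounded)
      show "AE x in circ. norm (f x * g x / (f x + g x)) \<le> K"
        using ratio_bounds by eventually_elim (simp only: real_norm_def abs_of_nonneg)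
    qed measurable
    show "AE x in circ. norm ((cmod (A x))\<^sup>2) \<le> (\<Sum>k\<le>N. cmod (a k))\<^sup>2"
      using A_poly_bounded by (auto intro!: power_mono)
  qed measurable
  have "(L2norm (spec_measure f) (\<lambda>x. A x - h x))\<^sup>2 + (L2norm (spec_measure g) h)\<^sup>2
      = 1 / (2 * pi) * (LINT x|circ. (cmod (A x * of_real (g x) + C x))\<^sup>2 / (f x + g x)\<^sup>2 * f x
          + (cmod (A x * of_real (f x) - C x))\<^sup>2 / (f x + g x)\<^sup>2 * g x)"
    unfolding error_norm_f error_norm_g
    by (simp only: Bochner_Integration.integral_add[OF error_integrable_f error_integrable_g] distrib_left)
  also have "(LINT x|circ. (cmod (A x * of_real (g x) + C x))\<^sup>2 / (f x + g x)\<^sup>2 * f x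
          + (cmod (A x * of_real (f x) - C x))\<^sup>2 / (f x + g x)\<^sup>2 * g x)
      = (LINT x|circ. (cmod (C x))\<^sup>2 / (f x + g x) + (cmod (A x))\<^sup>2 * (f x * g x / (f x + g x)))"
  proof (rule integral_cong_AE)
    show "AE x in circ. (cmod (A x * of_real (g x) + C x))\<^sup>2 / (f x + g x)\<^sup>2 * f x
          + (cmod (A x * of_real (f x) - C x))\<^sup>2 / (f x + g x)\<^sup>2 * g x
        = (cmod (C x))\<^sup>2 / (f x + g x) + (cmod (A x))\<^sup>2 * (f x * g x / (f x + g x))"
      using bounds by eventually_elim (intro error_density_identity, simp)
  qed measurable
  finally show ?thesis
    unfolding inner_y_c inner_Q_a of_real_add[symmetric] Bochner_Integration.integral_add[OF i1 i2]
    by (simp only: distrib_left)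
qed

end

section \<open>The optimal estimate\<close>

theorem theorem2:
  fixes M :: "'a measure"
    and \<xi> \<eta> :: "int \<Rightarrow> 'a \<Rightarrow> complex"
    and f g :: "real \<Rightarrow> real"
    and Z\<^sub>\<xi> Z\<^sub>\<eta> :: "real \<Rightarrow> 'a \<Rightarrow> complex"
    and N :: nat
    and a :: "nat \<Rightarrow> complex"
  assumes "prob_space M"
    and "stationary_with M \<xi> f" and "stationary_with M \<eta> g"
    and "uncorrelated M \<xi> \<eta>"
    and "spectral_representation M \<xi> f Z\<^sub>\<xi>" and "spectral_representation M \<eta> g Z\<^sub>\<eta>"
    and "(\<integral>\<^sup>+x. 1 / ennreal (f x + g x) \<partial>circ) < \<infinity>"
    and "l2_matrix (P_mat f g)" and "l2_invertible (P_mat f g)"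
    and "l2_matrix (R_mat f g N)" and "l2_matrix (Q_mat f g N)"
  shows "(\<exists>X. optimal_estimate M (\<lambda>m \<omega>. \<xi> m \<omega> + \<eta> m \<omega>) (A_functional N a \<xi>) X)
    \<and> (\<forall>X. optimal_estimate M (\<lambda>m \<omega>. \<xi> m \<omega> + \<eta> m \<omega>) (A_functional N a \<xi>) X \<longleftrightarrow>
          has_stoch_integral M (\<lambda>x. f x + g x) (\<lambda>t \<omega>. Z\<^sub>\<xi> t \<omega> + Z\<^sub>\<eta> t \<omega>) (spectral_char f g N a) X)
    \<and> (\<forall>X. optimal_estimate M (\<lambda>m \<omega>. \<xi> m \<omega> + \<eta> m \<omega>) (A_functional N a \<xi>) X \<longrightarrow>
          mean_square_error M (A_functional N a \<xi>) X =
            1 / (2 * pi) * (LINT x|circ.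
              (cmod (A_poly N a x * of_real (g x) + C_series f g N a x))\<^sup>2 / (f x + g x)\<^sup>2 * f x)
          + 1 / (2 * pi) * (LINT x|circ.
              (cmod (A_poly N a x * of_real (f x) - C_series f g N a x))\<^sup>2 / (f x + g x)\<^sup>2 * g x)
        \<and> complex_of_real (mean_square_error M (A_functional N a \<xi>) X) =
            l2_inner (mat_app (R_mat f g N) (pad N a))
              (l2_inverse (P_mat f g) (mat_app (R_mat f g N) (pad N a)))
          + l2_inner (mat_app (Q_mat f g N) (pad N a)) (pad N a))
    \<and> (\<forall>\<psi> \<theta>. canonical_factorization (\<lambda>x. f x + g x) \<psi> \<theta> \<longrightarrow>
          l2_matrix (\<lambda>k j. Theta_mat \<theta> j k) \<and> l2_matrix (\<lambda>k j. cnj (Theta_mat \<theta> k j)) \<and>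
          (\<forall>y\<in>l2. l2_inverse (P_mat f g) y =
             mat_app (\<lambda>k j. cnj (Theta_mat \<theta> k j)) (mat_app (\<lambda>k j. Theta_mat \<theta> j k) y)))"
proof -
  interpret signal_in_noise M \<xi> \<eta> f g Z\<^sub>\<xi> Z\<^sub>\<eta>
    by (rule signal_in_noise.intro) fact+
  obtain K where K: "AE x in circ. 0 < f x + g x \<and> f x + g x \<le> K \<and> 1 / (f x + g x) \<le> K"
    using spectral_density_bounds[OF f g assms(7-9)] by blast
  interpret B: filtering_equation f g N a K
    by (rule filtering_equation.intro) (rule f g K assms)+
  let ?h = "spectral_char f g N a" and ?Y = "A_functional N a \<xi>"
  have optimal: "optimal_estimate M \<zeta> ?Y X" if "has_stoch_integral M w Z ?h X" for X
    by (rule estimate_optimal[OF B.h_ms_tendsto that B.error_orthogonal])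
  obtain X0 where X0: "has_stoch_integral M w Z ?h X0"
    using has_stoch_integral_limit_exists[OF step_bound observation_integral B.h_ms_tendsto] by blast
  have integral: "has_stoch_integral M w Z ?h X" if X: "optimal_estimate M \<zeta> ?Y X" for X
  proof -
    have past: "sq_int M U" if "U \<in> past_space M \<zeta>" for U
      using that by (simp add: past_space_def rv_space_def)
    have "AE \<omega> in M. X0 \<omega> = X \<omega>"
      using orth_projection_unique[OF past sq_functional(1)] optimal[OF X0] X unfolding optimal_estimate_def by blast
    moreover have "X \<in> borel_measurable M"
      using X past by (auto simp: optimal_estimate_def orth_projection_def dest: sq_int_measurable)
    ultimately show ?thesis by (rule has_stoch_integral_cong_AE[OF X0])
  qed
  have mse: "mean_square_error M ?Y X = (L2norm (spec_measure f) (\<lambda>x. A_poly N a x - ?h x))\<^sup>2 + (L2norm (spec_measure g) ?h)\<^sup>2"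
    if "optimal_estimate M \<zeta> ?Y X" for X
    using error_norm[OF B.h_ms_tendsto integral[OF that], of N a] by (simp add: mean_square_error_def L2norm_square[of M])
  have error: "mean_square_error M ?Y X =
            1 / (2 * pi) * (LINT x|circ.
              (cmod (A_poly N a x * of_real (g x) + C_series f g N a x))\<^sup>2 / (f x + g x)\<^sup>2 * f x)
          + 1 / (2 * pi) * (LINT x|circ.
              (cmod (A_poly N a x * of_real (f x) - C_series f g N a x))\<^sup>2 / (f x + g x)\<^sup>2 * g x)
        \<and> complex_of_real (mean_square_error M ?Y X) =
            l2_inner (mat_app (R_mat f g N) (pad N a))
              (l2_inverse (P_mat f g) (mat_app (R_mat f g N) (pad N a)))
          + l2_inner (mat_app (Q_mat f g N) (pad N a)) (pad N a)"
    if "optimal_estimate M \<zeta> ?Y X" for X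
    unfolding mse[OF that] B.error_inner B.c_def B.y_def unfolding B.error_norm_f B.error_norm_g by blast
  have factor: "l2_matrix (\<lambda>k j. Theta_mat \<theta> j k) \<and> l2_matrix (\<lambda>k j. cnj (Theta_mat \<theta> k j)) \<and>
          (\<forall>y\<in>l2. l2_inverse (P_mat f g) y =
             mat_app (\<lambda>k j. cnj (Theta_mat \<theta> k j)) (mat_app (\<lambda>k j. Theta_mat \<theta> j k) y))"
    if fact: "canonical_factorization (\<lambda>x. f x + g x) \<psi> \<theta>" for \<psi> \<theta>
  proof (intro conjI ballI)
    note fi = factorization_inverse[OF fact spectral_densityD(2)[OF w] K]
    show T: "l2_matrix (\<lambda>k j. Theta_mat \<theta> j k)" and T': "l2_matrix (\<lambda>k j. cnj (Theta_mat \<theta> k j))"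
      by (rule fi(1), rule fi(2))
    fix y :: "nat \<Rightarrow> complex" assume y: "y \<in> l2"
    let ?x = "mat_app (\<lambda>k j. cnj (Theta_mat \<theta> k j)) (mat_app (\<lambda>k j. Theta_mat \<theta> j k) y)"
    have x: "?x \<in> l2" using T T' y by (simp add: l2_matrix_def)
    have inj: "inj_on (mat_app (P_mat f g)) l2"
      using assms(9) by (simp add: l2_invertible_def bij_betw_def)
    show "l2_inverse (P_mat f g) y = ?x"
      unfolding l2_inverse_def by (rule inv_into_f_eq[OF inj x]) (simp only: P_mat_toeplitz fi(3)[OF y])
  qed
  show ?thesis
    using X0 optimal integral error factor by blast
qed

end
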